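(* Let $I_0\subset\mathbb{R}$ be an interval, let $f\in C^{(3)}(I_0)$, and let $\mathcal{C}_f:=\{(x,f(x)):x\in I_0\}$. Let $v>1$ and assume that $\dim\{x\in I_0:f''(x)=0\}\le 2/(1+v)$. Then $$\dim\big(\mathcal{C}_f\cap\mathcal{S}^*_2(v)\big)=\frac{2}{1+v}.$$
   Context: $\dim$ denotes Hausdorff dimension. $C^{(3)}(I_0)$ is the set of three times continuously differentiable real functions on the (non-degenerate) interval $I_0$. For $x\in\mathbb{R}$ put $\|x\|=\min\{|x-m|:m\in\mathbb{Z}\}$. For $v>0$, $\mathcal{S}^*_2(v)$ is the set of $(y_1,y_2)\in\mathbb{R}^2$ for which there are infinitely many $q\in\mathbb{N}$ such that $\|qy_1\|\cdot\|qy_2\|<q^{-v}$. *)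

theory Defs
  imports "HOL-Analysis.Analysis"
begin

(* The power diam(U)^s with the conventions diam(U)^0 = 1 for nonempty U and 0 for the empty set;
   the case s = 0 is separate because 0 powr 0 = 0. *)
definition diam_pow :: "real \<Rightarrow> 'a::metric_space set \<Rightarrow> ennreal" where
  "diam_pow s U = (if U = {} then 0 else if s = 0 then 1 else ennreal (diameter U powr s))"

(* Covers consist of arbitrary sets; boundedness is required explicitly since the value of
   diameter is unspecified on unbounded sets. Finite covers are included because members of the
   sequence may be empty. *)
definition hausdorff_premeasure :: "real \<Rightarrow> real \<Rightarrow> 'a::metric_space set \<Rightarrow> ennreal" where
  "hausdorff_premeasure s \<delta> E =
     (INF U \<in> {U :: nat \<Rightarrow> 'a set. E \<subseteq> (\<Union>i. U i) \<and> (\<forall>i. bounded (U i) \<and> diameter (U i) \<le> \<delta>)}.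
        \<Sum>i. diam_pow s (U i))"

definition hausdorff_outer_measure :: "real \<Rightarrow> 'a::metric_space set \<Rightarrow> ennreal" where
  "hausdorff_outer_measure s E = (SUP \<delta> \<in> {0<..}. hausdorff_premeasure s \<delta> E)"

(* The empty set has dimension 0. *)
definition hausdorff_dim :: "'a::metric_space set \<Rightarrow> ennreal" where
  "hausdorff_dim E = (INF s \<in> {s. 0 \<le> s \<and> hausdorff_outer_measure s E = 0}. ennreal s)"

(* Derivatives are taken within I, hence one-sided at endpoints belonging to I. They are uniquely
   determined when I is a non-degenerate interval. *)
definition deriv_within :: "real set \<Rightarrow> (real \<Rightarrow> real) \<Rightarrow> real \<Rightarrow> real" where
  "deriv_within I f = (\<lambda>x. vector_derivative f (at x within I))"

definition Ck_on :: "nat \<Rightarrow> (real \<Rightarrow> real) \<Rightarrow> real set \<Rightarrow> bool" where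
  "Ck_on k f I \<longleftrightarrow>
     (\<forall>j<k. (deriv_within I ^^ j) f differentiable_on I) \<and>
     continuous_on I ((deriv_within I ^^ k) f)"

definition dist_int :: "real \<Rightarrow> real" where
  "dist_int x = infdist x \<int>"

lemma dist_int_attained: "\<exists>m::int. dist_int x = \<bar>x - of_int m\<bar>"
proof -
  have "closed (\<int> :: real set)" "(\<int> :: real set) \<noteq> {}"
    by auto
  from infdist_attains_inf[OF this, of x]
  show ?thesis by (auto simp: dist_int_def dist_real_def elim: Ints_cases)
qed

lemma dist_int_le: "dist_int x \<le> \<bar>x - of_int m\<bar>"
  using infdist_le[of "of_int m" \<int> x] by (simp add: dist_int_def dist_real_def)

definition mult_approx :: "real \<Rightarrow> (real \<times> real) set" where
  "mult_approx v =
     {(y1, y2). infinite {q::nat. q > 0 \<and>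
        dist_int (real q * y1) * dist_int (real q * y2) < real q powr (- v)}}"

end

(*
  Lower bound: since the distance to the nearest integer is at most 1/2, the curve contains, over
  each compact subinterval, a copy of the set of v-approximable numbers, whose dimension is at least
  2/(1+v) by Jarnik and Besicovitch. Given a cover of small cost one finds greedily a nested sequence
  of intervals around rationals whose intersection is a point that the cover misses.

  Upper bound: discard the zeros of f'' and a countable set, and cover the rest by countably many
  compact intervals on which f' and f'' do not vanish. A point (x, f x) of the set has infinitely many
  primitive rational approximations (p/q, r/q). With q about Q and the larger of the two errors about
  d/Q, the rational point is within about d/Q of the curve, and x lies in one of two sets of diameter
  about Q^(-1-v)/d. The number of such rational points is O(Q^e (Q + d Q^2)) for every e > 0
  (Huxley). Summing over dyadic Q and d, the s-dimensional cost converges for s > 2/(1+v).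

  Huxley's bound is obtained by induction on the exponent e. The points near a short arc of the
  curve are collinear. Arcs with few points are harmless; a line carrying many points has small
  height, and it is nearly tangent, so it corresponds to a rational point near the Legendre dual of
  the curve, to which the previous exponent is applied.
*)
theory Submission
  imports Defs
begin

section \<open>Hausdorff null sets\<close>

text \<open>The term Q in the count is unavoidable: on y = x^2 the points (k/n, k^2/n^2) with n^2
  \<le> Q already number about Q. Collinearity bounds the number of arcs by O(Q + \<delta> Q^2), but
  says nothing about how many points one arc holds; that is the obstacle. Duality lets the loss
  exponent e improve itself. If a line with leading entry \<alpha> carries K > Q^(e/2) points, then
  (K \<alpha>)^2 is O(Q^3 \<delta>) and \<alpha> \<delta> \<le> 1, hence \<alpha> is O(Q^(1 - e/3)).
  The old loss e, taken at this smaller dual height, is only a loss of e - e^2/3 in terms of Q. Half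
  of the gain pays for dyadic logarithms, which leaves e - e^2/6, and iterating this map drives e to
  0 from the trivial value 1. The dual curve has other constants, so each bound is proved for a
  whole class of functions at once; the class is defined by inequalities on the whole line, so that
  the dual needs no domain of its own.\<close>

text \<open>For \<open>s > 0\<close> a cover of small total cost automatically consists of sets of small diameter, so the
  bound on the diameters can be dropped.\<close>

definition hnull :: "real \<Rightarrow> 'a::metric_space set \<Rightarrow> bool" where
  "hnull s E \<longleftrightarrow> (\<forall>e>0. \<exists>U :: nat \<Rightarrow> 'a set. E \<subseteq> (\<Union>i. U i) \<and> (\<forall>i. bounded (U i)) \<and>
     (\<Sum>i. ennreal (diameter (U i) powr s)) \<le> ennreal e)"

lemma diam_pow_pos: "s > 0 \<Longrightarrow> diam_pow s U = ennreal (diameter U powr s)"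
  by (auto simp: diam_pow_def)

lemma suminf_ennreal_term_le: "f i \<le> (\<Sum>i. f i :: ennreal)"
  using sum_le_suminf[of f "{i}"] by (simp add: summableI)

lemma diameter_leI:
  assumes "\<And>x y. x \<in> S \<Longrightarrow> y \<in> S \<Longrightarrow> dist x y \<le> d" "0 \<le> d"
  shows "diameter S \<le> d"
  using assms by (auto simp: diameter_def intro!: cSUP_least)

lemma powr_le_imp_le:
  assumes "0 < s" "0 \<le> x" "0 \<le> (y::real)" "x powr s \<le> y powr s"
  shows "x \<le> y"
  using assms by (meson linorder_not_le powr_less_mono2)

lemma hnullE_small:
  assumes "hnull s E" "0 < s" "\<delta> > 0" "e > 0"
  obtains U :: "nat \<Rightarrow> 'a::metric_space set" where "E \<subseteq> (\<Union>i. U i)" "\<And>i. bounded (U i)"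
    "\<And>i. diameter (U i) \<le> \<delta>" "(\<Sum>i. ennreal (diameter (U i) powr s)) \<le> ennreal e"
proof -
  let ?e = "min e (\<delta> powr s)"
  have "?e > 0" using assms by simp
  then obtain U :: "nat \<Rightarrow> 'a set" where U: "E \<subseteq> (\<Union>i. U i)" "\<forall>i. bounded (U i)"
     "(\<Sum>i. ennreal (diameter (U i) powr s)) \<le> ennreal ?e"
    using assms(1) unfolding hnull_def by blast
  have "diameter (U i) \<le> \<delta>" for i
  proof -
    have "ennreal (diameter (U i) powr s) \<le> ennreal ?e"
      using suminf_ennreal_term_le[of "\<lambda>i. ennreal (diameter (U i) powr s)" i] U(3) by (rule order_trans)
    then have "diameter (U i) powr s \<le> \<delta> powr s"
      using \<open>?e > 0\<close> by (subst (asm) ennreal_le_iff) auto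
    then show ?thesis
      using powr_le_imp_le[of s "diameter (U i)" \<delta>] assms U(2) diameter_ge_0 by auto
  qed
  moreover have "(\<Sum>i. ennreal (diameter (U i) powr s)) \<le> ennreal e"
    using U(3) by (rule order_trans) (simp add: ennreal_leI)
  ultimately show thesis using that U by blast
qed

lemma hausdorff_outer_measure_eq_0_iff:
  fixes E :: "'a::metric_space set"
  assumes "s > 0"
  shows "hausdorff_outer_measure s E = 0 \<longleftrightarrow> hnull s E"
proof
  assume "hausdorff_outer_measure s E = 0"
  then have 0: "hausdorff_premeasure s 1 E = 0"
    unfolding hausdorff_outer_measure_def
    by (metis (mono_tags, lifting) SUP_upper greaterThan_iff le_zero_eq zero_less_one)
  show "hnull s E"
    unfolding hnull_def
  proof (intro allI impI)
    fix e :: real assume "e > 0"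
    then have "hausdorff_premeasure s 1 E < ennreal e" using 0 by simp
    then obtain U where "E \<subseteq> (\<Union>i. U i) \<and> (\<forall>i. bounded (U i) \<and> diameter (U i) \<le> 1)"
      "(\<Sum>i. diam_pow s (U i)) < ennreal e"
      unfolding hausdorff_premeasure_def INF_less_iff by blast
    then show "\<exists>U. E \<subseteq> (\<Union>i. U i) \<and> (\<forall>i. bounded (U i)) \<and>
        (\<Sum>i. ennreal (diameter (U i) powr s)) \<le> ennreal e"
      by (intro exI[of _ U]) (simp add: less_imp_le diam_pow_pos[OF assms])
  qed
next
  assume n: "hnull s E"
  have "hausdorff_premeasure s \<delta> E \<le> 0" if "\<delta> > 0" for \<delta>
  proof (rule ennreal_le_epsilon)
    fix e :: real assume "e > 0"
    obtain U where "E \<subseteq> (\<Union>i. U i)" "\<And>i. bounded (U i)"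
      "\<And>i. diameter (U i) \<le> \<delta>" "(\<Sum>i. ennreal (diameter (U i) powr s)) \<le> ennreal e"
      using hnullE_small[OF n assms \<open>\<delta> > 0\<close> \<open>e > 0\<close>] by blast
    then show "hausdorff_premeasure s \<delta> E \<le> 0 + ennreal e"
      unfolding hausdorff_premeasure_def
      by (intro INF_lower2[of U]) (simp_all add: diam_pow_pos[OF assms])
  qed
  then have "hausdorff_outer_measure s E \<le> 0"
    unfolding hausdorff_outer_measure_def by (intro SUP_least) auto
  then show "hausdorff_outer_measure s E = 0" by simp
qed

text \<open>At exponent 0 a nonempty set costs at least 1. The case is separate because in
  \<open>hnull\<close> a one-point set has cost \<open>0 powr 0 = 0\<close> at exponent 0.\<close>

lemma hausdorff_outer_measure_0_eq_0:
  fixes E :: "'a::metric_space set"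
  assumes "hausdorff_outer_measure 0 E = 0"
  shows "E = {}"
proof (rule ccontr)
  assume "E \<noteq> {}"
  have "(1::ennreal) \<le> hausdorff_premeasure 0 1 E"
    unfolding hausdorff_premeasure_def
  proof (rule INF_greatest)
    fix U :: "nat \<Rightarrow> 'a set"
    assume "U \<in> {U. E \<subseteq> (\<Union>i. U i) \<and> (\<forall>i. bounded (U i) \<and> diameter (U i) \<le> 1)}"
    then obtain i where "U i \<noteq> {}" using \<open>E \<noteq> {}\<close> by fastforce
    then have "1 = diam_pow 0 (U i)" by (simp add: diam_pow_def)
    also have "\<dots> \<le> (\<Sum>i. diam_pow 0 (U i))" by (rule suminf_ennreal_term_le)
    finally show "1 \<le> (\<Sum>i. diam_pow 0 (U i))" .
  qed
  also have "\<dots> \<le> hausdorff_outer_measure 0 E"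
    unfolding hausdorff_outer_measure_def by (rule SUP_upper) simp
  finally show False using assms by simp
qed

lemma hnull_subset: "hnull s E \<Longrightarrow> F \<subseteq> E \<Longrightarrow> hnull s F"
  unfolding hnull_def by (meson order_trans)

lemma hnull_mono_exponent:
  fixes E :: "'a::metric_space set"
  assumes "hnull s E" "0 < s" "s \<le> t"
  shows "hnull t E"
  unfolding hnull_def
proof (intro allI impI)
  fix e :: real assume "e > 0"
  obtain U :: "nat \<Rightarrow> 'a set" where U: "E \<subseteq> (\<Union>i. U i)" "\<And>i. bounded (U i)"
      "\<And>i. diameter (U i) \<le> 1" "(\<Sum>i. ennreal (diameter (U i) powr s)) \<le> ennreal e"
    using hnullE_small[OF assms(1,2) zero_less_one \<open>e > 0\<close>] by blast
  have "(\<Sum>i. ennreal (diameter (U i) powr t)) \<le> (\<Sum>i. ennreal (diameter (U i) powr s))"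
  proof (intro suminf_le summableI ennreal_leI)
    fix i
    show "diameter (U i) powr t \<le> diameter (U i) powr s"
    proof (cases "diameter (U i) = 0")
      case False
      then have "diameter (U i) > 0" using diameter_ge_0[OF U(2)[of i]] by linarith
      then show ?thesis using U(3)[of i] assms(3) by (simp add: powr_mono')
    qed (use assms in simp)
  qed
  also have "\<dots> \<le> ennreal e" by fact
  finally show "\<exists>U. E \<subseteq> (\<Union>i. U i) \<and> (\<forall>i. bounded (U i)) \<and>
        (\<Sum>i. ennreal (diameter (U i) powr t)) \<le> ennreal e"
    using U by blast
qed

lemma cover_from_double:
  fixes U :: "nat \<Rightarrow> nat \<Rightarrow> 'a::metric_space set"
  assumes "\<And>n i. bounded (U n i)" "(\<Sum>n. \<Sum>i. ennreal (diameter (U n i) powr s)) \<le> e"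
  shows "\<exists>V :: nat \<Rightarrow> 'a set. (\<Union>n. \<Union>i. U n i) \<subseteq> (\<Union>k. V k) \<and> (\<forall>k. bounded (V k)) \<and>
     (\<Sum>k. ennreal (diameter (V k) powr s)) \<le> e"
proof (intro exI conjI)
  define V where "V k = (case prod_decode k of (n, i) \<Rightarrow> U n i)" for k
  show "(\<Union>n. \<Union>i. U n i) \<subseteq> (\<Union>k. V k)"
  proof
    fix x assume "x \<in> (\<Union>n. \<Union>i. U n i)"
    then obtain n i where "x \<in> U n i" by blast
    then have "x \<in> V (prod_encode (n, i))" by (simp add: V_def)
    then show "x \<in> (\<Union>k. V k)" by blast
  qed
  show "\<forall>k. bounded (V k)" using assms(1) by (auto simp: V_def split: prod.split)
  have "(\<Sum>k. ennreal (diameter (V k) powr s)) = (\<Sum>n. \<Sum>i. ennreal (diameter (U n i) powr s))"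
    using suminf_ennreal_2dimen[of _ "\<lambda>(n,i). ennreal (diameter (U n i) powr s)", OF refl]
    by (simp add: V_def comp_def case_prod_unfold)
  then show "(\<Sum>k. ennreal (diameter (V k) powr s)) \<le> e" using assms(2) by simp
qed

lemma hnull_UN_nat:
  fixes A :: "nat \<Rightarrow> 'a::metric_space set"
  assumes "\<And>n. hnull s (A n)"
  shows "hnull s (\<Union>n. A n)"
  unfolding hnull_def
proof (intro allI impI)
  fix e :: real assume "e > 0"
  have "\<exists>U. \<forall>n. A n \<subseteq> (\<Union>i. U n i) \<and> (\<forall>i. bounded (U n i)) \<and>
      (\<Sum>i. ennreal (diameter (U n i) powr s)) \<le> ennreal (e * (1/2)^Suc n)"
    using assms \<open>e > 0\<close> unfolding hnull_def by (intro choice allI) auto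
  then obtain U where U: "\<And>n. A n \<subseteq> (\<Union>i. U n i)" "\<And>n i. bounded (U n i :: 'a set)"
      "\<And>n. (\<Sum>i. ennreal (diameter (U n i) powr s)) \<le> ennreal (e * (1/2)^Suc n)"
    by blast
  have "(\<Sum>n. \<Sum>i. ennreal (diameter (U n i) powr s)) \<le> (\<Sum>n. ennreal (e * (1/2)^Suc n))"
    by (intro suminf_le summableI U(3))
  also have "\<dots> = ennreal e"
  proof (rule suminf_ennreal_eq)
    show "(\<lambda>n. e * (1/2)^Suc n) sums e"
      using sums_mult[OF power_half_series, of e] by simp
  qed (use \<open>e > 0\<close> in auto)
  finally obtain V :: "nat \<Rightarrow> 'a set" where V: "(\<Union>n. \<Union>i. U n i) \<subseteq> (\<Union>k. V k)" "\<forall>k. bounded (V k)"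
     "(\<Sum>k. ennreal (diameter (V k) powr s)) \<le> ennreal e"
    using cover_from_double[of U s "ennreal e"] U(2) by blast
  have "(\<Union>n. A n) \<subseteq> (\<Union>n. \<Union>i. U n i)" using U(1) by (intro UN_mono) auto
  also note V(1)
  finally show "\<exists>U. (\<Union>n. A n) \<subseteq> (\<Union>i. U i) \<and> (\<forall>i. bounded (U i)) \<and>
        (\<Sum>i. ennreal (diameter (U i) powr s)) \<le> ennreal e"
    using V(2,3) by (intro exI[of _ V] conjI)
qed

lemma hnull_empty: "hnull s {}"
  unfolding hnull_def by (auto intro!: exI[of _ "\<lambda>_. {}"])

lemma hnull_UN_countable:
  assumes "countable I" "\<And>i. i \<in> I \<Longrightarrow> hnull s (A i)"
  shows "hnull s (\<Union>i\<in>I. A i)"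
proof (cases "I = {}")
  case False
  then have "(\<Union>i\<in>I. A i) = (\<Union>n. A (from_nat_into I n))"
    using range_from_nat_into[OF False assms(1)] by (metis image_image)
  then show ?thesis
    using hnull_UN_nat[of s "\<lambda>n. A (from_nat_into I n)"] assms(2) from_nat_into[OF False] by simp
qed (simp add: hnull_empty)

lemma hnull_Un: "hnull s A \<Longrightarrow> hnull s B \<Longrightarrow> hnull s (A \<union> B)"
  using hnull_UN_countable[of "{A, B}" s "\<lambda>x. x"] by auto

lemma hnull_countable: "countable A \<Longrightarrow> hnull s A"
proof -
  have "hnull s {x}" for x :: 'a
    unfolding hnull_def by (auto intro!: exI[of _ "\<lambda>_. {x}"])
  then show "countable A \<Longrightarrow> hnull s A"
    using hnull_UN_countable[of A s "\<lambda>x. {x}"] by simp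
qed

lemma hnull_lipschitz_image:
  fixes h :: "'a::metric_space \<Rightarrow> 'b::metric_space"
  assumes "hnull s E" "0 < s" and L: "\<And>x y. x \<in> E \<Longrightarrow> y \<in> E \<Longrightarrow> dist (h x) (h y) \<le> L * dist x y"
  shows "hnull s (h ` E)"
  unfolding hnull_def
proof (intro allI impI)
  fix e :: real assume "e > 0"
  \<comment> \<open>\<open>L\<close> may be 0 or negative; the maximum with 1 makes the division by
    \<open>M powr s\<close> legitimate.\<close>
  define M where "M = max L 1"
  have "M > 0" by (simp add: M_def)
  have LM: "dist (h x) (h y) \<le> M * dist x y" if "x \<in> E" "y \<in> E" for x y
    using L[OF that] mult_right_mono[of L M "dist x y"] by (simp add: M_def)
  obtain U :: "nat \<Rightarrow> 'a set" where U: "E \<subseteq> (\<Union>i. U i)" "\<And>i. bounded (U i)"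
      "(\<Sum>i. ennreal (diameter (U i) powr s)) \<le> ennreal (e / M powr s)"
    using assms(1) \<open>e > 0\<close> \<open>M > 0\<close> unfolding hnull_def by (metis divide_pos_pos powr_gt_zero less_irrefl)
  \<comment> \<open>The cover is cut down to \<open>E\<close>, where alone the Lipschitz bound is
    assumed.\<close>
  have d: "dist x y \<le> M * diameter (U i)" if xy: "x \<in> h ` (U i \<inter> E)" "y \<in> h ` (U i \<inter> E)" for i x y
  proof -
    from xy obtain x' y' where *: "x' \<in> U i \<inter> E" "y' \<in> U i \<inter> E" "x = h x'" "y = h y'" by auto
    have "dist x y \<le> M * dist x' y'" using LM * by auto
    also have "\<dots> \<le> M * diameter (U i)"
      using diameter_bounded_bound[OF U(2), of x' i y'] * \<open>M > 0\<close> by auto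
    finally show ?thesis .
  qed
  have "E = (\<Union>i. U i \<inter> E)" using U(1) by blast
  then have "h ` E \<subseteq> (\<Union>i. h ` (U i \<inter> E))" by blast
  moreover have bdd: "bounded (h ` (U i \<inter> E))" for i
    unfolding bounded_any_center[where a = "h (SOME z. z \<in> U i \<inter> E)"] 
    by (metis d empty_iff image_is_empty imageI some_in_eq)
  moreover have "(\<Sum>i. ennreal (diameter (h ` (U i \<inter> E)) powr s)) \<le> ennreal e"
  proof -
    have "diameter (h ` (U i \<inter> E)) \<le> M * diameter (U i)" for i
      using d \<open>M > 0\<close> diameter_ge_0[OF U(2), of i] by (intro diameter_leI) auto
    then have "diameter (h ` (U i \<inter> E)) powr s \<le> (M * diameter (U i)) powr s" for i
      using bdd diameter_ge_0 \<open>0 < s\<close> by (intro powr_mono2) auto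
    then have "(\<Sum>i. ennreal (diameter (h ` (U i \<inter> E)) powr s)) \<le>
        (\<Sum>i. ennreal (M powr s) * ennreal (diameter (U i) powr s))"
      using \<open>M > 0\<close> diameter_ge_0[OF U(2)]
      by (intro suminf_le summableI) (simp add: powr_mult ennreal_leI flip: ennreal_mult')
    also have "\<dots> = ennreal (M powr s) * (\<Sum>i. ennreal (diameter (U i) powr s))"
      by simp
    also have "\<dots> \<le> ennreal (M powr s) * ennreal (e / M powr s)"
      by (intro mult_left_mono U(3)) auto
    also have "\<dots> = ennreal e" using \<open>M > 0\<close> \<open>e > 0\<close> by (simp flip: ennreal_mult')
    finally show ?thesis .
  qed
  ultimately show "\<exists>U. h ` E \<subseteq> (\<Union>i. U i) \<and> (\<forall>i. bounded (U i)) \<and>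
        (\<Sum>i. ennreal (diameter (U i) powr s)) \<le> ennreal e"
    by (intro exI[of _ "\<lambda>i. h ` (U i \<inter> E)"]) auto
qed

lemma hausdorff_dim_leI:
  assumes "d \<ge> 0" "\<And>s. s > d \<Longrightarrow> hnull s E"
  shows "hausdorff_dim E \<le> ennreal d"
proof (rule ennreal_le_epsilon)
  fix e :: real assume "e > 0"
  have "hausdorff_outer_measure (d + e) E = 0"
    using hausdorff_outer_measure_eq_0_iff[of "d + e" E] assms \<open>e > 0\<close> by simp
  then show "hausdorff_dim E \<le> ennreal d + ennreal e"
    unfolding hausdorff_dim_def using assms \<open>e > 0\<close>
    by (intro INF_lower2[of "d + e"]) auto
qed

lemma hausdorff_dim_le_imp_hnull:
  assumes "hausdorff_dim E \<le> ennreal d" "s > d" "d \<ge> 0"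
  shows "hnull s E"
proof -
  have "hausdorff_dim E < ennreal s"
    using assms by (meson ennreal_less_iff order_le_less_trans)
  then obtain t where t: "t \<ge> 0" "hausdorff_outer_measure t E = 0" "ennreal t < ennreal s"
    unfolding hausdorff_dim_def INF_less_iff by auto
  show ?thesis
  proof (cases "t = 0")
    case True
    then show ?thesis using hausdorff_outer_measure_0_eq_0 t hnull_empty by metis
  next
    case False
    then show ?thesis using hausdorff_outer_measure_eq_0_iff[of t E] t hnull_mono_exponent[of t E s]
      by (simp add: ennreal_less_iff)
  qed
qed

lemma hausdorff_dim_geI:
  assumes "d > 0" "\<And>s. 0 < s \<Longrightarrow> s < d \<Longrightarrow> \<not> hnull s E"
  shows "ennreal d \<le> hausdorff_dim E"
  unfolding hausdorff_dim_def
proof (rule INF_greatest, clarify)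
  fix s :: real assume s: "0 \<le> s" "hausdorff_outer_measure s E = 0"
  \<comment> \<open>For s = 0 the set would be empty, hence null at exponent d/2, which the
    hypothesis excludes.\<close>
  have "s \<noteq> 0"
    using s hausdorff_outer_measure_0_eq_0[of E] hnull_empty[of "d/2"] assms(2)[of "d/2"] \<open>d > 0\<close> by force
  then have "hnull s E" using hausdorff_outer_measure_eq_0_iff[of s E] s by simp
  then have "d \<le> s" using assms(2)[of s] s \<open>s \<noteq> 0\<close> by force
  then show "ennreal d \<le> ennreal s" by (simp add: ennreal_leI)
qed

section \<open>The lower bound\<close>

text \<open>Cells of length \<sigma>, counted from \<open>a\<close>, hold at most one point of
  \<open>X\<close> each.\<close>

lemma separated_set_card:
  fixes X :: "real set"
  assumes sep: "\<And>x y. x \<in> X \<Longrightarrow> y \<in> X \<Longrightarrow> x \<noteq> y \<Longrightarrow> \<sigma> \<le> \<bar>x - y\<bar>"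
    and X: "X \<subseteq> {a..b}" and "a \<le> b" "0 < \<sigma>"
  shows "finite X" "real (card X) \<le> (b - a) / \<sigma> + 1"
proof -
  define \<phi> where "\<phi> x = \<lfloor>(x - a) / \<sigma>\<rfloor>" for x
  have inj: "inj_on \<phi> X"
  proof (rule inj_onI, rule ccontr)
    fix x y assume xy: "x \<in> X" "y \<in> X" "\<phi> x = \<phi> y" "x \<noteq> y"
    then have "\<bar>(x - a) / \<sigma> - (y - a) / \<sigma>\<bar> < 1" unfolding \<phi>_def by linarith
    then have "\<bar>x - y\<bar> < \<sigma>" using \<open>0 < \<sigma>\<close> by (simp add: abs_less_iff field_simps)
    then show False using sep[OF xy(1,2,4)] by simp
  qed
  have sub: "\<phi> ` X \<subseteq> {0..\<lfloor>(b - a) / \<sigma>\<rfloor>}"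
  proof
    fix z assume "z \<in> \<phi> ` X"
    then obtain x where "x \<in> X" "z = \<phi> x" by blast
    then have "0 \<le> (x - a) / \<sigma>" "(x - a) / \<sigma> \<le> (b - a) / \<sigma>"
      using X \<open>0 < \<sigma>\<close> by (auto intro!: divide_right_mono)
    then show "z \<in> {0..\<lfloor>(b - a) / \<sigma>\<rfloor>}"
      unfolding \<open>z = \<phi> x\<close> \<phi>_def by (auto intro: floor_mono)
  qed
  show "finite X" using inj_on_finite[OF inj sub] by simp
  have "card X = card (\<phi> ` X)" using inj by (simp add: card_image)
  also have "\<dots> \<le> card {0..\<lfloor>(b - a) / \<sigma>\<rfloor>}" using sub by (intro card_mono) auto
  finally have "card X \<le> nat (\<lfloor>(b - a) / \<sigma>\<rfloor> + 1)" by simp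
  moreover have "0 \<le> (b - a) / \<sigma>" using assms by simp
  ultimately show "real (card X) \<le> (b - a) / \<sigma> + 1" by linarith
qed

lemma card_ints_in_interval:
  fixes A :: "int set"
  assumes "\<And>n. n \<in> A \<Longrightarrow> a \<le> real_of_int n \<and> real_of_int n \<le> b" "a \<le> b"
  shows "finite A" "real (card A) \<le> b - a + 1"
proof -
  let ?X = "real_of_int ` A"
  have 1: "(1::real) \<le> \<bar>x - y\<bar>" if xy: "x \<in> ?X" "y \<in> ?X" "x \<noteq> y" for x y
  proof -
    obtain m n where "x = real_of_int m" "y = real_of_int n" using xy by auto
    moreover from this have "m \<noteq> n" using xy(3) by auto
    then have "1 \<le> \<bar>m - n\<bar>" by linarith
    ultimately show ?thesis by linarith
  qed
  have inj: "inj_on real_of_int A" by (auto simp: inj_on_def)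
  have "?X \<subseteq> {a..b}" using assms by auto
  note * = separated_set_card[of ?X 1, OF 1 this \<open>a \<le> b\<close>]
  show "finite A" using *(1) inj by (simp add: finite_image_iff)
  show "real (card A) \<le> b - a + 1" using *(2) inj by (simp add: card_image)
qed

lemma card_nats_in_interval:
  fixes A :: "nat set"
  assumes "\<And>n. n \<in> A \<Longrightarrow> a \<le> real n \<and> real n \<le> b" "a \<le> b"
  shows "finite A" "real (card A) \<le> b - a + 1"
proof -
  have *: "finite (int ` A)" "real (card (int ` A)) \<le> b - a + 1"
    by (rule card_ints_in_interval; use assms in auto)+
  show "finite A" using *(1) by (simp add: finite_image_iff)
  show "real (card A) \<le> b - a + 1" using *(2) by (simp add: card_image)
qed

text \<open>The difference has a nonzero integer as numerator and a denominator of at most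
  N^2.\<close>

lemma rationals_separated:
  fixes p p' :: int and q q' N :: nat
  assumes "real_of_int p / real q \<noteq> real_of_int p' / real q'" "0 < q" "q \<le> N" "0 < q'" "q' \<le> N"
  shows "1 / (real N)^2 \<le> \<bar>real_of_int p / real q - real_of_int p' / real q'\<bar>"
proof -
  have eq: "real_of_int p / real q - real_of_int p' / real q' =
      real_of_int (p * int q' - p' * int q) / (real q * real q')"
    using assms by (simp add: field_simps)
  have "p * int q' - p' * int q \<noteq> 0"
  proof
    assume "p * int q' - p' * int q = 0"
    then have "real_of_int p / real q - real_of_int p' / real q' = 0" by (simp only: eq)
    then show False using assms(1) by simp
  qed
  then have "1 \<le> \<bar>real_of_int (p * int q' - p' * int q)\<bar>" by linarith
  then have "1 / (real q * real q') \<le> \<bar>real_of_int (p * int q' - p' * int q)\<bar> / (real q * real q')"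
    using assms by (intro divide_right_mono) auto
  moreover have "real q * real q' \<le> (real N)^2"
    using assms by (auto simp: power2_eq_square intro!: mult_mono)
  then have "1 / (real N)^2 \<le> 1 / (real q * real q')"
    using assms by (intro divide_left_mono) auto
  ultimately show ?thesis unfolding eq by simp
qed

text \<open>A crude bound, by telescoping. It is enough that the sum is o(n), because it is compared
  with a main term that is larger by a factor of order N.\<close>

lemma sum_inverse_le_sqrt: "(\<Sum>q=1..n. 1 / real q) \<le> 2 * sqrt (real n)"
proof (induction n)
  case (Suc n)
  have *: "(sqrt (real n) - sqrt (real (Suc n)))^2 \<ge> 0" by simp
  have "1 / real (Suc n) \<le> 2 * (sqrt (real (Suc n)) - sqrt (real n))"
  proof -
    let ?a = "sqrt (real n)" and ?b = "sqrt (real (Suc n))"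
    have ab: "?b^2 = ?a^2 + 1" "?a \<ge> 0" "?b \<ge> 1" "?a \<le> ?b" by auto
    have "(?b - ?a) * (?b + ?a) = 1" using ab(1) by (simp add: algebra_simps power2_eq_square)
    moreover have "?b + ?a \<noteq> 0" using ab by linarith
    ultimately have "1 / (?b + ?a) = ?b - ?a" by (metis nonzero_eq_divide_eq)
    moreover have "1 / (2 * ?b) \<le> 1 / (?b + ?a)" using ab by (intro divide_left_mono mult_pos_pos) linarith+
    moreover have "1 / ?b^2 \<le> 1 / ?b"
      using ab(3) mult_right_mono[of 1 ?b ?b] by (intro divide_left_mono) (auto simp: power2_eq_square simp del: real_sqrt_mult_self of_nat_Suc)
    ultimately have "1 / ?b^2 \<le> 2 * (?b - ?a)" by simp
    then show ?thesis by simp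
  qed
  then show ?case using Suc by simp
qed simp

text \<open>Apply Dirichlet's theorem at the points of a grid of mesh \<open>32 / N\<^sup>2\<close>. Few grid points get a
  denominator at most \<open>N / 16\<close>, and the remaining ones get pairwise distinct fractions.\<close>

lemma many_rationals_in_interval:
  fixes x0 r :: real
  assumes "r > 0"
  shows "\<exists>N0. \<forall>N\<ge>N0. \<exists>P. finite P \<and> (r / 64 * (real N)^2 \<le> real (card P)) \<and>
     (\<forall>y\<in>P. x0 - 1 / real N \<le> y \<and> y \<le> x0 + r + 1 / real N \<and>
        (\<exists>p::int. \<exists>q::nat. real N / 16 < real q \<and> q \<le> N \<and> y = real_of_int p / real q))"
proof -
  \<comment> \<open>This threshold makes \<open>sqrt N * r\<close> at least 384 + 16 r, so that
    N^(3/2) is at most r N^2 / 384.\<close>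
  obtain N0 :: nat where N0: "real N0 > (384/r + 16)^2" using reals_Archimedean2 by blast
  have "\<exists>P. finite P \<and> (r / 64 * (real N)^2 \<le> real (card P)) \<and>
     (\<forall>y\<in>P. x0 - 1 / real N \<le> y \<and> y \<le> x0 + r + 1 / real N \<and>
        (\<exists>p::int. \<exists>q::nat. real N / 16 < real q \<and> q \<le> N \<and> y = real_of_int p / real q))"
    if "N \<ge> N0" for N
  proof -
    have NN: "real N > (384/r + 16)^2" using N0 that by linarith
    then have "sqrt (real N) > 384/r + 16" using \<open>r > 0\<close> by (intro real_less_rsqrt) auto
    then have sN: "sqrt (real N) * r \<ge> 384 + 16 * r" using \<open>r > 0\<close> by (simp add: field_simps)
    have N1: "real N \<ge> 1"
    proof -
      have "(384/r + 16)^2 \<ge> 1" using \<open>r > 0\<close> by (intro one_le_power) auto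
      then show ?thesis using NN by linarith
    qed
    then have "N > 0" by simp
    \<comment> \<open>A fraction with denominator above N/16 lies within 16 / N^2 = h / 2 of its
      grid point, so it cannot serve two grid points.\<close>
    define h where "h = 32 / (real N)^2"
    have "h > 0" using N1 by (simp add: h_def)
    define n where "n = nat \<lfloor>r / h\<rfloor>"
    define x where "x j = x0 + real j * h" for j
    have "\<exists>p q. \<forall>j. 0 < q j \<and> q j \<le> N \<and> \<bar>real (q j) * x j - real_of_int (p j)\<bar> < 1 / real N"
    proof -
      have "\<exists>q p. 0 < q \<and> q \<le> N \<and> \<bar>real q * x j - real_of_int p\<bar> < 1 / real N" for j
      proof -
        obtain a k where "0 < k" "k \<le> int N" "\<bar>of_int k * x j - of_int a\<bar> < 1 / real N"
          using Dirichlet_approx[OF \<open>N > 0\<close>, of "x j"] by metis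
        then show ?thesis by (intro exI[of _ "nat k"] exI[of _ a]) auto
      qed
      then show ?thesis by metis
    qed
    then obtain p :: "nat \<Rightarrow> int" and q :: "nat \<Rightarrow> nat" where
      pq: "\<And>j. 0 < q j" "\<And>j. q j \<le> N" "\<And>j. \<bar>real (q j) * x j - real_of_int (p j)\<bar> < 1 / real N"
      by blast
    define y where "y j = real_of_int (p j) / real (q j)" for j
    have y: "\<bar>x j - y j\<bar> < 1 / (real (q j) * real N)" for j
    proof -
      have "\<bar>x j - y j\<bar> = \<bar>real (q j) * x j - real_of_int (p j)\<bar> / real (q j)"
        using pq(1)[of j] by (simp add: y_def field_simps abs_if)
      also have "\<dots> < (1 / real N) / real (q j)" using pq by (intro divide_strict_right_mono) auto
      finally show ?thesis by (simp add: field_simps)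
    qed
    have y1: "\<bar>x j - y j\<bar> < 1 / real N" for j
    proof -
      have "1 / (real (q j) * real N) \<le> 1 / real N" using pq(1)[of j] N1
        by (intro divide_left_mono) auto
      then show ?thesis using y[of j] by simp
    qed
    have xr: "x0 \<le> x j" "x j \<le> x0 + r" if "j < n" for j
    proof -
      have "real j \<le> r / h" using that unfolding n_def by linarith
      then show "x0 \<le> x j" "x j \<le> x0 + r" using \<open>h > 0\<close> by (auto simp: x_def field_simps)
    qed
    define G where "G = {j. j < n \<and> real N / 16 < real (q j)}"
    define Bd where "Bd = {j. j < n \<and> real (q j) \<le> real N / 16}"
    have nGB: "n = card G + card Bd"
    proof -
      have "{..<n} = G \<union> Bd" "G \<inter> Bd = {}" by (auto simp: G_def Bd_def)
      moreover have "finite G" "finite Bd" by (auto simp: G_def Bd_def)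
      ultimately show ?thesis by (metis card_Un_disjoint card_lessThan)
    qed
    have inj: "inj_on y G"
    proof (rule inj_onI, rule ccontr)
      fix i j assume ij: "i \<in> G" "j \<in> G" "y i = y j" "i \<noteq> j"
      have *: "\<bar>x i - y i\<bar> < h / 2" if "i \<in> G" for i
      proof -
        have "real N * real N / 16 \<le> real (q i) * real N" using that N1 by (simp add: G_def)
        then have "1 / (real (q i) * real N) \<le> 1 / (real N * real N / 16)"
          using N1 pq(1)[of i] by (intro divide_left_mono) auto
        then show ?thesis using y[of i] by (simp add: h_def power2_eq_square)
      qed
      have "\<bar>x i - x j\<bar> < h" using *[OF ij(1)] *[OF ij(2)] ij(3) by linarith
      moreover have "\<bar>x i - x j\<bar> = \<bar>real i - real j\<bar> * h"
        using \<open>h > 0\<close> by (simp add: x_def abs_mult flip: left_diff_distrib)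
      moreover have "\<bar>real i - real j\<bar> \<ge> 1" using ij(4) by linarith
      ultimately show False using \<open>h > 0\<close> mult_right_mono[of 1 "\<bar>real i - real j\<bar>" h] by linarith
    qed
    define m where "m = nat \<lfloor>real N / 16\<rfloor>"
    \<comment> \<open>A grid point with denominator k \<le> N/16 lies within 1 / (k N) of some a /
      k, and only about k r numerators a are possible; a union bound over k and a is good
      enough.\<close>
    have Bsub: "Bd \<subseteq> (\<Union>k\<in>{1..m}. \<Union>a\<in>{a::int. real k * x0 - 1 \<le> a \<and> a \<le> real k * (x0 + r) + 1}.
        {j. \<bar>x j - real_of_int a / real k\<bar> < 1 / (real k * real N)})"
    proof
      fix j assume j: "j \<in> Bd"
      have "q j \<in> {1..m}" using j pq(1)[of j] by (auto simp: Bd_def m_def le_nat_floor)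
      moreover have "real (q j) * x0 - 1 \<le> p j \<and> p j \<le> real (q j) * (x0 + r) + 1"
      proof -
        have "1 / real N \<le> 1" using N1 by simp
        then have "\<bar>real (q j) * x j - real_of_int (p j)\<bar> \<le> 1" using pq(3)[of j] by linarith
        moreover have "real (q j) * x0 \<le> real (q j) * x j" "real (q j) * x j \<le> real (q j) * (x0 + r)"
          using xr[of j] j by (auto simp: Bd_def intro!: mult_left_mono)
        ultimately show ?thesis by linarith
      qed
      moreover have "\<bar>x j - real_of_int (p j) / real (q j)\<bar> < 1 / (real (q j) * real N)"
        using y[of j] by (simp add: y_def)
      ultimately show "j \<in> (\<Union>k\<in>{1..m}. \<Union>a\<in>{a::int. real k * x0 - 1 \<le> a \<and> a \<le> real k * (x0 + r) + 1}.
        {j. \<bar>x j - real_of_int a / real k\<bar> < 1 / (real k * real N)})" by blast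
    qed
    have c1: "finite {j. \<bar>x j - z\<bar> < 1 / (real k * real N)}"
        "real (card {j. \<bar>x j - z\<bar> < 1 / (real k * real N)}) \<le> real N / (8 * real k)"
      if "k \<in> {1..m}" for k z
    proof -
      have k: "1 \<le> real k" "real k \<le> real N / 16" using that by (auto simp: m_def) linarith
      let ?A = "{j. \<bar>x j - z\<bar> < 1 / (real k * real N)}"
      have *: "(z - 1 / (real k * real N) - x0) / h \<le> real j \<and> real j \<le> (z + 1 / (real k * real N) - x0) / h"
        if "j \<in> ?A" for j
      proof -
        have "\<bar>x0 + real j * h - z\<bar> < 1 / (real k * real N)" using that by (simp add: x_def)
        then have "z - 1 / (real k * real N) - x0 \<le> real j * h" "real j * h \<le> z + 1 / (real k * real N) - x0"
          by linarith+
        then show ?thesis using \<open>h > 0\<close> by (simp add: pos_divide_le_eq pos_le_divide_eq)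
      qed
      have **: "(z - 1 / (real k * real N) - x0) / h \<le> (z + 1 / (real k * real N) - x0) / h"
        using \<open>h > 0\<close> by (intro divide_right_mono) auto
      note cc = card_nats_in_interval[of ?A, OF * **]
      show "finite ?A" by (rule cc(1))
      have "real (card ?A) \<le> (z + 1 / (real k * real N) - x0) / h - (z - 1 / (real k * real N) - x0) / h + 1"
        by (rule cc(2))
      also have "\<dots> = 2 * (1 / (real k * real N)) / h + 1" using \<open>h > 0\<close> by (simp add: field_simps)
      also have "\<dots> = real N / (16 * real k) + 1"
        using N1 k by (simp add: h_def power2_eq_square)
      \<comment> \<open>The bound k \<le> N/16 lets the main term absorb the 1 of the integer
        count.\<close>
      also have "1 \<le> real N / (16 * real k)" using k by (simp add: field_simps)
      finally show "real (card ?A) \<le> real N / (8 * real k)" by (simp add: field_simps)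
    qed
    have c2: "finite {a::int. real k * x0 - 1 \<le> a \<and> a \<le> real k * (x0 + r) + 1}"
       "real (card {a::int. real k * x0 - 1 \<le> a \<and> a \<le> real k * (x0 + r) + 1}) \<le> real k * r + 3" for k :: nat
    proof -
      have *: "real k * x0 - 1 \<le> real k * (x0 + r) + 1" using \<open>r > 0\<close> by (simp add: algebra_simps)
      let ?A = "{a::int. real k * x0 - 1 \<le> a \<and> a \<le> real k * (x0 + r) + 1}"
      have **: "real k * x0 - 1 \<le> real_of_int n \<and> real_of_int n \<le> real k * (x0 + r) + 1" if "n \<in> ?A" for n
        using that by simp
      note cc = card_ints_in_interval[of ?A, OF ** *]
      show "finite ?A" by (rule cc(1))
      show "real (card ?A) \<le> real k * r + 3" using cc(2) by (simp add: algebra_simps)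
    qed
    have "real (card Bd) \<le> (\<Sum>k=1..m. (real k * r + 3) * (real N / (8 * real k)))"
    proof -
      let ?I = "\<lambda>k::nat. {a::int. real k * x0 - 1 \<le> a \<and> a \<le> real k * (x0 + r) + 1}"
      let ?J = "\<lambda>k a. {j. \<bar>x j - real_of_int a / real k\<bar> < 1 / (real k * real N)}"
      have "card Bd \<le> card (\<Union>k\<in>{1..m}. \<Union>a\<in>?I k. ?J k a)"
        using Bsub c1(1) c2(1) by (intro card_mono) auto
      also have "\<dots> \<le> (\<Sum>k\<in>{1..m}. card (\<Union>a\<in>?I k. ?J k a))"
        by (intro card_UN_le) auto
      also have "\<dots> \<le> (\<Sum>k\<in>{1..m}. \<Sum>a\<in>?I k. card (?J k a))"
        by (intro sum_mono card_UN_le c2(1))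
      finally have "real (card Bd) \<le> (\<Sum>k\<in>{1..m}. \<Sum>a\<in>?I k. real (card (?J k a)))"
        by (simp flip: of_nat_sum)
      also have "\<dots> \<le> (\<Sum>k\<in>{1..m}. \<Sum>a\<in>?I k. real N / (8 * real k))"
        by (intro sum_mono c1(2))
      also have "\<dots> = (\<Sum>k\<in>{1..m}. real (card (?I k)) * (real N / (8 * real k)))"
        by simp
      also have "\<dots> \<le> (\<Sum>k\<in>{1..m}. (real k * r + 3) * (real N / (8 * real k)))"
        by (intro sum_mono mult_right_mono c2(2)) auto
      finally show ?thesis .
    qed
    also have "\<dots> = (\<Sum>k=1..m. r * real N / 8 + 3 * real N / 8 * (1 / real k))"
      by (intro sum.cong refl) (simp add: field_simps)
    also have "\<dots> = real m * (r * real N / 8) + 3 * real N / 8 * (\<Sum>k=1..m. 1 / real k)"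
      by (simp only: sum.distrib sum_distrib_left) simp
    also have "\<dots> \<le> real N / 16 * (r * real N / 8) + 3 * real N / 8 * (2 * sqrt (real N))"
    proof -
      have "real m \<le> real N / 16" unfolding m_def by linarith
      then have "m \<le> N" by linarith
      then have "(\<Sum>k=1..m. 1 / real k) \<le> 2 * sqrt (real N)"
        using sum_inverse_le_sqrt[of m] by (meson mult_left_mono of_nat_le_iff order_trans real_sqrt_le_mono zero_le_numeral)
      then show ?thesis using \<open>real m \<le> real N / 16\<close> \<open>r > 0\<close> N1
        by (intro add_mono mult_left_mono mult_right_mono) auto
    qed
    finally have B: "real (card Bd) \<le> r * (real N)^2 / 128 + 3 / 4 * (real N * sqrt (real N))"
      by (simp add: power2_eq_square mult_ac)
    have n: "real n \<ge> r * (real N)^2 / 32 - 1" unfolding n_def h_def using \<open>r > 0\<close> N1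
      by (simp add: field_simps) linarith
    have Nsq: "real N = sqrt (real N) * sqrt (real N)" by simp
    have s1: "real N * sqrt (real N) * 384 \<le> r * (real N)^2"
    proof -
      have "384 * (real N * sqrt (real N)) \<le> (sqrt (real N) * r) * (real N * sqrt (real N))"
        using sN \<open>r > 0\<close> N1 by (intro mult_right_mono) auto
      also have "\<dots> = r * real N * (sqrt (real N) * sqrt (real N))" by (simp add: algebra_simps)
      finally show ?thesis by (simp add: power2_eq_square algebra_simps)
    qed
    have s2: "1 \<le> real N * sqrt (real N)"
      using N1 mult_mono[of 1 "real N" 1 "sqrt (real N)"] by simp
    \<comment> \<open>In multiples of r N^2: the grid has 1/32, the main term of the bad points
      takes 1/128, and the rest is at most 7/4 N^(3/2), hence 7/1536. This leaves 29/1536, which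
      exceeds 1/64.\<close>
    have "real (card G) \<ge> r / 64 * (real N)^2"
      using nGB B n s1 s2 by simp
    moreover have "card (y ` G) = card G" using inj by (rule card_image)
    ultimately have "r / 64 * (real N)^2 \<le> real (card (y ` G))" by simp
    moreover have "finite (y ` G)" by (simp add: G_def)
    moreover have "\<forall>z\<in>y ` G. x0 - 1 / real N \<le> z \<and> z \<le> x0 + r + 1 / real N \<and>
        (\<exists>p::int. \<exists>q::nat. real N / 16 < real q \<and> q \<le> N \<and> z = real_of_int p / real q)"
    proof
      fix z assume "z \<in> y ` G"
      then obtain j where j: "j \<in> G" "z = y j" by blast
      have "x0 - 1 / real N \<le> z" "z \<le> x0 + r + 1 / real N"
        using xr[of j] y1[of j] j by (auto simp: G_def)
      moreover have "real N / 16 < real (q j)" "q j \<le> N" "z = real_of_int (p j) / real (q j)"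
        using j pq(2) by (auto simp: G_def y_def)
      ultimately show "x0 - 1 / real N \<le> z \<and> z \<le> x0 + r + 1 / real N \<and>
        (\<exists>p::int. \<exists>q::nat. real N / 16 < real q \<and> q \<le> N \<and> z = real_of_int p / real q)" by blast
    qed
    ultimately show ?thesis by blast
  qed
  then show ?thesis by blast
qed

section \<open>Loads of a cover and the Jarnik-Besicovitch lower bound\<close>

text \<open>In use, \<open>d i\<close> is a positive upper bound of the diameter of
  \<open>U i\<close>. Positivity matters even for one-point sets: a member that meets every interval
  of a nested sequence keeps all loads at or above the same positive number
  \<open>d i powr s\<close>.\<close>

definition load :: "real \<Rightarrow> (nat \<Rightarrow> real set) \<Rightarrow> (nat \<Rightarrow> real) \<Rightarrow> real set \<Rightarrow> real" where
  "load s U d B = (\<Sum>i. of_bool (U i \<inter> B \<noteq> {}) * d i powr s)"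

lemma summable_load:
  assumes "summable (\<lambda>i. d i powr s)"
  shows "summable (\<lambda>i. of_bool (P i) * (d i :: real) powr s)"
  by (rule summable_comparison_test'[OF assms, of 0]) auto

text \<open>Sets of diameter at least \<open>1 / N\<^sup>2\<close> have small total diameter by the hypothesis on the load
  (this is where \<open>s < 1\<close> enters), so they spoil only a fixed proportion of the candidate balls; any
  other set meets at most three of them, so some unspoilt ball has at most the average load.\<close>

lemma load_descend:
  fixes U :: "nat \<Rightarrow> real set" and d :: "nat \<Rightarrow> real"
  assumes sv: "0 < s" "s < 2 / (1 + v)" "v > 1"
    and bU: "\<And>i. bounded (U i)" and dU: "\<And>i. diameter (U i) \<le> d i" and d0: "\<And>i. 0 < d i"
    and sm: "summable (\<lambda>i. d i powr s)"
    and r: "r > 0" and ld: "load s U d {x0..x0+r} \<le> (r / 1536) powr s"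
  shows "\<exists>x1 r1. {x1..x1+r1} \<subseteq> {x0..x0+r} \<and> 0 < r1 \<and> r1 \<le> r / 2 \<and>
     load s U d {x1..x1+r1} \<le> (r1 / 1536) powr s \<and>
     (\<exists>p::int. \<exists>q::nat. q \<ge> M \<and> q > 0 \<and>
        (\<forall>z\<in>{x1..x1+r1}. \<bar>real q * z - real_of_int p\<bar> < real q powr (-v)))"
proof -
  have s2: "s * (1 + v) < 2" using sv by (simp add: field_simps)
  have s1: "s < 1"
  proof (rule ccontr)
    assume "\<not> s < 1"
    then have "1 * (1 + v) \<le> s * (1 + v)" using sv by (intro mult_right_mono) auto
    then have "1 + v < 2" using s2 by simp
    then show False using sv by simp
  qed
  define \<eta> where "\<eta> = (1 / 1536 :: real) powr s"
  have "\<eta> > 0" by (simp add: \<eta>_def)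
  have etar: "(t / 1536) powr s = \<eta> * t powr s" if "t \<ge> 0" for t
    using powr_mult[of "1/1536" t s] that by (simp add: \<eta>_def)
  \<comment> \<open>Only the middle half of the interval is used, so that the fractions keep a
    distance r/8 from its ends and the balls around them fit in.\<close>
  obtain N0 where N0: "\<And>N. N \<ge> N0 \<Longrightarrow> \<exists>P. finite P \<and> ((r/2) / 64 * (real N)^2 \<le> real (card P)) \<and>
     (\<forall>y\<in>P. (x0+r/4) - 1 / real N \<le> y \<and> y \<le> (x0+r/4) + r/2 + 1 / real N \<and>
        (\<exists>p::int. \<exists>q::nat. real N / 16 < real q \<and> q \<le> N \<and> y = real_of_int p / real q))"
    using many_rationals_in_interval[of "r/2" "x0+r/4"] r by auto
  \<comment> \<open>The exponent 2 - s (1 + v) is positive because s < 2 / (1 + v). The number 768 =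
    3 * 256 comes from the averaging at the end.\<close>
  have "eventually (\<lambda>N. real N > (768 * r powr (s - 1)) powr (1 / (2 - s * (1 + v)))) sequentially"
    using filterlim_real_sequentially by (simp add: filterlim_at_top_dense)
  then have "eventually (\<lambda>N. real N powr (2 - s * (1 + v)) > 768 * r powr (s - 1)) sequentially"
  proof eventually_elim
    case (elim N)
    then have "((768 * r powr (s - 1)) powr (1 / (2 - s * (1 + v)))) powr (2 - s * (1 + v)) <
        real N powr (2 - s * (1 + v))"
      using s2 by (intro powr_less_mono2) auto
    then show ?case using s2 r by (simp add: powr_powr)
  qed
  moreover have "eventually (\<lambda>N. real N \<ge> 8 / r + 1) sequentially"
    using filterlim_real_sequentially by (simp add: filterlim_at_top)
  moreover have "eventually (\<lambda>N. N \<ge> N0 + 16 * M + 1) sequentially"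
    by (rule eventually_ge_at_top)
  ultimately have "eventually (\<lambda>N. real N powr (2 - s * (1 + v)) > 768 * r powr (s - 1) \<and>
      real N \<ge> 8 / r + 1 \<and> N \<ge> N0 + 16 * M + 1) sequentially"
    by eventually_elim auto
  then obtain N :: nat where N: "real N powr (2 - s * (1 + v)) > 768 * r powr (s - 1)"
      "real N \<ge> 8 / r + 1" "N \<ge> N0 + 16 * M + 1"
    by (auto simp: eventually_sequentially)
  have N1: "real N \<ge> 1" using N(3) by linarith
  have Nr: "1 / real N \<le> r / 8" using N(2) r N1 by (simp add: field_simps)
  obtain P where P: "finite P" "r / 128 * (real N)^2 \<le> real (card P)"
     "\<And>y. y \<in> P \<Longrightarrow> x0 + r/8 \<le> y \<and> y \<le> x0 + r * 7 / 8"
     "\<And>y. y \<in> P \<Longrightarrow> \<exists>p::int. \<exists>q::nat. real N / 16 < real q \<and> q \<le> N \<and> y = real_of_int p / real q"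
  proof -
    from N0[of N] N(3) obtain P where *: "finite P" "(r/2) / 64 * (real N)^2 \<le> real (card P)"
     "\<And>y. y \<in> P \<Longrightarrow> (x0+r/4) - 1 / real N \<le> y \<and> y \<le> (x0+r/4) + r/2 + 1 / real N"
     "\<And>y. y \<in> P \<Longrightarrow> \<exists>p::int. \<exists>q::nat. real N / 16 < real q \<and> q \<le> N \<and> y = real_of_int p / real q"
      by fastforce
    show thesis
    proof (rule that)
      show "finite P" by fact
      show "r / 128 * (real N)^2 \<le> real (card P)" using *(2) by simp
      show "x0 + r/8 \<le> y \<and> y \<le> x0 + r * 7 / 8" if "y \<in> P" for y
        using *(3)[OF that] Nr by linarith
    qed (use *(4) in auto)
  qed
  have sepP: "1 / (real N)^2 \<le> \<bar>y - z\<bar>" if yz: "y \<in> P" "z \<in> P" "y \<noteq> z" for y z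
  proof -
    obtain p q where pq: "real N / 16 < real q" "q \<le> N" "y = real_of_int p / real q" using P(4)[OF yz(1)] by blast
    obtain p' q' where pq': "real N / 16 < real q'" "q' \<le> N" "z = real_of_int p' / real q'" using P(4)[OF yz(2)] by blast
    have "q > 0" "q' > 0" using pq(1) pq'(1) N1 by (auto intro!: gr0I)
    then show ?thesis using rationals_separated[of p q p' q' N] pq pq' yz(3) by simp
  qed
  \<comment> \<open>The radius is half of N^(-1-v), hence below q^(-1-v) for each denominator q
    \<le> N. The length \<open>r1\<close> does not exceed the separation 1 / N^2 of the
    fractions.\<close>
  define \<rho> where "\<rho> = real N powr (-1 - v) / 2"
  define r1 where "r1 = real N powr (-1 - v)"
  have r1: "r1 > 0" "r1 = 2 * \<rho>" "\<rho> > 0" using N1 by (auto simp: r1_def \<rho>_def)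
  have r1_le: "r1 \<le> 1 / (real N)^2" 
  proof -
    have "r1 \<le> real N powr (-2)" unfolding r1_def using N1 sv by (intro powr_mono) auto
    also have "\<dots> = 1 / (real N)^2" using N1 by (simp add: powr_minus powr_numeral inverse_eq_divide)
    finally show ?thesis .
  qed
  have N2: "1 / (real N)^2 \<le> 1 / real N" using N1 by (intro divide_left_mono) (auto simp: power2_eq_square)
  define B where "B y = {y - \<rho>..y - \<rho> + r1}" for y
  have Bsub: "B y \<subseteq> {x0..x0+r}" if "y \<in> P" for y
    using P(3)[OF that] r1 r1_le N2 Nr by (auto simp: B_def)
  define Pi where "Pi i = {y \<in> P. U i \<inter> B y \<noteq> {}}" for i
  \<comment> \<open>The centres whose balls meet \<open>U i\<close> lie in an interval of length
    \<open>d i + r1\<close> and are 1 / N^2 apart; as r1 N^2 \<le> 1, only 2 has to be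
    added.\<close>
  have cardPi: "real (card (Pi i)) \<le> (real N)^2 * d i + 2" for i
  proof (cases "Pi i = {}")
    case False
    define mn where "mn = Min (Pi i)"
    have fin: "finite (Pi i)" using P(1) by (simp add: Pi_def)
    have mnP: "mn \<in> Pi i" using Min_in[OF fin False] by (simp add: mn_def)
    then obtain u where u: "u \<in> U i" "u \<in> B mn" by (auto simp: Pi_def)
    have up: "y \<le> mn + (d i + r1)" if y: "y \<in> Pi i" for y
    proof -
      obtain w where w: "w \<in> U i" "w \<in> B y" using y by (auto simp: Pi_def)
      have "dist u w \<le> d i" using diameter_bounded_bound[OF bU u(1) w(1)] dU[of i] by linarith
      then have "w - u \<le> d i" by (simp add: dist_real_def)
      moreover have "y - w \<le> \<rho>" "u - mn \<le> \<rho>" using u w r1 by (auto simp: B_def)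
      ultimately show ?thesis using r1 by linarith
    qed
    have "Pi i \<subseteq> {mn..mn + (d i + r1)}"
      using up Min_le[OF fin] by (auto simp: mn_def)
    moreover have "mn \<le> mn + (d i + r1)" using d0[of i] r1 by simp
    moreover have "1 / (real N)^2 \<le> \<bar>x - y\<bar>" if "x \<in> Pi i" "y \<in> Pi i" "x \<noteq> y" for x y
      using sepP that by (auto simp: Pi_def)
    moreover have "0 < 1 / (real N)^2" using N1 by simp
    ultimately have "real (card (Pi i)) \<le> (mn + (d i + r1) - mn) / (1 / (real N)^2) + 1"
      by (intro separated_set_card(2)) auto
    also have "\<dots> = (real N)^2 * d i + (real N)^2 * r1 + 1" by (simp add: algebra_simps)
    also have "(real N)^2 * r1 \<le> 1" using r1_le N1 by (simp add: field_simps)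
    finally show ?thesis by simp
  next
    case True
    then show ?thesis using d0[of i] by simp
  qed
  define m where "m i = (if U i \<inter> {x0..x0+r} \<noteq> {} then 1 else 0 :: real)" for i
  have ldm: "load s U d {x0..x0+r} = (\<Sum>i. m i * d i powr s)"
    unfolding load_def m_def by (intro suminf_cong) simp
  have smm: "summable (\<lambda>i. m i * d i powr s)"
    by (rule summable_comparison_test'[OF sm, of 0]) (auto simp: m_def)
  have m01: "0 \<le> m i" "m i \<le> 1" for i by (auto simp: m_def)
  have Pim: "Pi i = {}" if "m i = 0" for i
    using that Bsub by (auto simp: m_def Pi_def split: if_splits)
  define Big where "Big = {i. U i \<inter> {x0..x0+r} \<noteq> {} \<and> d i \<ge> 1 / (real N)^2}"
  have finBig: "finite Big"
  proof -
    have "(\<lambda>i. d i powr s) \<longlonglongrightarrow> 0" by (rule summable_LIMSEQ_zero[OF sm])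
    moreover have "(1 / (real N)^2) powr s > 0" using N1 by simp
    ultimately have "eventually (\<lambda>i. d i powr s < (1 / (real N)^2) powr s) sequentially"
      by (rule order_tendstoD)
    then obtain i0 where i0: "\<And>i. i \<ge> i0 \<Longrightarrow> d i powr s < (1 / (real N)^2) powr s"
      by (auto simp: eventually_sequentially)
    have "Big \<subseteq> {..<i0}"
    proof
      fix i assume "i \<in> Big"
      then have "(1 / (real N)^2) powr s \<le> d i powr s"
        unfolding Big_def using sv N1 by (intro powr_mono2) auto
      then have "\<not> i \<ge> i0" using i0[of i] by linarith
      then show "i \<in> {..<i0}" by simp
    qed
    then show ?thesis using finite_subset by blast
  qed
  have L: "(\<Sum>i. m i * d i powr s) \<le> \<eta> * r powr s" using ld ldm etar[of r] r by simp
  have dle: "d i \<le> r / 1536" if "U i \<inter> {x0..x0+r} \<noteq> {}" for i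
  proof -
    have "d i powr s = m i * d i powr s" using that by (simp add: m_def)
    also have "\<dots> \<le> (\<Sum>i. m i * d i powr s)"
      using sum_le_suminf[OF smm, of "{i}"] m01 by simp
    also have "\<dots> \<le> (r / 1536) powr s" using ld ldm by simp
    finally show ?thesis using powr_le_imp_le[of s "d i" "r/1536"] sv d0[of i] r by simp
  qed
  \<comment> \<open>The load bound gives \<open>d i\<close> \<le> r/1536 for each single set, so
    writing d = d^s * d^(1-s) turns the sum of s-th powers into a sum of lengths.\<close>
  have sumBig: "(\<Sum>i\<in>Big. d i) \<le> r / 1536"
  proof -
    have "(\<Sum>i\<in>Big. d i) \<le> (\<Sum>i\<in>Big. (m i * d i powr s) * (r / 1536) powr (1 - s))"
    proof (rule sum_mono)
      fix i assume i: "i \<in> Big"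
      have "d i = d i powr s * d i powr (1 - s)" using d0[of i] by (simp flip: powr_add)
      also have "\<dots> \<le> d i powr s * (r / 1536) powr (1 - s)"
        using dle[of i] i d0[of i] s1 by (intro mult_left_mono powr_mono2) (auto simp: Big_def)
      finally show "d i \<le> (m i * d i powr s) * (r / 1536) powr (1 - s)"
        using i by (simp add: m_def Big_def)
    qed
    also have "\<dots> = (\<Sum>i\<in>Big. m i * d i powr s) * (r / 1536) powr (1 - s)"
      by (simp add: sum_distrib_right)
    also have "\<dots> \<le> (r / 1536) powr s * (r / 1536) powr (1 - s)"
    proof (intro mult_right_mono)
      show "(\<Sum>i\<in>Big. m i * d i powr s) \<le> (r / 1536) powr s"
        using sum_le_suminf[OF smm finBig] m01 ld ldm by simp
    qed simp
    also have "\<dots> = r / 1536" using r by (simp flip: powr_add)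
    finally show ?thesis .
  qed
  define P1 where "P1 = P - (\<Union>i\<in>Big. Pi i)"
  \<comment> \<open>This step fixes 1536: the large sets spoil at most 3 N^2 r / 1536 = r N^2 / 512
    of the fractions, of which there are at least r N^2 / 128, so at least half of that number
    remains.\<close>
  have cardP1: "real (card P1) \<ge> r / 256 * (real N)^2"
  proof -
    have "real (card (\<Union>i\<in>Big. Pi i)) \<le> (\<Sum>i\<in>Big. real (card (Pi i)))"
      using card_UN_le[OF finBig, of Pi] by (simp flip: of_nat_sum)
    also have "\<dots> \<le> (\<Sum>i\<in>Big. 3 * (real N)^2 * d i)"
    proof (rule sum_mono)
      fix i assume "i \<in> Big"
      then have "1 \<le> (real N)^2 * d i" using N1 by (simp add: Big_def field_simps)
      then show "real (card (Pi i)) \<le> 3 * (real N)^2 * d i" using cardPi[of i] by linarith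
    qed
    also have "\<dots> = 3 * (real N)^2 * (\<Sum>i\<in>Big. d i)" by (simp add: sum_distrib_left)
    also have "\<dots> \<le> 3 * (real N)^2 * (r / 1536)" by (intro mult_left_mono sumBig) auto
    finally have 1: "real (card (\<Union>i\<in>Big. Pi i)) \<le> r / 512 * (real N)^2" by simp
    have "card P \<le> card P1 + card (\<Union>i\<in>Big. Pi i)"
    proof -
      have "P \<subseteq> P1 \<union> (\<Union>i\<in>Big. Pi i)" by (auto simp: P1_def)
      then have "card P \<le> card (P1 \<union> (\<Union>i\<in>Big. Pi i))"
        using P(1) finBig by (intro card_mono) (auto simp: P1_def Pi_def)
      also have "\<dots> \<le> card P1 + card (\<Union>i\<in>Big. Pi i)" by (rule card_Un_le)
      finally show ?thesis .
    qed
    then have "real (card P) \<le> real (card P1) + real (card (\<Union>i\<in>Big. Pi i))" by linarith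
    moreover have "r * (real N)^2 \<ge> 0" using r by simp
    ultimately show ?thesis using 1 P(2) by simp
  qed
  \<comment> \<open>Each remaining set is counted in at most three balls, so the loads of the balls
    add up to at most three times that of the parent. If all of them exceeded the bound, N^(2 - s (1
    + v)) \<le> 768 r^(s - 1) would follow, against the choice of N.\<close>
  have "\<exists>y\<in>P1. load s U d (B y) \<le> (r1 / 1536) powr s"
  proof (rule ccontr)
    assume "\<not> ?thesis"
    then have big: "\<And>y. y \<in> P1 \<Longrightarrow> \<eta> * r1 powr s \<le> load s U d (B y)"
      using etar[of r1] r1 by force
    have finP1: "finite P1" using P(1) by (simp add: P1_def)
    have "r / 256 * (real N)^2 * (\<eta> * r1 powr s) \<le> real (card P1) * (\<eta> * r1 powr s)"
      using cardP1 \<open>\<eta> > 0\<close> by (intro mult_right_mono) auto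
    also have "\<dots> \<le> (\<Sum>y\<in>P1. load s U d (B y))"
      using sum_mono[of P1 "\<lambda>_. \<eta> * r1 powr s", OF big] by simp
    also have "\<dots> = (\<Sum>i. \<Sum>y\<in>P1. of_bool (U i \<inter> B y \<noteq> {}) * d i powr s)"
      unfolding load_def by (intro suminf_sum[symmetric] summable_load sm)
    also have "\<dots> \<le> (\<Sum>i. 3 * (m i * d i powr s))"
    proof (rule suminf_le)
      fix i
      have "(\<Sum>y\<in>P1. of_bool (U i \<inter> B y \<noteq> {}) * d i powr s) = real (card {y\<in>P1. U i \<inter> B y \<noteq> {}}) * d i powr s"
        using finP1 by (simp flip: sum_distrib_right add: Int_def)
      also have "real (card {y\<in>P1. U i \<inter> B y \<noteq> {}}) \<le> 3 * m i"
      proof (cases "i \<in> Big \<or> m i = 0")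
        case True
        then have "{y\<in>P1. U i \<inter> B y \<noteq> {}} = {}" using Pim[of i] by (auto simp: P1_def Pi_def)
        then have "card {y\<in>P1. U i \<inter> B y \<noteq> {}} = 0" by (simp only: card.empty)
        then show ?thesis using m01[of i] by simp
      next
        case False
        then have "d i < 1 / (real N)^2" "m i = 1" by (auto simp: Big_def m_def split: if_splits)
        then have "(real N)^2 * d i \<le> 1" using N1 by (simp add: field_simps)
        moreover have "card {y\<in>P1. U i \<inter> B y \<noteq> {}} \<le> card (Pi i)"
          using P(1) by (intro card_mono) (auto simp: Pi_def P1_def)
        ultimately show ?thesis using cardPi[of i] \<open>m i = 1\<close> by linarith
      qed
      finally show "(\<Sum>y\<in>P1. of_bool (U i \<inter> B y \<noteq> {}) * d i powr s) \<le> 3 * (m i * d i powr s)"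
        by (simp add: mult_right_mono)
    qed (use smm in \<open>auto intro!: summable_sum summable_load sm summable_mult\<close>)
    also have "\<dots> = 3 * (\<Sum>i. m i * d i powr s)" by (rule suminf_mult[OF smm])
    also have "\<dots> \<le> 3 * (\<eta> * r powr s)" using L by simp
    finally have "r / 256 * (real N)^2 * (\<eta> * r1 powr s) \<le> 3 * (\<eta> * r powr s)" .
    then have "\<eta> * (r * ((real N)^2 * r1 powr s)) \<le> \<eta> * (768 * r powr s)" by (simp add: algebra_simps)
    then have "r * ((real N)^2 * r1 powr s) \<le> 768 * r powr s" using \<open>\<eta> > 0\<close> by simp
    moreover have "(real N)^2 * r1 powr s = real N powr (2 - s * (1 + v))"
    proof -
      have "(real N)^2 = real N powr 2" using N1 by (simp add: powr_numeral)
      moreover have "r1 powr s = real N powr (- (s * (1 + v)))"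
        unfolding r1_def powr_powr by (rule arg_cong[where f = "\<lambda>t. real N powr t"]) (simp add: algebra_simps)
      ultimately show ?thesis by (simp only: powr_add[symmetric]) simp
    qed
    moreover have "r powr s = r * r powr (s - 1)" using r by (simp add: powr_diff)
    ultimately have "real N powr (2 - s * (1 + v)) \<le> 768 * r powr (s - 1)" using r by simp
    then show False using N(1) by linarith
  qed
  then obtain y where y: "y \<in> P" "load s U d (B y) \<le> (r1 / 1536) powr s" by (auto simp: P1_def)
  obtain p q where pq: "real N / 16 < real q" "q \<le> N" "y = real_of_int p / real q" using P(4)[OF y(1)] by blast
  have q0: "q > 0" using pq(1) N1 by (auto intro!: gr0I)
  have "\<bar>real q * z - real_of_int p\<bar> < real q powr (-v)" if "z \<in> B y" for z
  proof -
    have "\<bar>z - y\<bar> \<le> \<rho>" using that r1 by (auto simp: B_def)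
    then have "real q * \<bar>z - y\<bar> \<le> real q * \<rho>" by (intro mult_left_mono) auto
    moreover have "real q * \<bar>z - y\<bar> = \<bar>real q * z - real_of_int p\<bar>"
      using q0 pq(3) by (simp add: abs_mult flip: right_diff_distrib) (simp add: abs_if field_simps)
    moreover have "\<rho> < real q powr (-1 - v)"
    proof -
      have "real N powr (-1 - v) \<le> real q powr (-1 - v)"
        using pq q0 sv by (intro powr_mono2') auto
      then show ?thesis using r1 r1_def by linarith
    qed
    then have "real q * \<rho> < real q * real q powr (-1 - v)" using q0 by simp
    moreover have "real q * real q powr (-1 - v) = real q powr (-v)"
      using q0 by (simp add: powr_mult_base)
    ultimately show ?thesis by linarith
  qed
  moreover have "q \<ge> M" using pq(1) N(3) by linarith
  moreover have "B y \<subseteq> {x0..x0+r}" using Bsub y by blast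
  moreover have "r1 \<le> r / 2" using r1_le N2 Nr r by linarith
  ultimately show ?thesis using y(2) r1(1) q0 unfolding B_def
    by (intro exI[of _ "y - \<rho>"] exI[of _ r1]) blast
qed

text \<open>The n-th step of the construction supplies a denominator of at least n, so the limit
  point is approximable and must lie in some \<open>U i\<close>. Then the load of every interval is
  at least \<open>d i powr s\<close>, while the bound on the load tends to 0 with the length of the
  interval.\<close>

theorem jarnik_besicovitch_not_null:
  assumes sv: "0 < s" "s < 2 / (1 + v)" "v > 1" and "a < b"
  shows "\<not> hnull s {x \<in> {a..b}. infinite {q::nat. q > 0 \<and> dist_int (real q * x) < real q powr (- v)}}"
    (is "\<not> hnull s ?E")
proof
  assume nul: "hnull s ?E"
  \<comment> \<open>Half of the admissible starting load; the other half is spent on making all the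
    lengths \<open>d i\<close> positive.\<close>
  define \<epsilon> where "\<epsilon> = ((b - a) / 1536) powr s / 2"
  have "\<epsilon> > 0" using \<open>a < b\<close> by (simp add: \<epsilon>_def)
  then obtain U :: "nat \<Rightarrow> real set" where U: "?E \<subseteq> (\<Union>i. U i)" "\<And>i. bounded (U i)"
     "(\<Sum>i. ennreal (diameter (U i) powr s)) \<le> ennreal \<epsilon>"
    using nul unfolding hnull_def by blast
  define d where "d i = (diameter (U i) powr s + \<epsilon> * (1/2)^Suc i) powr (1 / s)" for i
  have pos: "0 < diameter (U i) powr s + \<epsilon> * (1/2)^Suc i" for i
    using \<open>\<epsilon> > 0\<close> by (intro add_nonneg_pos) auto
  have ds: "d i powr s = diameter (U i) powr s + \<epsilon> * (1/2)^Suc i" for i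
    using pos[of i] sv unfolding d_def powr_powr by simp
  have d0: "0 < d i" for i using pos[of i] by (simp add: d_def)
  have dU: "diameter (U i) \<le> d i" for i
  proof (rule powr_le_imp_le[OF sv(1) diameter_ge_0[OF U(2)] less_imp_le[OF d0]])
    show "diameter (U i) powr s \<le> d i powr s" using \<open>\<epsilon> > 0\<close> by (simp add: ds)
  qed
  have sm1: "summable (\<lambda>i. diameter (U i) powr s)"
    using U(3) by (intro summable_suminf_not_top) (auto simp: top_unique)
  have "(\<Sum>i. diameter (U i) powr s) \<le> \<epsilon>"
    using U(3) \<open>\<epsilon> > 0\<close> by (subst (asm) suminf_ennreal2[OF _ sm1]) (auto simp: ennreal_le_iff)
  have g: "(\<lambda>n. \<epsilon> * (1/2)^Suc n) sums \<epsilon>" using sums_mult[OF power_half_series, of \<epsilon>] by simp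
  have sm: "summable (\<lambda>i. d i powr s)" unfolding ds by (intro summable_add sm1 sums_summable[OF g])
  have tot: "(\<Sum>i. d i powr s) \<le> 2 * \<epsilon>"
    unfolding ds using suminf_add[OF sm1 sums_summable[OF g]] sums_unique[OF g] \<open>_ \<le> \<epsilon>\<close> by simp
  define Q where "Q n X \<longleftrightarrow> 0 < snd X \<and> load s U d {fst X..fst X + snd X} \<le> (snd X / 1536) powr s \<and>
      snd X \<le> (b - a) / 2^n \<and> (n = 0 \<longrightarrow> X = (a, b - a))" for n :: nat and X :: "real \<times> real"
  define R where "R n X Y \<longleftrightarrow> {fst Y..fst Y + snd Y} \<subseteq> {fst X..fst X + snd X} \<and>
      (\<exists>p::int. \<exists>q::nat. q \<ge> n \<and> q > 0 \<and>
        (\<forall>z\<in>{fst Y..fst Y + snd Y}. \<bar>real q * z - real_of_int p\<bar> < real q powr (-v)))"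
    for n :: nat and X Y :: "real \<times> real"
  have "\<exists>Xs. \<forall>n. Q n (Xs n) \<and> R n (Xs n) (Xs (Suc n))"
  proof -
    have "Q 0 (a, b - a)"
    proof -
      have "load s U d {a..b} \<le> (\<Sum>i. d i powr s)"
        unfolding load_def by (intro suminf_le summable_load sm) auto
      then show ?thesis using tot \<open>a < b\<close> by (simp add: Q_def \<epsilon>_def)
    qed
    moreover have "\<exists>Y. Q (Suc n) Y \<and> R n X Y" if QX: "Q n X" for n X
    proof -
      obtain x1 r1 where 1: "{x1..x1+r1} \<subseteq> {fst X..fst X+snd X}" "0 < r1" "r1 \<le> snd X / 2"
         "load s U d {x1..x1+r1} \<le> (r1 / 1536) powr s"
         "\<exists>p::int. \<exists>q::nat. q \<ge> n \<and> q > 0 \<and>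
        (\<forall>z\<in>{x1..x1+r1}. \<bar>real q * z - real_of_int p\<bar> < real q powr (-v))"
      proof -
        have "0 < snd X" "load s U d {fst X..fst X + snd X} \<le> (snd X / 1536) powr s"
          using QX by (auto simp: Q_def)
        from load_descend[OF sv U(2) dU d0 sm this, of n] show thesis using that by blast
      qed
      have "r1 \<le> (b - a) / 2^n / 2" using 1(3) QX by (simp add: Q_def)
      then have "r1 \<le> (b - a) / 2^Suc n" by simp
      then have "Q (Suc n) (x1, r1) \<and> R n X (x1, r1)" using 1 by (simp add: Q_def R_def)
      then show ?thesis by blast
    qed
    ultimately show ?thesis
      using dependent_nat_choice[of Q R] by blast
  qed
  then obtain Xs where Xs: "\<And>n. Q n (Xs n)" "\<And>n. R n (Xs n) (Xs (Suc n))" by blast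
  have X0: "Xs 0 = (a, b - a)" using Xs(1)[of 0] by (simp add: Q_def)
  define F where "F n = {fst (Xs n)..fst (Xs n) + snd (Xs n)}" for n
  have F1: "F (Suc n) \<subseteq> F n" for n using Xs(2)[of n] by (simp add: R_def F_def)
  then have F2: "m \<le> n \<Longrightarrow> F n \<subseteq> F m" for m n by (rule lift_Suc_antimono_le)
  have "\<Inter>(range F) \<noteq> {}"
    by (rule compact_nest) (use Xs(1) F2 in \<open>auto simp: F_def Q_def less_imp_le\<close>)
  then obtain x where x: "\<And>n. x \<in> F n" by blast
  have "infinite {q::nat. q > 0 \<and> dist_int (real q * x) < real q powr (- v)}"
    unfolding infinite_nat_iff_unbounded_le
  proof
    fix n
    obtain p :: int and q :: nat where "q \<ge> n" "q > 0" "\<bar>real q * x - real_of_int p\<bar> < real q powr (-v)"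
      using Xs(2)[of n] x[of "Suc n"] unfolding R_def F_def by blast
    then show "\<exists>q\<ge>n. q \<in> {q::nat. q > 0 \<and> dist_int (real q * x) < real q powr (- v)}"
      using dist_int_le[of "real q * x" p] by (intro exI[of _ q]) auto
  qed
  moreover have "x \<in> {a..b}" using x[of 0] by (simp add: F_def X0)
  ultimately obtain i where i: "x \<in> U i" using U(1) by blast
  have "d i powr s \<le> ((b - a) / 2^n / 1536) powr s" for n
  proof -
    have "d i powr s = of_bool (U i \<inter> F n \<noteq> {}) * d i powr s" using i x[of n] by auto
    also have "\<dots> \<le> load s U d (F n)"
      unfolding load_def
      using sum_le_suminf[OF summable_load[OF sm, of "\<lambda>i. U i \<inter> F n \<noteq> {}"], of "{i}"]
      by (simp del: sum_of_bool_mult_eq)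
    also have "\<dots> \<le> (snd (Xs n) / 1536) powr s" using Xs(1)[of n] by (simp add: Q_def F_def)
    also have "\<dots> \<le> ((b - a) / 2^n / 1536) powr s"
      using Xs(1)[of n] sv by (intro powr_mono2 divide_right_mono) (auto simp: Q_def)
    finally show ?thesis .
  qed
  then have le: "d i \<le> (b - a) / 2^n / 1536" for n
    using powr_le_imp_le[OF sv(1) less_imp_le[OF d0[of i]]] \<open>a < b\<close> by simp
  have "(\<lambda>n. (b - a) / 1536 * (1/2)^n) \<longlonglongrightarrow> (b - a) / 1536 * 0"
    by (intro tendsto_mult tendsto_const LIMSEQ_realpow_zero) auto
  then have "d i \<le> (b - a) / 1536 * 0"
    by (rule LIMSEQ_le_const) (use le in \<open>auto simp: power_one_over divide_simps mult_ac\<close>)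
  then show False using d0[of i] by simp
qed

section \<open>Rational points near curves\<close>

text \<open>The bounds play the role of \<open>2 * c \<le> f'' \<le> 2 * C\<close>, with \<open>g\<close> for \<open>f'\<close>. In this form, and on the
  whole line, the class is closed under Legendre duality.\<close>

definition bent :: "real \<Rightarrow> real \<Rightarrow> (real \<Rightarrow> real) \<Rightarrow> (real \<Rightarrow> real) \<Rightarrow> bool" where
  "bent c C f g \<longleftrightarrow> 0 < c \<and> c \<le> C \<and>
     (\<forall>x y. c * (y - x)^2 \<le> f y - f x - g x * (y - x) \<and> f y - f x - g x * (y - x) \<le> C * (y - x)^2)"

lemma bentD:
  assumes "bent c C f g"
  shows "0 < c" "c \<le> C" "0 < C"
    "c * (y - x)^2 \<le> f y - f x - g x * (y - x)" "f y - f x - g x * (y - x) \<le> C * (y - x)^2"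
proof -
  show "0 < c" "c \<le> C" "0 < C" using assms by (auto simp: bent_def)
  show "c * (y - x)^2 \<le> f y - f x - g x * (y - x)" "f y - f x - g x * (y - x) \<le> C * (y - x)^2"
    using assms unfolding bent_def by blast+
qed

text \<open>Adding the hypothesis for (x, y) and for (y, x) cancels the values of
  \<open>f\<close>.\<close>

lemma bent_slope:
  assumes "bent c C f g" "x \<le> y"
  shows "2 * c * (y - x) \<le> g y - g x" "g y - g x \<le> 2 * C * (y - x)"
proof -
  have 1: "2 * c * (y - x)^2 \<le> (g y - g x) * (y - x)" "(g y - g x) * (y - x) \<le> 2 * C * (y - x)^2"
    using bentD(4,5)[OF assms(1), of y x] bentD(4,5)[OF assms(1), of x y]
    by (simp_all add: power2_eq_square algebra_simps)
  show "2 * c * (y - x) \<le> g y - g x"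
  proof (cases "x = y")
    case False
    then show ?thesis using 1(1) assms(2) mult_le_cancel_right_pos[of "y - x" "2 * c * (y - x)" "g y - g x"]
      by (simp add: power2_eq_square mult.assoc)
  qed simp
  show "g y - g x \<le> 2 * C * (y - x)"
  proof (cases "x = y")
    case False
    then show ?thesis using 1(2) assms(2) mult_le_cancel_right_pos[of "y - x" "g y - g x" "2 * C * (y - x)"]
      by (simp add: power2_eq_square mult.assoc)
  qed simp
qed

lemma bent_slope_abs:
  assumes "bent c C f g"
  shows "2 * c * \<bar>y - x\<bar> \<le> \<bar>g y - g x\<bar>" "\<bar>g y - g x\<bar> \<le> 2 * C * \<bar>y - x\<bar>"
proof -
  have "2 * c * \<bar>y - x\<bar> \<le> \<bar>g y - g x\<bar> \<and> \<bar>g y - g x\<bar> \<le> 2 * C * \<bar>y - x\<bar>"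
  proof (cases "x \<le> y")
    case True
    then have "0 \<le> 2 * c * (y - x)" using bentD(1)[OF assms] by simp
    then show ?thesis using bent_slope[OF assms True] True by simp
  next
    case False
    then have "0 \<le> 2 * c * (x - y)" using bentD(1)[OF assms] by simp
    then show ?thesis using bent_slope[OF assms, of y x] False by simp
  qed
  then show "2 * c * \<bar>y - x\<bar> \<le> \<bar>g y - g x\<bar>" "\<bar>g y - g x\<bar> \<le> 2 * C * \<bar>y - x\<bar>" by auto
qed

text \<open>\<open>g\<close> is Lipschitz and grows at least linearly in both directions.
  Surjectivity provides the inverse slope function on which the Legendre transform rests.\<close>

lemma bent_surj:
  assumes "bent c C f g"
  shows "\<exists>x. g x = t"
proof -
  have c: "0 < c" "0 < C" using bentD[OF assms] by auto
  have "continuous_on UNIV g"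
  proof (rule continuous_onI)
    fix x and e :: real assume "0 < e"
    show "\<exists>d>0. \<forall>x'\<in>UNIV. dist x' x < d \<longrightarrow> dist (g x') (g x) \<le> e"
    proof (intro exI[of _ "e / (2 * C)"] conjI ballI impI)
      fix x' assume "dist x' x < e / (2 * C)"
      then have "2 * C * \<bar>x' - x\<bar> \<le> e" using c by (simp add: dist_real_def field_simps)
      then show "dist (g x') (g x) \<le> e" using bent_slope_abs(2)[OF assms, of x' x] by (simp add: dist_real_def)
    qed (use c \<open>0 < e\<close> in auto)
  qed
  define X where "X = \<bar>t - g 0\<bar> / (2 * c)"
  have "X \<ge> 0" using c by (simp add: X_def)
  have "2 * c * X = \<bar>t - g 0\<bar>" using c by (simp add: X_def)
  then have "g (- X) \<le> t" "t \<le> g X"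
    using bent_slope(1)[OF assms, of "-X" 0] bent_slope(1)[OF assms, of 0 X] \<open>X \<ge> 0\<close> by auto
  then show ?thesis
    using IVT'[of g "-X" t X] \<open>X \<ge> 0\<close> continuous_on_subset[OF \<open>continuous_on UNIV g\<close>, of "{-X..X}"] by auto
qed

section \<open>Legendre duality\<close>

text \<open>The Taylor remainder of the dual from x to y equals that of \<open>f\<close> from
  \<open>h y\<close> to \<open>h x\<close>. As |y - x| lies between 2 c and 2 C times |h y - h x|,
  dividing c by (2 C)^2 and C by (2 c)^2 gives the dual constants.\<close>

lemma bent_legendre:
  assumes "bent c C f g"
  obtains h where "\<And>t. g (h t) = t" "bent (c / (4 * C^2)) (C / (4 * c^2)) (\<lambda>t. t * h t - f (h t)) h"
proof -
  obtain h where h: "\<And>t. g (h t) = t" using bent_surj[OF assms] by metis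
  have c: "0 < c" "c \<le> C" "0 < C" using bentD[OF assms] by auto
  have "bent (c / (4 * C^2)) (C / (4 * c^2)) (\<lambda>t. t * h t - f (h t)) h"
    unfolding bent_def
  proof (intro conjI allI)
    show "0 < c / (4 * C^2)" using c by simp
    have "c * c^2 \<le> C * C^2" using c by (intro mult_mono power_mono) auto
    then show "c / (4 * C^2) \<le> C / (4 * c^2)" using c by (simp add: field_simps)
    fix x y
    define D where "D = f (h x) - f (h y) - g (h y) * (h x - h y)"
    have e: "y * h y - f (h y) - (x * h x - f (h x)) - h x * (y - x) = D"
      by (simp add: D_def h algebra_simps)
    have D: "c * (h x - h y)^2 \<le> D" "D \<le> C * (h x - h y)^2"
      using bentD(4,5)[OF assms] unfolding D_def by auto
    have s: "2 * c * \<bar>h y - h x\<bar> \<le> \<bar>y - x\<bar>" "\<bar>y - x\<bar> \<le> 2 * C * \<bar>h y - h x\<bar>"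
      using bent_slope_abs[OF assms, of "h y" "h x"] by (auto simp: h)
    have "(2 * c * \<bar>h y - h x\<bar>)^2 \<le> \<bar>y - x\<bar>^2" using s c by (intro power_mono) auto
    then have s1: "4 * c^2 * (h x - h y)^2 \<le> (y - x)^2" by (simp add: power_mult_distrib power2_commute)
    have "\<bar>y - x\<bar>^2 \<le> (2 * C * \<bar>h y - h x\<bar>)^2" using s c by (intro power_mono) auto
    then have s2: "(y - x)^2 \<le> 4 * C^2 * (h x - h y)^2" by (simp add: power_mult_distrib power2_commute)
    have "c / (4 * C^2) * (y - x)^2 \<le> c / (4 * C^2) * (4 * C^2 * (h x - h y)^2)"
      using s2 c by (intro mult_left_mono) auto
    also have "\<dots> = c * (h x - h y)^2" using c by simp
    finally show "c / (4 * C^2) * (y - x)^2 \<le> y * h y - f (h y) - (x * h x - f (h x)) - h x * (y - x)"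
      unfolding e using D by linarith
    have "C * (h x - h y)^2 = C / (4 * c^2) * (4 * c^2 * (h x - h y)^2)" using c by simp
    also have "\<dots> \<le> C / (4 * c^2) * (y - x)^2"
      using s1 c by (intro mult_left_mono) auto
    finally show "y * h y - f (h y) - (x * h x - f (h x)) - h x * (y - x) \<le> C / (4 * c^2) * (y - x)^2"
      unfolding e using D by linarith
  qed
  then show thesis using that h by blast
qed

lemma bent_lipschitz:
  assumes "bent c C f g" "a \<le> b"
  obtains G where "G > 0" "\<And>x y. x \<in> {a..b} \<Longrightarrow> y \<in> {a..b} \<Longrightarrow> \<bar>f x - f y\<bar> \<le> G * \<bar>x - y\<bar>"
proof -
  have c: "0 < c" "c \<le> C" "0 < C" using bentD[OF assms(1)] by auto
  define G where "G = 1 + \<bar>g a\<bar> + 3 * C * (b - a)"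
  have "G > 0" using assms c by (auto simp: G_def intro!: add_pos_nonneg mult_nonneg_nonneg)
  moreover have "\<bar>f y - f x\<bar> \<le> G * \<bar>y - x\<bar>" if "x \<in> {a..b}" "y \<in> {a..b}" for x y
  proof -
    have 0: "0 \<le> f y - f x - g x * (y - x)" "f y - f x - g x * (y - x) \<le> C * (y - x)^2"
    proof -
      have "0 \<le> c * (y - x)^2" using c by simp
      then show "0 \<le> f y - f x - g x * (y - x)" using bentD(4)[OF assms(1), of y x] by linarith
    qed (rule bentD(5)[OF assms(1)])
    have "\<bar>g x - g a\<bar> \<le> 2 * C * \<bar>x - a\<bar>" by (rule bent_slope_abs(2)[OF assms(1)])
    also have "\<dots> \<le> 2 * C * (b - a)" using that c by (intro mult_left_mono) auto
    finally have "\<bar>g x\<bar> \<le> \<bar>g a\<bar> + 2 * C * (b - a)" by linarith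
    then have 1: "\<bar>g x * (y - x)\<bar> \<le> (\<bar>g a\<bar> + 2 * C * (b - a)) * \<bar>y - x\<bar>"
      unfolding abs_mult by (intro mult_right_mono) auto
    have "C * (y - x)^2 = C * \<bar>y - x\<bar> * \<bar>y - x\<bar>" by (simp add: power2_eq_square)
    also have "\<dots> \<le> C * (b - a) * \<bar>y - x\<bar>" using that c by (intro mult_right_mono mult_left_mono) auto
    finally have 2: "C * (y - x)^2 \<le> C * (b - a) * \<bar>y - x\<bar>" .
    have "\<bar>f y - f x\<bar> \<le> (\<bar>g a\<bar> + 2 * C * (b - a)) * \<bar>y - x\<bar> + C * (b - a) * \<bar>y - x\<bar>"
      using 0 1 2 by linarith
    also have "\<dots> \<le> G * \<bar>y - x\<bar>" by (simp add: G_def algebra_simps)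
    finally show ?thesis .
  qed
  ultimately show thesis using that by blast
qed

text \<open>The triple \<open>(q, p, r)\<close> stands for the rational point \<open>(p / q, r / q)\<close>.\<close>

definition near_pts :: "(real \<Rightarrow> real) \<Rightarrow> real \<Rightarrow> real \<Rightarrow> real \<Rightarrow> real \<Rightarrow> (int \<times> int \<times> int) set" where
  "near_pts f a b Q \<delta> = {(q, p, r). 0 < q \<and> real_of_int q \<le> Q \<and> gcd q (gcd p r) = 1 \<and>
     a \<le> real_of_int p / real_of_int q \<and> real_of_int p / real_of_int q \<le> b \<and>
     \<bar>f (real_of_int p / real_of_int q) - real_of_int r / real_of_int q\<bar> \<le> \<delta> / Q}"

text \<open>For each denominator and numerator the third entry lies in an interval of length 2
  \<delta>. Besides finiteness, this serves the start of the induction and the range \<delta> \<ge>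
  1.\<close>

lemma near_pts_trivial_bound:
  assumes "a \<le> b" "Q \<ge> 1" "\<delta> > 0"
  shows "finite (near_pts f a b Q \<delta>)"
    "real (card (near_pts f a b Q \<delta>)) \<le> 2 * (b - a + 1) * (1 + \<delta>) * Q^2"
proof -
  define m where "m = nat \<lfloor>Q\<rfloor>"
  let ?I = "\<lambda>q::int. {p::int. q * a \<le> p \<and> p \<le> q * b}"
  let ?R = "\<lambda>(q::int) (p::int). {r::int. q * f (p / q) - \<delta> \<le> r \<and> r \<le> q * f (p / q) + \<delta>}"
  let ?S = "\<lambda>q. \<Union>p\<in>?I q. \<Union>r\<in>?R q p. {(q, p, r)}"
  have sub: "near_pts f a b Q \<delta> \<subseteq> (\<Union>q\<in>{1..\<lfloor>Q\<rfloor>}. ?S q)"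
  proof
    fix P assume "P \<in> near_pts f a b Q \<delta>"
    then obtain q p r where P: "P = (q, p, r)" "0 < q" "real_of_int q \<le> Q"
        "a \<le> real_of_int p / real_of_int q" "real_of_int p / real_of_int q \<le> b"
        "\<bar>f (real_of_int p / real_of_int q) - real_of_int r / real_of_int q\<bar> \<le> \<delta> / Q"
      by (auto simp: near_pts_def)
    have "\<bar>q * f (p / q) - r\<bar> = q * \<bar>f (p / q) - r / q\<bar>"
      using P(2) by (simp add: abs_if field_simps)
    also have "\<dots> \<le> q * (\<delta> / Q)" using P by (intro mult_left_mono) auto
    also have "\<dots> \<le> \<delta>" using P assms by (simp add: field_simps)
    finally have "r \<in> ?R q p" by auto
    moreover have "p \<in> ?I q" using P by (auto simp: field_simps)
    moreover have "q \<in> {1..\<lfloor>Q\<rfloor>}" using P by (auto simp: le_floor_iff)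
    ultimately show "P \<in> (\<Union>q\<in>{1..\<lfloor>Q\<rfloor>}. ?S q)" using P(1) by blast
  qed
  have I: "finite (?I q)" "real (card (?I q)) \<le> (b - a + 1) * Q" if "q \<in> {1..\<lfloor>Q\<rfloor>}" for q
  proof -
    have q: "1 \<le> real_of_int q" "real_of_int q \<le> Q" using that by (auto simp: le_floor_iff)
    have *: "q * a \<le> q * b" using q assms by (intro mult_left_mono) auto
    have "finite (?I q)" "real (card (?I q)) \<le> q * b - q * a + 1"
      by (rule card_ints_in_interval[OF _ *]; auto)+
    moreover have "q * b - q * a + 1 \<le> (b - a + 1) * Q"
    proof -
      have "q * (b - a) \<le> Q * (b - a)" using q assms by (intro mult_right_mono) auto
      then show ?thesis using assms by (simp add: algebra_simps)
    qed
    ultimately show "finite (?I q)" "real (card (?I q)) \<le> (b - a + 1) * Q" by auto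
  qed
  have R: "finite (?R q p)" "real (card (?R q p)) \<le> 2 * (1 + \<delta>)" for q p
  proof -
    have "finite (?R q p)" "real (card (?R q p)) \<le> (q * f (p / q) + \<delta>) - (q * f (p / q) - \<delta>) + 1"
      by (rule card_ints_in_interval[of _ "q * f (p / q) - \<delta>" "q * f (p / q) + \<delta>"]; use assms in auto)+
    then show "finite (?R q p)" "real (card (?R q p)) \<le> 2 * (1 + \<delta>)" by auto
  qed
  have fS: "finite (?S q)" if "q \<in> {1..\<lfloor>Q\<rfloor>}" for q using I(1)[OF that] R(1) by auto
  show "finite (near_pts f a b Q \<delta>)" using sub fS by (meson finite_UN_I finite_atLeastAtMost_int finite_subset)
  have cS: "real (card (?S q)) \<le> (b - a + 1) * Q * (2 * (1 + \<delta>))" if "q \<in> {1..\<lfloor>Q\<rfloor>}" for q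
  proof -
    have "card (?S q) \<le> (\<Sum>p\<in>?I q. card (\<Union>r\<in>?R q p. {(q, p, r)}))" by (rule card_UN_le[OF I(1)[OF that]])
    also have "\<dots> \<le> (\<Sum>p\<in>?I q. \<Sum>r\<in>?R q p. card {(q, p, r)})" by (intro sum_mono card_UN_le R(1))
    finally have "real (card (?S q)) \<le> (\<Sum>p\<in>?I q. real (card (?R q p)))" by (simp flip: of_nat_sum)
    also have "\<dots> \<le> (\<Sum>p\<in>?I q. 2 * (1 + \<delta>))" by (intro sum_mono R(2))
    also have "\<dots> = real (card (?I q)) * (2 * (1 + \<delta>))" by simp
    also have "\<dots> \<le> (b - a + 1) * Q * (2 * (1 + \<delta>))" using I(2)[OF that] assms by (intro mult_right_mono) auto
    finally show ?thesis .
  qed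
  have "card (near_pts f a b Q \<delta>) \<le> card (\<Union>q\<in>{1..\<lfloor>Q\<rfloor>}. ?S q)"
    using sub fS by (intro card_mono) auto
  also have "\<dots> \<le> (\<Sum>q\<in>{1..\<lfloor>Q\<rfloor>}. card (?S q))" by (intro card_UN_le) auto
  finally have "real (card (near_pts f a b Q \<delta>)) \<le> (\<Sum>q\<in>{1..\<lfloor>Q\<rfloor>}. real (card (?S q)))"
    by (simp flip: of_nat_sum)
  also have "\<dots> \<le> (\<Sum>q\<in>{1..\<lfloor>Q\<rfloor>}. (b - a + 1) * Q * (2 * (1 + \<delta>)))" by (intro sum_mono cS)
  also have "\<dots> = real (nat \<lfloor>Q\<rfloor>) * ((b - a + 1) * Q * (2 * (1 + \<delta>)))" by simp
  also have "\<dots> \<le> Q * ((b - a + 1) * Q * (2 * (1 + \<delta>)))"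
    using assms by (intro mult_right_mono mult_nonneg_nonneg) auto
  also have "\<dots> = 2 * (b - a + 1) * (1 + \<delta>) * Q^2" by (simp add: power2_eq_square algebra_simps)
  finally show "real (card (near_pts f a b Q \<delta>)) \<le> 2 * (b - a + 1) * (1 + \<delta>) * Q^2" .
qed

section \<open>Collinearity of rational points near a short arc\<close>

text \<open>Subtracting the tangent at \<open>x1\<close> is a shear and leaves the area unchanged.
  After it, the heights of the other two points over the first are at most C \<Delta>^2 + 2
  \<eta>.\<close>

lemma thin_triangle:
  assumes "bent c C f g" "\<bar>x2 - x1\<bar> \<le> \<Delta>" "\<bar>x3 - x1\<bar> \<le> \<Delta>"
    "\<bar>f x1 - y1\<bar> \<le> \<eta>" "\<bar>f x2 - y2\<bar> \<le> \<eta>" "\<bar>f x3 - y3\<bar> \<le> \<eta>"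
  shows "\<bar>(x2 - x1) * (y3 - y1) - (x3 - x1) * (y2 - y1)\<bar> \<le> 2 * \<Delta> * (C * \<Delta>^2 + 2 * \<eta>)"
proof -
  have c: "0 < c" "c \<le> C" "0 < C" using bentD[OF assms(1)] by auto
  define \<rho> where "\<rho> x y = (y - y1) - g x1 * (x - x1)" for x y
  have r: "\<bar>\<rho> x y\<bar> \<le> C * \<Delta>^2 + 2 * \<eta>" if "\<bar>x - x1\<bar> \<le> \<Delta>" "\<bar>f x - y\<bar> \<le> \<eta>" for x y
  proof -
    have "\<bar>x - x1\<bar>^2 \<le> \<Delta>^2" using that(1) by (intro power_mono) auto
    then have "C * (x - x1)^2 \<le> C * \<Delta>^2" using c by (intro mult_left_mono) auto
    moreover have "0 \<le> c * (x - x1)^2" using c by simp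
    ultimately show ?thesis
      using bentD(4,5)[OF assms(1), of x x1] that(2) assms(4) unfolding \<rho>_def by linarith
  qed
  have \<Delta>: "0 \<le> \<Delta>" using assms(2) by linarith
  have "(x2 - x1) * (y3 - y1) - (x3 - x1) * (y2 - y1) = (x2 - x1) * \<rho> x3 y3 - (x3 - x1) * \<rho> x2 y2"
    by (simp add: \<rho>_def algebra_simps)
  moreover have "\<bar>(x2 - x1) * \<rho> x3 y3\<bar> \<le> \<Delta> * (C * \<Delta>^2 + 2 * \<eta>)"
    unfolding abs_mult using assms r[of x3 y3] \<Delta> by (intro mult_mono) auto
  moreover have "\<bar>(x3 - x1) * \<rho> x2 y2\<bar> \<le> \<Delta> * (C * \<Delta>^2 + 2 * \<eta>)"
    unfolding abs_mult using assms r[of x2 y2] \<Delta> by (intro mult_mono) auto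
  ultimately show ?thesis by (simp add: algebra_simps)
qed

text \<open>The determinant of the three triples, expanded along the third one, so that its
  coefficients are those of the line through the first two points.\<close>

definition det3 :: "int \<times> int \<times> int \<Rightarrow> int \<times> int \<times> int \<Rightarrow> int \<times> int \<times> int \<Rightarrow> int" where
  "det3 = (\<lambda>(q1, p1, r1) (q2, p2, r2) (q3, p3, r3).
     (p1 * r2 - p2 * r1) * q3 - (q1 * r2 - q2 * r1) * p3 + (q1 * p2 - q2 * p1) * r3)"

abbreviation ptx :: "int \<times> int \<times> int \<Rightarrow> real" where
  "ptx P \<equiv> real_of_int (fst (snd P)) / real_of_int (fst P)"

abbreviation pty :: "int \<times> int \<times> int \<Rightarrow> real" where
  "pty P \<equiv> real_of_int (snd (snd P)) / real_of_int (fst P)"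

lemma det3_area:
  assumes "fst P1 > 0" "fst P2 > 0" "fst P3 > 0"
  shows "real_of_int (det3 P1 P2 P3) = real_of_int (fst P1) * real_of_int (fst P2) * real_of_int (fst P3) *
     ((ptx P2 - ptx P1) * (pty P3 - pty P1) - (ptx P3 - ptx P1) * (pty P2 - pty P1))"
proof (cases P1; cases P2; cases P3)
  fix q1 p1 r1 q2 p2 r2 q3 p3 r3
  assume P: "P1 = (q1, p1, r1)" "P2 = (q2, p2, r2)" "P3 = (q3, p3, r3)"
  define x1 y1 x2 y2 x3 y3 where "x1 = p1 / q1" "y1 = r1 / q1" "x2 = p2 / q2" "y2 = r2 / q2" "x3 = p3 / q3" "y3 = r3 / q3"
  have e: "real_of_int p1 = x1 * q1" "real_of_int r1 = y1 * q1" "real_of_int p2 = x2 * q2"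
     "real_of_int r2 = y2 * q2" "real_of_int p3 = x3 * q3" "real_of_int r3 = y3 * q3"
    using assms P by (auto simp: x1_y1_x2_y2_x3_y3_def)
  have "real_of_int (det3 P1 P2 P3) = q1 * q2 * q3 * ((x2 - x1) * (y3 - y1) - (x3 - x1) * (y2 - y1))"
    by (simp add: P det3_def e algebra_simps)
  then show ?thesis by (simp add: P x1_y1_x2_y2_x3_y3_def)
qed

text \<open>The determinant is an integer, so it vanishes once it is below 1 in size. Curvature and
  approximation error contribute 2 C \<Delta>^3 and 4 \<Delta> \<delta> / Q to the bound of
  \<open>thin_triangle\<close>, to be multiplied by denominators of total size Q^3. The two parts of
  Q + \<delta> Q^2 control one contribution each, and the factor 1 / (8 (1 + C)) reduces them to 1/4
  and 1/2.\<close>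

lemma near_pts_collinear:
  assumes b: "bent c C f g" and Q: "Q \<ge> 1" and d: "\<delta> > 0"
    and P: "P1 \<in> near_pts f a b Q \<delta>" "P2 \<in> near_pts f a b Q \<delta>" "P3 \<in> near_pts f a b Q \<delta>"
    and x: "\<bar>ptx P2 - ptx P1\<bar> \<le> \<Delta>" "\<bar>ptx P3 - ptx P1\<bar> \<le> \<Delta>"
    and \<Delta>: "\<Delta> = 1 / (8 * (1 + C)) / (Q + \<delta> * Q^2)"
  shows "det3 P1 P2 P3 = 0"
proof -
  have c: "0 < c" "c \<le> C" "0 < C" using bentD[OF b] by auto
  have pos: "0 < fst P \<and> real_of_int (fst P) \<le> Q \<and> \<bar>f (ptx P) - pty P\<bar> \<le> \<delta> / Q"
    if "P \<in> near_pts f a b Q \<delta>" for P using that by (auto simp: near_pts_def)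
  let ?A = "(ptx P2 - ptx P1) * (pty P3 - pty P1) - (ptx P3 - ptx P1) * (pty P2 - pty P1)"
  have A: "\<bar>?A\<bar> \<le> 2 * \<Delta> * (C * \<Delta>^2 + 2 * (\<delta> / Q))"
    by (rule thin_triangle[OF b x]) (use pos P in auto)
  define c0 where "c0 = 1 / (8 * (1 + C))"
  have c0: "0 < c0" "c0 \<le> 1/8" "C * c0 \<le> 1/8" using c by (auto simp: c0_def field_simps)
  have U: "0 < Q" "Q \<le> Q + \<delta> * Q^2" "\<delta> * Q^2 \<le> Q + \<delta> * Q^2" "0 < \<delta> * Q^2" using Q d by auto
  have \<Delta>1: "\<Delta> \<le> c0 / Q" unfolding \<Delta> c0_def[symmetric] using U c0 by (intro divide_left_mono) (auto intro!: mult_pos_pos)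
  have \<Delta>2: "\<Delta> \<le> c0 / (\<delta> * Q^2)" unfolding \<Delta> c0_def[symmetric] using U c0 by (intro divide_left_mono) (auto intro!: mult_pos_pos)
  have \<Delta>0: "0 < \<Delta>" unfolding \<Delta> using U c by (intro divide_pos_pos) auto
  have "2 * C * \<Delta>^3 \<le> 2 * C * (c0 / Q)^3" using \<Delta>0 \<Delta>1 c by (intro mult_left_mono power_mono) auto
  also have "\<dots> = 2 * (C * c0) * c0^2 / Q^3" by (simp add: power_divide power3_eq_cube power2_eq_square)
  also have "\<dots> \<le> 2 * (1/8) * 1^2 / Q^3"
    using c0 c U by (intro divide_right_mono mult_mono power_mono) auto
  finally have 1: "2 * C * \<Delta>^3 \<le> (1/4) / Q^3" by simp
  have "4 * \<Delta> * (\<delta> / Q) \<le> 4 * (c0 / (\<delta> * Q^2)) * (\<delta> / Q)"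
    using \<Delta>2 d U by (intro mult_right_mono mult_left_mono) auto
  also have "\<dots> = 4 * c0 / Q^3" using d by (simp add: power3_eq_cube power2_eq_square)
  also have "\<dots> \<le> (1/2) / Q^3" using c0 U by (intro divide_right_mono) auto
  finally have 2: "4 * \<Delta> * (\<delta> / Q) \<le> (1/2) / Q^3" .
  have "2 * \<Delta> * (C * \<Delta>^2 + 2 * (\<delta> / Q)) = 2 * C * \<Delta>^3 + 4 * \<Delta> * (\<delta> / Q)"
    by (simp add: power3_eq_cube power2_eq_square algebra_simps)
  then have A2: "\<bar>?A\<bar> \<le> (3/4) / Q^3" using A 1 2 by simp
  let ?q = "real_of_int (fst P1) * real_of_int (fst P2) * real_of_int (fst P3)"
  have q: "0 \<le> ?q" "?q \<le> Q * Q * Q"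
    using pos[OF P(1)] pos[OF P(2)] pos[OF P(3)] U by (auto intro!: mult_mono mult_nonneg_nonneg)
  have "\<bar>real_of_int (det3 P1 P2 P3)\<bar> = ?q * \<bar>?A\<bar>"
  proof -
    have "real_of_int (det3 P1 P2 P3) = ?q * ?A" using pos P by (intro det3_area) auto
    then show ?thesis using q(1) by (simp only: abs_mult[of ?q] abs_of_nonneg)
  qed
  also have "\<dots> \<le> Q * Q * Q * ((3/4) / Q^3)" using q A2 U by (intro mult_mono[of ?q "Q * Q * Q" "\<bar>?A\<bar>"]) auto
  also have "\<dots> < 1" using U by (simp add: power3_eq_cube)
  finally show ?thesis by linarith
qed

section \<open>Integer lines and the spacing of rational points on them\<close>

text \<open>The triples scaled by \<open>q'\<close> and by \<open>q\<close> agree, and the gcd of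
  the entries of a scaled primitive triple is the scaling factor.\<close>

lemma prim_triple_eq:
  fixes q p r q' p' r' :: int
  assumes "gcd q (gcd p r) = 1" "gcd q' (gcd p' r') = 1" "0 < q" "0 < q'"
    "q * p' = q' * p" "q * r' = q' * r"
  shows "q = q' \<and> p = p' \<and> r = r'"
proof -
  have "q = gcd (q * q') (gcd (q * p') (q * r'))"
    using assms(2,3) by (metis abs_of_pos gcd_mult_distrib_int mult.right_neutral)
  also have "\<dots> = gcd (q' * q) (gcd (q' * p) (q' * r))" using assms by (simp add: mult.commute)
  also have "\<dots> = q'" using assms(1,4) by (metis abs_of_pos gcd_mult_distrib_int mult.right_neutral)
  finally show ?thesis using assms by auto
qed

text \<open>The triple \<open>(\<alpha>, \<beta>, \<gamma>)\<close> stands for the line \<open>\<gamma> + \<beta> * x + \<alpha> * y = 0\<close>. Its leading entry \<open>\<alpha>\<close> is the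
  denominator of the dual point \<open>(- \<beta> / \<alpha>, \<gamma> / \<alpha>)\<close>.\<close>

definition on_line :: "int \<times> int \<times> int \<Rightarrow> int \<times> int \<times> int \<Rightarrow> bool" where
  "on_line = (\<lambda>(\<alpha>, \<beta>, \<gamma>) (q, p, r). \<gamma> * q + \<beta> * p + \<alpha> * r = 0)"

definition prim3 :: "int \<times> int \<times> int \<Rightarrow> bool" where
  "prim3 = (\<lambda>(q, p, r). gcd q (gcd p r) = 1)"

text \<open>The coefficients are the 2 by 2 minors of the two triples, divided by their gcd and with
  the sign adjusted. If \<open>A\<close> and \<open>B\<close> both vanished, the points would
  coincide; so the gcd is positive.\<close>

lemma line_through:
  assumes "prim3 P1" "prim3 P2" "fst P1 > 0" "fst P2 > 0" "P1 \<noteq> P2"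
  obtains l where "fst l \<ge> 0" "prim3 l" "\<And>P. det3 P1 P2 P = 0 \<Longrightarrow> on_line l P"
proof -
  obtain q1 p1 r1 where P1: "P1 = (q1, p1, r1)" by (cases P1)
  obtain q2 p2 r2 where P2: "P2 = (q2, p2, r2)" by (cases P2)
  define A B C where "A = q1 * p2 - q2 * p1" "B = - (q1 * r2 - q2 * r1)" "C = p1 * r2 - p2 * r1"
  define D where "D = gcd A (gcd B C)"
  have "\<not> (A = 0 \<and> B = 0)"
  proof
    assume "A = 0 \<and> B = 0"
    then have "q1 * p2 = q2 * p1" "q1 * r2 = q2 * r1" by (auto simp: A_B_C_def)
    then show False using prim_triple_eq[of q1 p1 r1 q2 p2 r2] assms by (auto simp: P1 P2 prim3_def)
  qed
  then have "D > 0" by (auto simp: D_def gcd_pos_int intro!: gcd_pos_int[THEN iffD2])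
  obtain A' B' C' where ABC: "A = D * A'" "B = D * B'" "C = D * C'"
    unfolding D_def by (metis dvdE gcd_dvd1 gcd_dvd2 dvd_trans)
  have "D * gcd A' (gcd B' C') = D"
    using \<open>D > 0\<close> D_def unfolding ABC by (metis abs_of_pos gcd_mult_distrib_int)
  then have pr: "gcd A' (gcd B' C') = 1" using \<open>D > 0\<close> by simp
  have on: "C' * q + B' * p + A' * r = 0" if "det3 P1 P2 (q, p, r) = 0" for q p r
  proof -
    have "D * (C' * q + B' * p + A' * r) = C * q + B * p + A * r" unfolding ABC by (simp add: algebra_simps)
    also have "\<dots> = 0" using that by (simp add: P1 P2 det3_def A_B_C_def algebra_simps)
    finally show ?thesis using \<open>D > 0\<close> by simp
  qed
  show thesis
  proof (cases "A' \<ge> 0")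
    case True
    show thesis by (rule that[of "(A', B', C')"]) (use True pr on in \<open>auto simp: prim3_def on_line_def\<close>)
  next
    case False
    have "- (C' * q) - B' * p - A' * r = 0" if "det3 P1 P2 (q, p, r) = 0" for q p r using on[OF that] by simp
    then show thesis by (intro that[of "(-A', -B', -C')"]) (use False pr in \<open>auto simp: prim3_def on_line_def\<close>)
  qed
qed

text \<open>The minors of two triples on the line form a vector parallel to the coefficients, up to
  signs, and an integral vector parallel to a primitive one is an integral multiple of it.
  \<open>key\<close> is how primitivity enters: a common divisor of \<alpha> x, \<beta> x and
  \<gamma> x divides x.\<close>

lemma on_line_dvd:
  fixes q p r q' p' r' :: int
  assumes "prim3 (\<alpha>, \<beta>, \<gamma>)" "on_line (\<alpha>, \<beta>, \<gamma>) (q, p, r)" "on_line (\<alpha>, \<beta>, \<gamma>) (q', p', r')"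
  shows "\<alpha> dvd p * q' - p' * q" "\<beta> dvd r * q' - r' * q"
    "\<beta> * (p * q' - p' * q) + \<alpha> * (r * q' - r' * q) = 0"
proof -
  have 1: "\<gamma> * q + \<beta> * p + \<alpha> * r = 0" "\<gamma> * q' + \<beta> * p' + \<alpha> * r' = 0"
    using assms by (auto simp: on_line_def)
  define u w z where "u = p * q' - p' * q" "w = r * q' - r' * q" "z = r * p' - r' * p"
  have a: "\<beta> * u + \<alpha> * w = 0" "\<gamma> * u = \<alpha> * z" "\<gamma> * w = - \<beta> * z"
    using 1 by (auto simp: u_w_z_def) algebra+
  have key: "k dvd x" if "k dvd \<alpha> * x" "k dvd \<beta> * x" "k dvd \<gamma> * x" for k x :: int
  proof -
    have "k dvd gcd (x * \<alpha>) (gcd (x * \<beta>) (x * \<gamma>))" using that by (simp add: mult.commute)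
    also have "gcd (x * \<beta>) (x * \<gamma>) = \<bar>x * gcd \<beta> \<gamma>\<bar>"
      using gcd_mult_left[of x \<beta> \<gamma>] by simp
    also have "gcd (x * \<alpha>) \<bar>x * gcd \<beta> \<gamma>\<bar> = gcd (x * \<alpha>) (x * gcd \<beta> \<gamma>)"
      by (rule gcd_abs2_int)
    also have "\<dots> = \<bar>x * gcd \<alpha> (gcd \<beta> \<gamma>)\<bar>"
      using gcd_mult_left[of x \<alpha> "gcd \<beta> \<gamma>"] by simp
    finally show ?thesis using assms(1) by (simp add: prim3_def)
  qed
  have "\<beta> * u = \<alpha> * (- w)" using a(1) by (simp add: eq_neg_iff_add_eq_0)
  then have "\<alpha> dvd \<beta> * u" by (rule dvdI)
  moreover have "\<alpha> dvd \<gamma> * u" using a(2) by (rule dvdI)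
  ultimately have "\<alpha> dvd u" by (rule key[OF dvd_triv_left])
  then show "\<alpha> dvd p * q' - p' * q" by (simp only: u_w_z_def(1))
  have "\<alpha> * w = \<beta> * (- u)" using a(1) by (simp add: eq_neg_iff_add_eq_0 add.commute)
  then have "\<beta> dvd \<alpha> * w" by (rule dvdI)
  moreover have "\<gamma> * w = \<beta> * (- z)" using a(3) by simp
  then have "\<beta> dvd \<gamma> * w" by (rule dvdI)
  ultimately have "\<beta> dvd w" by (rule key[OF _ dvd_triv_left])
  then show "\<beta> dvd r * q' - r' * q" by (simp only: u_w_z_def(2))
  show "\<beta> * (p * q' - p' * q) + \<alpha> * (r * q' - r' * q) = 0" using a(1) by (simp add: u_w_z_def)
qed

lemma near_ptsD:
  assumes "P \<in> near_pts f a b Q \<delta>"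
  shows "0 < fst P" "real_of_int (fst P) \<le> Q" "prim3 P" "a \<le> ptx P" "ptx P \<le> b" "\<bar>f (ptx P) - pty P\<bar> \<le> \<delta> / Q"
  using assms by (auto simp: near_pts_def prim3_def)

text \<open>The minor in the numerator is nonzero for different points; as a multiple of the
  coefficient it is at least as large, and it is divided by q q' \<le> Q^2. So lines with large
  coefficients hold few points.\<close>

lemma line_spacing:
  assumes P: "P \<in> near_pts f a b Q \<delta>" "P' \<in> near_pts f a b Q \<delta>" "P \<noteq> P'"
    and l: "prim3 (\<alpha>, \<beta>, \<gamma>)" "on_line (\<alpha>, \<beta>, \<gamma>) P" "on_line (\<alpha>, \<beta>, \<gamma>) P'"
  shows "real_of_int \<beta> * (ptx P - ptx P') + real_of_int \<alpha> * (pty P - pty P') = 0"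
    and "\<alpha> \<noteq> 0 \<Longrightarrow> \<bar>real_of_int \<alpha>\<bar> / Q^2 \<le> \<bar>ptx P - ptx P'\<bar>"
    and "\<beta> \<noteq> 0 \<Longrightarrow> \<bar>real_of_int \<beta>\<bar> / Q^2 \<le> \<bar>pty P - pty P'\<bar>"
proof -
  obtain q p r where Pe: "P = (q, p, r)" by (cases P)
  obtain q' p' r' where Pe': "P' = (q', p', r')" by (cases P')
  have q: "0 < q" "real_of_int q \<le> Q" "0 < q'" "real_of_int q' \<le> Q"
    using near_ptsD(1,2)[OF P(1)] near_ptsD(1,2)[OF P(2)] by (auto simp: Pe Pe')
  define u w where "u = p * q' - p' * q" "w = r * q' - r' * q"
  have d: "\<alpha> dvd u" "\<beta> dvd w" "\<beta> * u + \<alpha> * w = 0"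
    using on_line_dvd[of \<alpha> \<beta> \<gamma> q p r q' p' r'] l by (auto simp: Pe Pe' u_w_def)
  have x: "ptx P - ptx P' = real_of_int u / (real_of_int q * real_of_int q')"
    and y: "pty P - pty P' = real_of_int w / (real_of_int q * real_of_int q')"
    using q by (auto simp: Pe Pe' u_w_def field_simps)
  have "real_of_int (\<beta> * u + \<alpha> * w) = 0" using d(3) by simp
  then show "real_of_int \<beta> * (ptx P - ptx P') + real_of_int \<alpha> * (pty P - pty P') = 0"
    unfolding x y using q by (simp add: field_simps)
  have uw: "\<not> (u = 0 \<and> w = 0)"
  proof
    assume "u = 0 \<and> w = 0"
    then have "q * p' = q' * p" "q * r' = q' * r" by (auto simp: u_w_def mult.commute)
    then show False using prim_triple_eq[of q p r q' p' r'] q P near_ptsD(3)[OF P(1)] near_ptsD(3)[OF P(2)]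
      by (auto simp: Pe Pe' prim3_def)
  qed
  have qq: "0 < real_of_int q * real_of_int q'" "real_of_int q * real_of_int q' \<le> Q^2"
    using q by (auto simp: power2_eq_square intro!: mult_mono)
  show "\<bar>real_of_int \<alpha>\<bar> / Q^2 \<le> \<bar>ptx P - ptx P'\<bar>" if "\<alpha> \<noteq> 0"
  proof -
    have "u \<noteq> 0" using uw d(3) that by auto
    then have "\<bar>\<alpha>\<bar> \<le> \<bar>u\<bar>" using d(1) by (simp add: dvd_imp_le_int)
    then have "\<bar>real_of_int \<alpha>\<bar> \<le> \<bar>real_of_int u\<bar>" by linarith
    then have "\<bar>real_of_int \<alpha>\<bar> / Q^2 \<le> \<bar>real_of_int u\<bar> / (real_of_int q * real_of_int q')"
      using qq by (intro frac_le) auto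
    then show ?thesis unfolding x using qq by simp
  qed
  show "\<bar>real_of_int \<beta>\<bar> / Q^2 \<le> \<bar>pty P - pty P'\<bar>" if "\<beta> \<noteq> 0"
  proof -
    have "w \<noteq> 0" using uw d(3) that by auto
    then have "\<bar>\<beta>\<bar> \<le> \<bar>w\<bar>" using d(2) by (simp add: dvd_imp_le_int)
    then have "\<bar>real_of_int \<beta>\<bar> \<le> \<bar>real_of_int w\<bar>" by linarith
    then have "\<bar>real_of_int \<beta>\<bar> / Q^2 \<le> \<bar>real_of_int w\<bar> / (real_of_int q * real_of_int q')"
      using qq by (intro frac_le) auto
    then show ?thesis unfolding y using qq by simp
  qed
qed

section \<open>Lines steeper than the curve\<close>

text \<open>On such a line, which may be vertical, y changes at least 2 G + 2 times as fast as x,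
  whereas along the curve it changes at most G times as fast, up to errors \<delta> / Q. So any two
  of the points differ by at most 4 \<delta> / Q in y, while they are |\<beta>| / Q^2 apart there.
  The bound on \<gamma> holds because the line passes through a bounded region.\<close>

lemma steep_line_card:
  assumes G: "G > 0" "\<And>x y. x \<in> {a..b} \<Longrightarrow> y \<in> {a..b} \<Longrightarrow> \<bar>f x - f y\<bar> \<le> G * \<bar>x - y\<bar>"
    and Q: "Q \<ge> 1" and d: "0 < \<delta>" "\<delta> \<le> 1" and "a \<le> b"
    and l: "prim3 (\<alpha>, \<beta>, \<gamma>)" "0 \<le> \<alpha>" "(2 * G + 2) * real_of_int \<alpha> \<le> \<bar>real_of_int \<beta>\<bar>"
    and E: "E \<subseteq> near_pts f a b Q \<delta>" "\<And>P. P \<in> E \<Longrightarrow> on_line (\<alpha>, \<beta>, \<gamma>) P" "2 \<le> card E"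
  shows "1 \<le> \<bar>\<beta>\<bar>" "\<bar>real_of_int \<beta>\<bar> \<le> 4 * \<delta> * Q" "real (card E) \<le> 12 * \<delta> * Q / \<bar>real_of_int \<beta>\<bar>"
    "\<bar>real_of_int \<gamma>\<bar> \<le> (\<bar>a\<bar> + \<bar>b\<bar> + \<bar>f a\<bar> + G * (b - a) + 1) * \<bar>real_of_int \<beta>\<bar>"
proof -
  have finE: "finite E" using E(3) by (intro card_ge_0_finite) linarith
  obtain P P' where PP: "P \<in> E" "P' \<in> E" "P \<noteq> P'"
    using E(3) card_le_Suc0_iff_eq[OF finE] by fastforce
  obtain q p r where Pe: "P = (q, p, r)" by (cases P)
  have P: "P \<in> near_pts f a b Q \<delta>" using PP E by auto
  note Pd = near_ptsD[OF P]
  have b0: "\<beta> \<noteq> 0"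
  proof
    assume "\<beta> = 0"
    then have "\<alpha> = 0" using l(2,3) G(1) by (auto simp: mult_le_0_iff)
    then have "\<gamma> * q = 0" using E(2)[OF PP(1)] \<open>\<beta> = 0\<close> by (simp add: on_line_def Pe)
    then have "\<gamma> = 0" using Pd(1) by (simp add: Pe)
    then show False using l(1) \<open>\<alpha> = 0\<close> \<open>\<beta> = 0\<close> by (simp add: prim3_def)
  qed
  then show "1 \<le> \<bar>\<beta>\<bar>" by linarith
  then have b1: "1 \<le> \<bar>real_of_int \<beta>\<bar>" by linarith
  have close: "\<bar>pty P1 - pty P2\<bar> \<le> 4 * \<delta> / Q" if PP12: "P1 \<in> E" "P2 \<in> E" for P1 P2
  proof (cases "P1 = P2")
    case False
    have N: "P1 \<in> near_pts f a b Q \<delta>" "P2 \<in> near_pts f a b Q \<delta>" using PP12 E by auto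
    note D1 = near_ptsD[OF N(1)] and D2 = near_ptsD[OF N(2)]
    define X Y where "X = \<bar>ptx P1 - ptx P2\<bar>" "Y = \<bar>pty P1 - pty P2\<bar>"
    have "real_of_int \<beta> * (ptx P1 - ptx P2) = - (real_of_int \<alpha> * (pty P1 - pty P2))"
      using line_spacing(1)[OF N False l(1) E(2)[OF PP12(1)] E(2)[OF PP12(2)]] by linarith
    then have "\<bar>real_of_int \<beta> * (ptx P1 - ptx P2)\<bar> = \<bar>real_of_int \<alpha> * (pty P1 - pty P2)\<bar>" by linarith
    then have "\<bar>real_of_int \<beta>\<bar> * X = real_of_int \<alpha> * Y"
      using l(2) unfolding X_Y_def abs_mult by simp
    then have "(2 * G + 2) * (\<bar>real_of_int \<beta>\<bar> * X) = ((2 * G + 2) * real_of_int \<alpha>) * Y" by simp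
    also have "\<dots> \<le> \<bar>real_of_int \<beta>\<bar> * Y" using l(3) by (intro mult_right_mono) (auto simp: X_Y_def)
    finally have "\<bar>real_of_int \<beta>\<bar> * ((2 * G + 2) * X) \<le> \<bar>real_of_int \<beta>\<bar> * Y" by (simp add: mult.left_commute)
    then have "(2 * G + 2) * X \<le> Y" using b1 by (simp add: mult_le_cancel_left)
    moreover have "X \<ge> 0" by (simp add: X_Y_def)
    ultimately have "2 * (G * X) \<le> Y" by (simp add: algebra_simps)
    moreover have "\<bar>f (ptx P1) - f (ptx P2)\<bar> \<le> G * X"
      unfolding X_Y_def using D1 D2 by (intro G(2)) auto
    then have "Y \<le> G * X + 2 * (\<delta> / Q)" using D1(6) D2(6) unfolding X_Y_def by linarith
    ultimately have "Y \<le> 4 * (\<delta> / Q)" by linarith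
    then show ?thesis unfolding X_Y_def by simp
  qed (use d Q in auto)
  have sep: "\<bar>real_of_int \<beta>\<bar> / Q^2 \<le> \<bar>pty P1 - pty P2\<bar>" if "P1 \<in> E" "P2 \<in> E" "P1 \<noteq> P2" for P1 P2
    using line_spacing(3)[OF _ _ that(3) l(1) E(2)[OF that(1)] E(2)[OF that(2)] b0] that E(1) by blast
  have Q2: "0 < Q^2" using Q by simp
  have "\<bar>real_of_int \<beta>\<bar> / Q^2 \<le> 4 * \<delta> / Q" using sep[OF PP] close[OF PP(1,2)] by linarith
  then have "\<bar>real_of_int \<beta>\<bar> \<le> 4 * \<delta> / Q * Q^2" using Q2 by (simp add: divide_le_eq)
  then show b2: "\<bar>real_of_int \<beta>\<bar> \<le> 4 * \<delta> * Q" using Q by (simp add: power2_eq_square)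
  have inj: "inj_on pty E"
  proof (rule inj_onI, rule ccontr)
    fix P1 P2 assume *: "P1 \<in> E" "P2 \<in> E" "pty P1 = pty P2" "P1 \<noteq> P2"
    have "0 < \<bar>real_of_int \<beta>\<bar> / Q^2" using b1 Q2 by simp
    then show False using sep[OF *(1,2,4)] *(3) by simp
  qed
  have "real (card (pty ` E)) \<le> ((pty P + 4 * \<delta> / Q) - (pty P - 4 * \<delta> / Q)) / (\<bar>real_of_int \<beta>\<bar> / Q^2) + 1"
  proof (rule separated_set_card(2))
    show "\<bar>real_of_int \<beta>\<bar> / Q^2 \<le> \<bar>x - y\<bar>" if xy: "x \<in> pty ` E" "y \<in> pty ` E" "x \<noteq> y" for x y
    proof -
      obtain P1 P2 where "P1 \<in> E" "x = pty P1" "P2 \<in> E" "y = pty P2" using xy by blast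
      then show ?thesis using sep[of P1 P2] xy(3) by blast
    qed
    show "pty ` E \<subseteq> {pty P - 4 * \<delta> / Q..pty P + 4 * \<delta> / Q}"
    proof
      fix y assume "y \<in> pty ` E"
      then obtain P1 where "P1 \<in> E" "y = pty P1" by blast
      then show "y \<in> {pty P - 4 * \<delta> / Q..pty P + 4 * \<delta> / Q}" using close[OF \<open>P1 \<in> E\<close> PP(1)] unfolding \<open>y = pty P1\<close> atLeastAtMost_iff by linarith
    qed
    have "0 \<le> 4 * \<delta> / Q" using d Q by simp
    then show "pty P - 4 * \<delta> / Q \<le> pty P + 4 * \<delta> / Q" by linarith
    show "0 < \<bar>real_of_int \<beta>\<bar> / Q^2" using b1 Q2 by simp
  qed
  also have "((pty P + 4 * \<delta> / Q) - (pty P - 4 * \<delta> / Q)) / (\<bar>real_of_int \<beta>\<bar> / Q^2) = 8 * \<delta> * Q / \<bar>real_of_int \<beta>\<bar>"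
    using Q by (simp add: power2_eq_square field_simps)
  \<comment> \<open>Two points on the line already give |\<beta>| \<le> 4 \<delta> Q, which absorbs
    the 1 of the count.\<close>
  also have "1 \<le> 4 * \<delta> * Q / \<bar>real_of_int \<beta>\<bar>" using b1 b2 by (simp add: le_divide_eq)
  finally show "real (card E) \<le> 12 * \<delta> * Q / \<bar>real_of_int \<beta>\<bar>" using inj
    by (simp add: card_image add_divide_distrib[symmetric] mult_ac)
  have "\<gamma> * q = - (\<beta> * p) - \<alpha> * r" using E(2)[OF PP(1)] by (simp add: on_line_def Pe)
  then have "real_of_int \<gamma> * q = - (\<beta> * p) - \<alpha> * r" by (metis of_int_diff of_int_minus of_int_mult)
  then have ge: "real_of_int \<gamma> = - (\<beta> * ptx P) - \<alpha> * pty P" using Pd(1) by (simp add: Pe field_simps)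
  have x: "\<bar>ptx P\<bar> \<le> \<bar>a\<bar> + \<bar>b\<bar>" using Pd(4,5) by linarith
  have "\<bar>f (ptx P) - f a\<bar> \<le> G * \<bar>ptx P - a\<bar>" using Pd(4,5) \<open>a \<le> b\<close> by (intro G(2)) auto
  also have "\<dots> \<le> G * (b - a)" using Pd(4,5) G(1) by (intro mult_left_mono) auto
  moreover have "\<delta> / Q \<le> 1" using d Q by simp
  ultimately have y: "\<bar>pty P\<bar> \<le> \<bar>f a\<bar> + G * (b - a) + 1" using Pd(6) by linarith
  have "real_of_int \<alpha> \<le> (2 * G + 2) * real_of_int \<alpha>" using G(1) l(2) by (simp add: algebra_simps)
  then have ab: "\<bar>real_of_int \<alpha>\<bar> \<le> \<bar>real_of_int \<beta>\<bar>" using l by linarith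
  have "\<bar>real_of_int \<gamma>\<bar> \<le> \<bar>real_of_int \<beta>\<bar> * \<bar>ptx P\<bar> + \<bar>real_of_int \<alpha>\<bar> * \<bar>pty P\<bar>"
    unfolding ge abs_mult[symmetric] by linarith
  also have "\<dots> \<le> \<bar>real_of_int \<beta>\<bar> * (\<bar>a\<bar> + \<bar>b\<bar>) + \<bar>real_of_int \<beta>\<bar> * (\<bar>f a\<bar> + G * (b - a) + 1)"
    using x y ab by (intro add_mono mult_mono) auto
  finally show "\<bar>real_of_int \<gamma>\<bar> \<le> (\<bar>a\<bar> + \<bar>b\<bar> + \<bar>f a\<bar> + G * (b - a) + 1) * \<bar>real_of_int \<beta>\<bar>"
    by (simp add: algebra_simps)
qed

text \<open>The factor |\<beta>| in the number of \<gamma> cancels the denominator in the bound on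
  \<open>K\<close>. There remain the numbers of \<alpha> and of \<beta>, at most 2 / \<delta> and 12
  \<delta> Q; hence 288 = 2 * 12 * 12.\<close>

lemma steep_sum:
  fixes A :: "(int \<times> int \<times> int) set" and K :: "int \<times> int \<times> int \<Rightarrow> real"
  assumes Q: "Q \<ge> 1" and d: "0 < \<delta>" "\<delta> \<le> 1" and "Z \<ge> 0" and "finite A"
    and A: "\<And>\<alpha> \<beta> \<gamma>. (\<alpha>, \<beta>, \<gamma>) \<in> A \<Longrightarrow> 0 \<le> \<alpha> \<and> real_of_int \<alpha> \<le> 1 / \<delta> \<and> 1 \<le> \<bar>\<beta>\<bar> \<and> \<bar>real_of_int \<beta>\<bar> \<le> 4 * \<delta> * Q \<and>
       \<bar>real_of_int \<gamma>\<bar> \<le> Z * \<bar>real_of_int \<beta>\<bar> \<and> K (\<alpha>, \<beta>, \<gamma>) \<le> 12 * \<delta> * Q / \<bar>real_of_int \<beta>\<bar>"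
  shows "sum K A \<le> 288 * (2 * Z + 1) * \<delta> * Q^2"
proof (cases "A = {}")
  case True
  then show ?thesis using d Q \<open>Z \<ge> 0\<close> by simp
next
  case False
  \<comment> \<open>A single line forces 1 \<le> 4 \<delta> Q, which absorbs the 1 in the number of
    \<beta>.\<close>
  then obtain \<alpha>0 \<beta>0 \<gamma>0 where "(\<alpha>0, \<beta>0, \<gamma>0) \<in> A" by auto
  from A[OF this] have dQ: "1 \<le> 4 * \<delta> * Q" by linarith
  define I1 where "I1 = {\<alpha>::int. 0 \<le> \<alpha> \<and> real_of_int \<alpha> \<le> 1 / \<delta>}"
  define I2 where "I2 = {\<beta>::int. 1 \<le> \<bar>\<beta>\<bar> \<and> \<bar>real_of_int \<beta>\<bar> \<le> 4 * \<delta> * Q}"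
  define I3 where "I3 \<beta> = {\<gamma>::int. \<bar>real_of_int \<gamma>\<bar> \<le> Z * \<bar>real_of_int \<beta>\<bar>}" for \<beta> :: int
  have c1: "finite I1" "real (card I1) \<le> 1 / \<delta> - 0 + 1"
    by (rule card_ints_in_interval[of I1 0 "1 / \<delta>"]; use d in \<open>auto simp: I1_def\<close>)+
  have c2: "finite I2" "real (card I2) \<le> 4 * \<delta> * Q - (- (4 * \<delta> * Q)) + 1"
  proof -
    have *: "- (4 * \<delta> * Q) \<le> 4 * \<delta> * Q" using dQ by linarith
    have **: "- (4 * \<delta> * Q) \<le> real_of_int n \<and> real_of_int n \<le> 4 * \<delta> * Q" if "n \<in> I2" for n
      using that unfolding I2_def by (simp add: abs_le_iff)
    note cc = card_ints_in_interval[of I2, OF ** *]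
    show "finite I2" by (rule cc(1))
    show "real (card I2) \<le> 4 * \<delta> * Q - (- (4 * \<delta> * Q)) + 1" by (rule cc(2))
  qed
  have c3: "finite (I3 \<beta>)" "real (card (I3 \<beta>)) \<le> Z * \<bar>real_of_int \<beta>\<bar> - (- (Z * \<bar>real_of_int \<beta>\<bar>)) + 1" for \<beta>
    by (rule card_ints_in_interval[of "I3 \<beta>" "- (Z * \<bar>real_of_int \<beta>\<bar>)" "Z * \<bar>real_of_int \<beta>\<bar>"];
        use \<open>Z \<ge> 0\<close> in \<open>auto simp: I3_def\<close>)+
  define S where "S = (SIGMA \<alpha>:I1. SIGMA \<beta>:I2. I3 \<beta>)"
  define h where "h = (\<lambda>(\<alpha>::int, \<beta>::int, \<gamma>::int). 12 * \<delta> * Q / \<bar>real_of_int \<beta>\<bar>)"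
  have AS: "A \<subseteq> S" using A by (auto simp: S_def I1_def I2_def I3_def)
  have "sum K A \<le> sum h A"
  proof (rule sum_mono)
    fix l assume "l \<in> A"
    then show "K l \<le> h l" using A by (cases l) (auto simp: h_def)
  qed
  also have "\<dots> \<le> sum h S"
    using AS c1 c2 c3 d Q by (intro sum_mono2) (auto simp: S_def h_def intro!: finite_SigmaI)
  also have "\<dots> = (\<Sum>\<alpha>\<in>I1. \<Sum>\<beta>\<in>I2. \<Sum>\<gamma>\<in>I3 \<beta>. 12 * \<delta> * Q / \<bar>real_of_int \<beta>\<bar>)"
  proof -
    have "sum h S = (\<Sum>\<alpha>\<in>I1. \<Sum>p\<in>Sigma I2 I3. h (\<alpha>, p))"
      unfolding S_def using sum.Sigma[of I1 "\<lambda>_. Sigma I2 I3" "\<lambda>\<alpha> p. h (\<alpha>, p)"] c1 c2 c3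
      by (simp add: finite_SigmaI)
    also have "\<dots> = (\<Sum>\<alpha>\<in>I1. \<Sum>\<beta>\<in>I2. \<Sum>\<gamma>\<in>I3 \<beta>. h (\<alpha>, \<beta>, \<gamma>))"
      using sum.Sigma[of I2 I3 "\<lambda>\<beta> \<gamma>. h (_, \<beta>, \<gamma>)"] c2 c3 by (intro sum.cong refl) simp
    finally show ?thesis by (simp add: h_def)
  qed
  also have "\<dots> \<le> (\<Sum>\<alpha>\<in>I1. \<Sum>\<beta>\<in>I2. (2 * Z + 1) * (12 * \<delta> * Q))"
  proof (intro sum_mono)
    fix \<beta> assume "\<beta> \<in> I2"
    then have b: "1 \<le> \<bar>real_of_int \<beta>\<bar>" by (auto simp: I2_def)
    have "(\<Sum>\<gamma>\<in>I3 \<beta>. 12 * \<delta> * Q / \<bar>real_of_int \<beta>\<bar>) = real (card (I3 \<beta>)) * (12 * \<delta> * Q / \<bar>real_of_int \<beta>\<bar>)" by simp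
    also have "\<dots> \<le> ((2 * Z + 1) * \<bar>real_of_int \<beta>\<bar>) * (12 * \<delta> * Q / \<bar>real_of_int \<beta>\<bar>)"
      using c3(2)[of \<beta>] b d Q by (intro mult_right_mono) (auto simp: algebra_simps)
    also have "\<dots> = (2 * Z + 1) * (12 * \<delta> * Q)" using b by simp
    finally show "(\<Sum>\<gamma>\<in>I3 \<beta>. 12 * \<delta> * Q / \<bar>real_of_int \<beta>\<bar>) \<le> (2 * Z + 1) * (12 * \<delta> * Q)" .
  qed
  also have "\<dots> = real (card I1) * (real (card I2) * ((2 * Z + 1) * (12 * \<delta> * Q)))" by simp
  also have "\<dots> \<le> (2 / \<delta>) * ((12 * \<delta> * Q) * ((2 * Z + 1) * (12 * \<delta> * Q)))"
  proof (intro mult_mono)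
    have "1 \<le> 1 / \<delta>" using d by simp
    then show "real (card I1) \<le> 2 / \<delta>" using c1(2) by simp
    show "real (card I2) \<le> 12 * \<delta> * Q" using c2(2) dQ by linarith
  qed (use d Q \<open>Z \<ge> 0\<close> in auto)
  also have "\<dots> = 288 * (2 * Z + 1) * \<delta> * Q^2" using d by (simp add: power2_eq_square field_simps)
  finally show ?thesis .
qed

section \<open>Shallow lines as points near the dual curve\<close>

text \<open>A middle point with wide gaps on both sides is the input to the convexity argument of
  \<open>near_tangent\<close>.\<close>

lemma three_separated:
  fixes X :: "real set"
  assumes sep: "\<And>x y. x \<in> X \<Longrightarrow> y \<in> X \<Longrightarrow> x \<noteq> y \<Longrightarrow> \<sigma> \<le> \<bar>x - y\<bar>" and "3 \<le> card X" "0 < \<sigma>"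
  obtains x1 x2 x3 where "x1 \<in> X" "x2 \<in> X" "x3 \<in> X" "real (card X) * \<sigma> / 4 \<le> x2 - x1" "real (card X) * \<sigma> / 4 \<le> x3 - x2"
proof -
  have fin: "finite X" using assms(2) by (intro card_ge_0_finite) linarith
  define xs where "xs = sorted_list_of_set X"
  define n where "n = card X"
  have xs: "sorted xs" "distinct xs" "set xs = X" "length xs = n" using fin by (auto simp: xs_def n_def)
  have step: "real (j - i) * \<sigma> \<le> xs ! j - xs ! i" if "i \<le> j" "j < n" for i j
    using that
  proof (induction j)
    case (Suc j)
    show ?case
    proof (cases "i = Suc j")
      case False
      then have ij: "i \<le> j" "j < n" using Suc.prems by auto
      have "xs ! j \<noteq> xs ! Suc j" using xs Suc.prems by (simp add: nth_eq_iff_index_eq)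
      moreover have "xs ! j \<le> xs ! Suc j" using xs Suc.prems by (intro sorted_nth_mono) auto
      moreover have "xs ! j \<in> X" "xs ! Suc j \<in> X" using xs Suc.prems by (metis Suc_lessD nth_mem)+
      ultimately have "\<sigma> \<le> xs ! Suc j - xs ! j" using sep[of "xs ! j" "xs ! Suc j"] by linarith
      then have "real (j - i) * \<sigma> + \<sigma> \<le> xs ! Suc j - xs ! i" using Suc.IH[OF ij] by linarith
      moreover have "real (Suc j - i) = real (j - i) + 1" using ij by (simp add: of_nat_diff)
      ultimately show ?thesis by (simp add: algebra_simps)
    qed simp
  qed simp
  have n3: "3 \<le> n" using assms by (simp add: n_def)
  define m where "m = n div 2"
  have m: "m < n" "m \<le> n - 1" "n - 1 < n" using n3 by (auto simp: m_def)
  have m1: "real n / 4 \<le> real m" unfolding m_def using n3 by linarith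
  have m2: "real n / 4 \<le> real (n - 1 - m)"
  proof -
    have "4 * m + 4 \<le> 3 * n"
    \<comment> \<open>The estimate 4 (n div 2) + 4 \<le> 2 n + 4 \<le> 3 n is available only for n
      \<ge> 4.\<close>
    proof (cases "n = 3")
      case False
      then show ?thesis using n3 by (simp add: m_def)
    qed (simp add: m_def)
    then have "n \<le> 4 * (n - 1 - m)" by linarith
    then show ?thesis by linarith
  qed
  have "real n * \<sigma> / 4 \<le> real m * \<sigma>" using mult_right_mono[OF m1, of \<sigma>] \<open>0 < \<sigma>\<close> by simp
  moreover have "real n * \<sigma> / 4 \<le> real (n - 1 - m) * \<sigma>" using mult_right_mono[OF m2, of \<sigma>] \<open>0 < \<sigma>\<close> by simp
  ultimately have "real n * \<sigma> / 4 \<le> xs ! m - xs ! 0" "real n * \<sigma> / 4 \<le> xs ! (n - 1) - xs ! m"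
    using step[of 0 m] step[of m "n - 1"] m by auto
  moreover have "xs ! 0 \<in> X" "xs ! m \<in> X" "xs ! (n - 1) \<in> X"
    using nth_mem[of _ xs] xs(3,4) m n3 by auto
  ultimately show thesis using that unfolding n_def by blast
qed

text \<open>Let F be \<gamma> + \<beta> x + \<alpha> f. From x2 to the outer point on the side where
  its tangent rises, F gains at least |F'(x2)| w + \<alpha> c w^2, yet at most 2 M. So F is nearly
  stationary at x2. The true critical point \<xi> lies within |F'(x2)| / (2 c \<alpha>) of x2, and F
  changes little on the way there.\<close>

lemma near_tangent:
  assumes bt: "bent c C f g" and al: "0 < \<alpha>" and w: "0 < w" "w \<le> x2 - x1" "w \<le> x3 - x2"
    and F: "\<bar>\<gamma> + \<beta> * x1 + \<alpha> * f x1\<bar> \<le> M" "\<bar>\<gamma> + \<beta> * x2 + \<alpha> * f x2\<bar> \<le> M" "\<bar>\<gamma> + \<beta> * x3 + \<alpha> * f x3\<bar> \<le> M"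
    and xi: "\<alpha> * g \<xi> = - \<beta>"
  shows "\<alpha> * c * w^2 \<le> 2 * M" "\<bar>\<gamma> + \<beta> * \<xi> + \<alpha> * f \<xi>\<bar> \<le> M + 2 * M^2 / (c * \<alpha> * w^2)"
proof -
  define F where "F x = \<gamma> + \<beta> * x + \<alpha> * f x" for x
  define F' where "F' x = \<beta> + \<alpha> * g x" for x
  have c: "0 < c" using bentD[OF bt] by auto
  have lo: "F' x * (y - x) + \<alpha> * c * (y - x)^2 \<le> F y - F x" for x y
  proof -
    have "\<alpha> * (c * (y - x)^2) \<le> \<alpha> * (f y - f x - g x * (y - x))"
      using bentD(4)[OF bt, of y x] al by (intro mult_left_mono) auto
    then show ?thesis by (simp add: F_def F'_def algebra_simps)
  qed
  have M: "\<bar>F x1\<bar> \<le> M" "\<bar>F x2\<bar> \<le> M" "\<bar>F x3\<bar> \<le> M" using F by (auto simp: F_def)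
  have Fxi: "F' \<xi> = 0" using xi by (simp add: F'_def)
  have *: "\<bar>F' x2\<bar> * w \<le> 2 * M \<and> \<alpha> * c * w^2 \<le> 2 * M"
  proof -
    have gen: "\<bar>F' x2\<bar> * w \<le> 2 * M \<and> \<alpha> * c * w^2 \<le> 2 * M"
      if z: "w \<le> \<bar>z - x2\<bar>" "\<bar>F z\<bar> \<le> M" "F' x2 * (z - x2) = \<bar>F' x2\<bar> * \<bar>z - x2\<bar>" for z
    proof -
      have "w^2 \<le> \<bar>z - x2\<bar>^2" using z(1) w by (intro power_mono) auto
      then have "\<alpha> * c * w^2 \<le> \<alpha> * c * (z - x2)^2" using al c by (intro mult_left_mono) auto
      moreover have "\<bar>F' x2\<bar> * w \<le> \<bar>F' x2\<bar> * \<bar>z - x2\<bar>" using z by (intro mult_left_mono) auto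
      moreover have "\<bar>F' x2\<bar> * \<bar>z - x2\<bar> + \<alpha> * c * (z - x2)^2 \<le> 2 * M"
        using lo[of x2 z] z M by linarith
      moreover have "0 \<le> \<bar>F' x2\<bar> * w" "0 \<le> \<alpha> * c * w^2" using w al c by auto
      ultimately show ?thesis by linarith
    qed
    show ?thesis
    proof (cases "F' x2 \<ge> 0")
      case True
      show ?thesis by (rule gen[of x3]) (use True w M in auto)
    next
      case False
      show ?thesis by (rule gen[of x1]) (use False w M in \<open>auto simp: abs_of_neg abs_if algebra_simps\<close>)
    qed
  qed
  then show "\<alpha> * c * w^2 \<le> 2 * M" by blast
  have D: "\<bar>F' x2\<bar> \<le> 2 * M / w" using * w by (simp add: le_divide_eq)
  have "2 * c * \<bar>x2 - \<xi>\<bar> \<le> \<bar>g x2 - g \<xi>\<bar>" by (rule bent_slope_abs(1)[OF bt])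
  then have "\<alpha> * (2 * c * \<bar>x2 - \<xi>\<bar>) \<le> \<alpha> * \<bar>g x2 - g \<xi>\<bar>" using al by (intro mult_left_mono) auto
  also have "\<dots> = \<bar>F' x2 - F' \<xi>\<bar>" using al by (simp add: F'_def abs_mult flip: right_diff_distrib)
  finally have "\<bar>x2 - \<xi>\<bar> \<le> \<bar>F' x2\<bar> / (2 * c * \<alpha>)" using Fxi al c by (simp add: field_simps)
  then have "\<bar>F' x2\<bar> * \<bar>x2 - \<xi>\<bar> \<le> \<bar>F' x2\<bar> * (\<bar>F' x2\<bar> / (2 * c * \<alpha>))" by (intro mult_left_mono) auto
  also have "\<dots> = \<bar>F' x2\<bar>^2 / (2 * c * \<alpha>)" by (simp add: power2_eq_square)
  also have "\<dots> \<le> (2 * M / w)^2 / (2 * c * \<alpha>)" using D c al by (intro divide_right_mono power_mono) auto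
  also have "\<dots> = 2 * M^2 / (c * \<alpha> * w^2)" by (simp add: power_divide power_mult_distrib field_simps)
  finally have 1: "\<bar>F' x2 * (\<xi> - x2)\<bar> \<le> 2 * M^2 / (c * \<alpha> * w^2)" by (simp add: abs_mult abs_minus_commute)
  have p: "0 \<le> \<alpha> * c * (\<xi> - x2)^2" "0 \<le> \<alpha> * c * (x2 - \<xi>)^2" using al c by auto
  have "F \<xi> \<ge> F x2 - 2 * M^2 / (c * \<alpha> * w^2)" using lo[of x2 \<xi>] 1 p by linarith
  moreover have "F \<xi> \<le> F x2" using lo[of \<xi> x2] Fxi p by simp
  moreover have "0 \<le> 2 * M^2 / (c * \<alpha> * w^2)" using 1 by linarith
  ultimately show "\<bar>\<gamma> + \<beta> * \<xi> + \<alpha> * f \<xi>\<bar> \<le> M + 2 * M^2 / (c * \<alpha> * w^2)"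
    using M(2) unfolding F_def[symmetric] by linarith
qed

text \<open>This is \<open>near_tangent\<close> with w = K \<alpha> / (4 Q^2), from the spacing on
  the line, and M = \<alpha> \<delta> / Q. The first conclusion there bounds K \<alpha> and also
  makes M at most the quadratic term of the second, whence 64 = 2 * 32. As \<xi> is where the
  tangent is parallel to the line, the second bound measures how far the dual point is from the
  Legendre dual.\<close>

lemma shallow_line:
  assumes bt: "bent c C f g" and Q: "Q \<ge> 1" and d: "0 < \<delta>"
    and l: "prim3 (\<alpha>, \<beta>, \<gamma>)" "0 < \<alpha>"
    and E: "E \<subseteq> near_pts f a b Q \<delta>" "\<And>P. P \<in> E \<Longrightarrow> on_line (\<alpha>, \<beta>, \<gamma>) P" "3 \<le> card E"
    and xi: "\<alpha> * g \<xi> = - real_of_int \<beta>"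
  shows "(real (card E) * \<alpha>)^2 \<le> 32 / c * (Q^3 * \<delta>)"
    "\<bar>\<gamma> + \<beta> * \<xi> + \<alpha> * f \<xi>\<bar> \<le> 64 * \<delta>^2 * Q^2 / (c * (real (card E))^2 * \<alpha>)"
proof -
  have c: "0 < c" using bentD[OF bt] by auto
  have finE: "finite E" using E(3) by (intro card_ge_0_finite) linarith
  define \<sigma> where "\<sigma> = real_of_int \<alpha> / Q^2"
  have Q2: "0 < Q" "0 < Q^2" using Q by auto
  have al: "1 \<le> real_of_int \<alpha>" using l by simp
  have s0: "0 < \<sigma>" using al Q2 by (simp add: \<sigma>_def)
  have sep: "\<sigma> \<le> \<bar>ptx P1 - ptx P2\<bar>" if "P1 \<in> E" "P2 \<in> E" "P1 \<noteq> P2" for P1 P2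
    using line_spacing(2)[OF subsetD[OF E(1) that(1)] subsetD[OF E(1) that(2)] that(3) l(1)
        E(2)[OF that(1)] E(2)[OF that(2)]] l(2) by (simp add: \<sigma>_def)
  have inj: "inj_on ptx E"
  proof (rule inj_onI, rule ccontr)
    fix P1 P2 assume *: "P1 \<in> E" "P2 \<in> E" "ptx P1 = ptx P2" "P1 \<noteq> P2"
    then show False using sep[OF *(1,2,4)] *(3) s0 by simp
  qed
  define K where "K = real (card E)"
  have K3: "K \<ge> 3" using E(3) by (simp add: K_def)
  have card: "card (ptx ` E) = card E" using inj by (rule card_image)
  obtain x1 x2 x3 where x: "x1 \<in> ptx ` E" "x2 \<in> ptx ` E" "x3 \<in> ptx ` E"
      "K * \<sigma> / 4 \<le> x2 - x1" "K * \<sigma> / 4 \<le> x3 - x2"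
  proof (rule three_separated[of "ptx ` E" \<sigma>])
    show "\<sigma> \<le> \<bar>x - y\<bar>" if xy: "x \<in> ptx ` E" "y \<in> ptx ` E" "x \<noteq> y" for x y
    proof -
      obtain P1 P2 where "P1 \<in> E" "x = ptx P1" "P2 \<in> E" "y = ptx P2" using xy by blast
      then show ?thesis using sep[of P1 P2] xy(3) by blast
    qed
  qed (use E(3) s0 card in \<open>auto simp: K_def\<close>)
  define M where "M = real_of_int \<alpha> * (\<delta> / Q)"
  have F: "\<bar>\<gamma> + \<beta> * x + \<alpha> * f x\<bar> \<le> M" if xE: "x \<in> ptx ` E" for x :: real
  proof -
    obtain P where P: "P \<in> E" "x = ptx P" using xE by blast
    obtain q p r where Pe: "P = (q, p, r)" by (cases P)
    have N: "P \<in> near_pts f a b Q \<delta>" using P E by auto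
    have "\<gamma> * q + \<beta> * p + \<alpha> * r = 0" using E(2)[OF P(1)] by (simp add: on_line_def Pe)
    then have "real_of_int \<gamma> * q + \<beta> * p + \<alpha> * r = 0" by (metis of_int_0 of_int_add of_int_mult)
    then have "\<gamma> + \<beta> * ptx P + \<alpha> * pty P = 0" using near_ptsD(1)[OF N] by (simp add: Pe field_simps)
    then have "\<gamma> + \<beta> * x + \<alpha> * f x = \<alpha> * (f (ptx P) - pty P)" by (simp add: P(2) algebra_simps)
    then show ?thesis unfolding M_def using near_ptsD(6)[OF N] al by (simp only: abs_mult) (intro mult_mono; simp)
  qed
  define w where "w = K * \<sigma> / 4"
  have w0: "0 < w" using K3 s0 by (simp add: w_def)
  have al0: "0 < real_of_int \<alpha>" using al by linarith
  note T = near_tangent[OF bt al0 w0 x(4)[folded w_def] x(5)[folded w_def] F[OF x(1)] F[OF x(2)] F[OF x(3)] xi]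
  have w2: "w^2 = K^2 * \<alpha>^2 / (16 * Q^4)" by (simp add: w_def \<sigma>_def power_mult_distrib power_divide)
  have "\<alpha> * (c * (K^2 * \<alpha>^2 / (16 * Q^4))) \<le> \<alpha> * (2 * (\<delta> / Q))"
    using T(1) unfolding w2 M_def by (simp add: mult_ac)
  then have "c * (K^2 * \<alpha>^2 / (16 * Q^4)) \<le> 2 * (\<delta> / Q)" using mult_left_le_imp_le[OF _ al0] by blast
  then have "c * (K^2 * \<alpha>^2) / (16 * Q^4) \<le> 2 * (\<delta> / Q)" by simp
  moreover have "0 < 16 * Q^4" using Q2 by simp
  ultimately have "c * (K^2 * \<alpha>^2) \<le> 2 * (\<delta> / Q) * (16 * Q^4)" by (simp only: pos_divide_le_eq)
  also have "\<dots> = 32 * (Q^3 * \<delta>)" using Q2 by (simp add: power4_eq_xxxx power3_eq_cube)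
  finally have k: "(K * \<alpha>)^2 \<le> 32 / c * (Q^3 * \<delta>)" using c by (simp add: power_mult_distrib field_simps)
  then show "(real (card E) * \<alpha>)^2 \<le> 32 / c * (Q^3 * \<delta>)" by (simp add: K_def)
  have e2: "2 * M^2 / (c * \<alpha> * w^2) = 32 * \<delta>^2 * Q^2 / (c * K^2 * \<alpha>)"
  proof -
    have gen: "2 * (a2 * d2 / q2) / (c * a * (k2 * a2 / (16 * (q2 * q2)))) = 32 * d2 * q2 / (c * k2 * a)"
      if "a2 \<noteq> 0" "q2 \<noteq> 0" "a \<noteq> 0" "k2 \<noteq> 0" for a a2 d2 q2 k2 :: real
      using that c by (simp add: field_simps)
    have "M^2 = \<alpha>^2 * \<delta>^2 / Q^2" by (simp add: M_def power_mult_distrib power_divide)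
    moreover have "w^2 = K^2 * \<alpha>^2 / (16 * (Q^2 * Q^2))" unfolding w2 by (simp flip: power_add)
    ultimately show ?thesis using gen[of "real_of_int \<alpha>^2" "Q^2" \<alpha> "K^2" "\<delta>^2"] al0 Q2 K3 by simp
  qed
  have "M = (\<delta> / (Q * c * K^2 * \<alpha>)) * (c * (K * \<alpha>)^2)"
    unfolding M_def using Q2 al0 c K3 by (simp add: power2_eq_square)
  also have "\<dots> \<le> (\<delta> / (Q * c * K^2 * \<alpha>)) * (32 * (Q^3 * \<delta>))"
    using k Q2 al0 c K3 d by (intro mult_left_mono) (auto simp: field_simps)
  also have "\<dots> = 32 * \<delta>^2 * Q^2 / (c * K^2 * \<alpha>)"
    using Q2 al0 c K3 by (simp add: power2_eq_square power3_eq_cube field_simps)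
  finally have "M \<le> 32 * \<delta>^2 * Q^2 / (c * K^2 * \<alpha>)" .
  then have "\<bar>\<gamma> + \<beta> * \<xi> + \<alpha> * f \<xi>\<bar> \<le> 32 * \<delta>^2 * Q^2 / (c * K^2 * \<alpha>) + 32 * \<delta>^2 * Q^2 / (c * K^2 * \<alpha>)"
    using T(2) e2 by linarith
  then show "\<bar>\<gamma> + \<beta> * \<xi> + \<alpha> * f \<xi>\<bar> \<le> 64 * \<delta>^2 * Q^2 / (c * (real (card E))^2 * \<alpha>)"
    by (simp add: K_def mult_ac)
qed

section \<open>Improving the exponent of the count\<close>

text \<open>All bent functions and all intervals are included because the induction hypothesis is
  applied to the dual curve. \<open>K\<close> is uniform in \<open>Q\<close> and \<delta>, since the
  dual problem comes with its own values of both.\<close>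

definition count_bound :: "real \<Rightarrow> bool" where
  "count_bound \<epsilon> \<longleftrightarrow> (\<forall>c C f g a b. bent c C f g \<longrightarrow> a \<le> b \<longrightarrow>
     (\<exists>K. \<forall>Q\<ge>1. \<forall>\<delta>>0. real (card (near_pts f a b Q \<delta>)) \<le> K * Q powr \<epsilon> * (Q + \<delta> * Q^2)))"

lemma count_bound_1: "count_bound 1"
  unfolding count_bound_def
proof (intro allI impI)
  fix c C :: real and f g :: "real \<Rightarrow> real" and a b :: real
  assume "a \<le> b"
  have "real (card (near_pts f a b Q \<delta>)) \<le> (2 * (b - a + 1)) * Q powr 1 * (Q + \<delta> * Q^2)"
    if Q: "Q \<ge> 1" "\<delta> > 0" for Q \<delta>
  proof -
    have "\<delta> * Q^2 \<le> \<delta> * (Q * Q^2)" using Q by (intro mult_left_mono) auto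
    then have "(1 + \<delta>) * Q^2 \<le> Q * (Q + \<delta> * Q^2)" by (simp add: algebra_simps power2_eq_square)
    then have "(2 * (b - a + 1)) * ((1 + \<delta>) * Q^2) \<le> (2 * (b - a + 1)) * (Q * (Q + \<delta> * Q^2))"
      using \<open>a \<le> b\<close> by (intro mult_left_mono) auto
    then show ?thesis using near_pts_trivial_bound(2)[OF \<open>a \<le> b\<close> Q, of f] Q by (simp add: mult_ac)
  qed
  then show "\<exists>K. \<forall>Q\<ge>1. \<forall>\<delta>>0. real (card (near_pts f a b Q \<delta>)) \<le> K * Q powr 1 * (Q + \<delta> * Q^2)"
    by blast
qed

lemma count_boundE:
  assumes "count_bound \<epsilon>" "bent c C f g" "a \<le> b"
  obtains K where "K \<ge> 0" "\<And>Q \<delta>. Q \<ge> 1 \<Longrightarrow> \<delta> > 0 \<Longrightarrow>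
      real (card (near_pts f a b Q \<delta>)) \<le> K * Q powr \<epsilon> * (Q + \<delta> * Q^2)"
proof -
  have "\<exists>K. \<forall>Q\<ge>1. \<forall>\<delta>>0. real (card (near_pts f a b Q \<delta>)) \<le> K * Q powr \<epsilon> * (Q + \<delta> * Q^2)"
    using assms(1)[unfolded count_bound_def, rule_format, OF assms(2,3)] .
  then obtain K where K: "\<forall>Q\<ge>1. \<forall>\<delta>>0. real (card (near_pts f a b Q \<delta>)) \<le> K * Q powr \<epsilon> * (Q + \<delta> * Q^2)" ..
  show thesis
  proof (rule that[of "max K 0"])
    fix Q \<delta> :: real assume Q: "Q \<ge> 1" "\<delta> > 0"
    have "K * Q powr \<epsilon> * (Q + \<delta> * Q^2) \<le> max K 0 * Q powr \<epsilon> * (Q + \<delta> * Q^2)"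
      using Q by (intro mult_right_mono) auto
    moreover have "real (card (near_pts f a b Q \<delta>)) \<le> K * Q powr \<epsilon> * (Q + \<delta> * Q^2)"
      using K Q by simp
    ultimately show "real (card (near_pts f a b Q \<delta>)) \<le> max K 0 * Q powr \<epsilon> * (Q + \<delta> * Q^2)" by linarith
  qed simp
qed

lemma count_bound_mono:
  assumes "count_bound \<epsilon>" "\<epsilon> \<le> \<epsilon>'"
  shows "count_bound \<epsilon>'"
  unfolding count_bound_def
proof (intro allI impI)
  fix c C :: real and f g :: "real \<Rightarrow> real" and a b :: real
  assume bt: "bent c C f g" and ab: "a \<le> b"
  obtain K where K0: "K \<ge> 0" and K: "\<And>Q \<delta>. Q \<ge> 1 \<Longrightarrow> \<delta> > 0 \<Longrightarrow>
      real (card (near_pts f a b Q \<delta>)) \<le> K * Q powr \<epsilon> * (Q + \<delta> * Q^2)"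
    by (rule count_boundE[OF assms(1) bt ab]) (rule that; blast)
  show "\<exists>K. \<forall>Q\<ge>1. \<forall>\<delta>>0. real (card (near_pts f a b Q \<delta>)) \<le> K * Q powr \<epsilon>' * (Q + \<delta> * Q^2)"
  proof (intro exI[of _ K] allI impI)
    fix Q \<delta> :: real assume Q: "Q \<ge> 1" "\<delta> > 0"
    have "K * Q powr \<epsilon> \<le> K * Q powr \<epsilon>'"
      using Q K0 assms(2) by (intro mult_left_mono powr_mono) auto
    then have "K * Q powr \<epsilon> * (Q + \<delta> * Q^2) \<le> K * Q powr \<epsilon>' * (Q + \<delta> * Q^2)"
      using Q by (intro mult_right_mono) auto
    then show "real (card (near_pts f a b Q \<delta>)) \<le> K * Q powr \<epsilon>' * (Q + \<delta> * Q^2)"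
      using K[OF Q] by linarith
  qed
qed

text \<open>In a block the sizes J of \<alpha> and \<kappa> of the cardinality are fixed up to a
  factor 2. The lines are counted near the dual curve at height 2 J; multiplied by \<kappa> this
  leaves \<kappa> J and \<delta>^2 Q^2 J / \<kappa>, both O(Q + \<delta> Q^2), with a loss of (2
  J)^\<epsilon>. The lower bound Q^t on the cardinality is what keeps J below Q by a power.\<close>

lemma dyadic_block:
  fixes A :: "(int \<times> int \<times> int) set" and E :: "int \<times> int \<times> int \<Rightarrow> (int \<times> int \<times> int) set"
  assumes bt: "bent c C f g" and h: "\<And>t. g (h t) = t"
    and Q: "Q \<ge> 1" and d: "0 < \<delta>" and t: "0 \<le> t" and \<epsilon>: "0 < \<epsilon>"
    and K': "K' \<ge> 0" "\<And>Q' \<delta>'. Q' \<ge> 1 \<Longrightarrow> \<delta>' > 0 \<Longrightarrow>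
       real (card (near_pts (\<lambda>s. s * h s - f (h s)) (- B) B Q' \<delta>')) \<le> K' * Q' powr \<epsilon> * (Q' + \<delta>' * Q'^2)"
    and B: "- B \<le> B"
    and finA: "finite A"
    and A: "\<And>\<alpha> \<beta> \<gamma>. (\<alpha>, \<beta>, \<gamma>) \<in> A \<Longrightarrow> prim3 (\<alpha>, \<beta>, \<gamma>) \<and> 0 < \<alpha> \<and> \<bar>real_of_int \<beta>\<bar> \<le> B * \<alpha> \<and> \<alpha> * \<delta> \<le> 1 \<and>
       2^j \<le> real_of_int \<alpha> \<and> real_of_int \<alpha> < 2^(j+1)"
    and E: "\<And>l. l \<in> A \<Longrightarrow> E l \<subseteq> near_pts f a b Q \<delta>" "\<And>l P. l \<in> A \<Longrightarrow> P \<in> E l \<Longrightarrow> on_line l P"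
       "\<And>l. l \<in> A \<Longrightarrow> 3 \<le> card (E l) \<and> Q powr t \<le> card (E l) \<and> 2^k \<le> card (E l) \<and> card (E l) < 2^(k+1)"
  shows "(\<Sum>l\<in>A. real (card (E l))) \<le>
     K' * (2 * (32 / c) powr (1/3)) powr \<epsilon> * (4 * sqrt (32 / c) + 1024 / c) * Q powr (\<epsilon> - 2 * t * \<epsilon> / 3) * (Q + \<delta> * Q^2)"
proof (cases "A = {}")
  case True
  have "0 < c" using bentD[OF bt] by auto
  then show ?thesis using True K'(1) Q d by (auto intro!: mult_nonneg_nonneg add_nonneg_nonneg)
next
  case False
  have c: "0 < c" using bentD[OF bt] by auto
  define J \<kappa> where "J = (2::real)^j" and "\<kappa> = (2::real)^k"
  have Jk: "1 \<le> J" "1 \<le> \<kappa>" by (auto simp: J_def \<kappa>_def)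
  define U where "U = Q + \<delta> * Q^2"
  have U: "0 < U" "Q \<le> U" "\<delta> * Q^2 \<le> U" using Q d by (auto simp: U_def intro!: add_pos_pos)
  define fs where "fs s = s * h s - f (h s)" for s
  \<comment> \<open>Chosen so that \<open>\<delta>s / (2 * J)\<close> is the bound of
    \<open>shallow_line\<close> divided by \<alpha>, with \<alpha> and the cardinality replaced by
    their lower ends J and \<kappa>.\<close>
  define \<delta>s where "\<delta>s = 128 * \<delta>^2 * Q^2 / (c * \<kappa>^2 * J)"
  have ds: "\<delta>s > 0" using d Q c Jk by (simp add: \<delta>s_def)
  define R where "R = 32 / c"
  have R: "0 < R" using c by (simp add: R_def)
  have sh: "(real (card (E l)) * \<alpha>)^2 \<le> R * (Q^3 * \<delta>) \<and>
      \<bar>fs (- \<beta> / \<alpha>) - \<gamma> / \<alpha>\<bar> \<le> \<delta>s / (2 * J)" if lA: "l \<in> A" and l: "l = (\<alpha>, \<beta>, \<gamma>)" for l and \<alpha> \<beta> \<gamma> :: int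
  proof -
    note Al = A[OF lA[unfolded l]]
    have al0: "0 < real_of_int \<alpha>" using Al by simp
    define \<xi> where "\<xi> = h (- \<beta> / \<alpha>)"
    have xi: "real_of_int \<alpha> * g \<xi> = - real_of_int \<beta>" using al0 by (simp add: \<xi>_def h)
    have c3: "3 \<le> card (E l)" using E(3)[OF lA] by simp
    have on: "\<And>P. P \<in> E l \<Longrightarrow> on_line (\<alpha>, \<beta>, \<gamma>) P" using E(2)[OF lA] l by simp
    have pr: "prim3 (\<alpha>, \<beta>, \<gamma>)" "0 < \<alpha>" using Al by auto
    note S = shallow_line[OF bt Q d pr E(1)[OF lA] on c3 xi]
    define k where "k = real (card (E l))"
    have k: "\<kappa> \<le> k" unfolding k_def \<kappa>_def using E(3)[OF lA] by (metis of_nat_le_iff of_nat_numeral of_nat_power)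
    have aJ: "J \<le> \<alpha>" using Al by (simp add: J_def)
    \<comment> \<open>As \<xi> is \<open>h (- \<beta> / \<alpha>)\<close>, evaluating the line on
      the curve at \<xi> gives -\<alpha> times the error of the dual rational point.\<close>
    have e: "real_of_int \<gamma> + \<beta> * \<xi> + \<alpha> * f \<xi> = - \<alpha> * (fs (- \<beta> / \<alpha>) - \<gamma> / \<alpha>)"
      unfolding fs_def \<xi>_def[symmetric] using al0 by (simp add: field_simps)
    have "\<alpha> * \<bar>fs (- \<beta> / \<alpha>) - \<gamma> / \<alpha>\<bar> = \<bar>real_of_int \<gamma> + \<beta> * \<xi> + \<alpha> * f \<xi>\<bar>"
      unfolding e abs_mult using al0 by simp
    also have "\<dots> \<le> 64 * \<delta>^2 * Q^2 / (c * k^2 * \<alpha>)" using S(2) by (simp add: k_def)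
    finally have "\<bar>fs (- \<beta> / \<alpha>) - \<gamma> / \<alpha>\<bar> \<le> 64 * \<delta>^2 * Q^2 / (c * k^2 * \<alpha>) / \<alpha>"
      by (subst pos_le_divide_eq[OF al0], subst mult.commute)
    also have "\<dots> = 64 * \<delta>^2 * Q^2 / (c * k^2 * \<alpha>^2)" by (simp add: power2_eq_square mult_ac)
    also have "\<dots> \<le> 64 * \<delta>^2 * Q^2 / (c * \<kappa>^2 * J^2)"
      using c k aJ Jk by (intro divide_left_mono mult_mono power_mono mult_pos_pos) auto
    also have "\<dots> = \<delta>s / (2 * J)" by (simp add: \<delta>s_def power2_eq_square mult_ac)
    finally show ?thesis using S(1) by (simp add: R_def)
  qed
  have inj: "inj_on (\<lambda>(\<alpha>, \<beta>, \<gamma>). (\<alpha>, - \<beta>, \<gamma>)) A" by (auto simp: inj_on_def)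
  have sub: "(\<lambda>(\<alpha>, \<beta>, \<gamma>). (\<alpha>, - \<beta>, \<gamma>)) ` A \<subseteq> near_pts fs (- B) B (2 * J) \<delta>s"
  proof
    fix P assume "P \<in> (\<lambda>(\<alpha>, \<beta>, \<gamma>). (\<alpha>, - \<beta>, \<gamma>)) ` A"
    then obtain \<alpha> \<beta> \<gamma> where l: "(\<alpha>, \<beta>, \<gamma>) \<in> A" "P = (\<alpha>, - \<beta>, \<gamma>)" by auto
    note Al = A[OF l(1)]
    have al0: "0 < real_of_int \<alpha>" using Al by simp
    have "- (B * \<alpha>) \<le> real_of_int \<beta>" "real_of_int \<beta> \<le> B * \<alpha>" using Al by (auto simp: abs_le_iff)
    then have "- B \<le> - real_of_int \<beta> / \<alpha>" "- real_of_int \<beta> / \<alpha> \<le> B" using al0 by (auto simp: field_simps)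
    moreover have "\<bar>fs (- \<beta> / \<alpha>) - \<gamma> / \<alpha>\<bar> \<le> \<delta>s / (2 * J)" using sh[OF l(1) refl] by blast
    ultimately show "P \<in> near_pts fs (- B) B (2 * J) \<delta>s"
      using Al unfolding near_pts_def l(2) by (simp add: J_def prim3_def)
  qed
  have "real (card A) = real (card ((\<lambda>(\<alpha>, \<beta>, \<gamma>). (\<alpha>, - \<beta>, \<gamma>)) ` A))" using inj by (simp add: card_image)
  also have "\<dots> \<le> real (card (near_pts fs (- B) B (2 * J) \<delta>s))"
    using sub near_pts_trivial_bound(1)[OF B _ ds, of "2 * J" fs] Jk by (simp add: card_mono)
  also have "\<dots> \<le> K' * (2 * J) powr \<epsilon> * (2 * J + \<delta>s * (2 * J)^2)"
    using K'(2)[of "2 * J" \<delta>s] Jk ds unfolding fs_def by simp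
  finally have cA: "real (card A) \<le> K' * (2 * J) powr \<epsilon> * (2 * J + \<delta>s * (2 * J)^2)" .
  have "(\<Sum>l\<in>A. real (card (E l))) \<le> (\<Sum>l\<in>A. 2 * \<kappa>)"
  proof (rule sum_mono)
    fix l assume "l \<in> A"
    then have "card (E l) \<le> 2^(k+1)" using E(3) by fastforce
    then have "real (card (E l)) \<le> real (2^(k+1))" by (simp only: of_nat_le_iff)
    then show "real (card (E l)) \<le> 2 * \<kappa>" by (simp add: \<kappa>_def)
  qed
  also have "\<dots> = 2 * \<kappa> * real (card A)" by simp
  also have "\<dots> \<le> 2 * \<kappa> * (K' * (2 * J) powr \<epsilon> * (2 * J + \<delta>s * (2 * J)^2))"
    using cA Jk by (intro mult_left_mono) auto
  also have "\<dots> = K' * (2 * J) powr \<epsilon> * (4 * (\<kappa> * J) + 1024 / c * (\<delta>^2 * Q^2 * J / \<kappa>))"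
    unfolding \<delta>s_def using c Jk by (simp add: field_simps power2_eq_square)
  also have "\<dots> \<le> K' * ((2 * R powr (1/3)) powr \<epsilon> * Q powr (\<epsilon> - 2 * t * \<epsilon> / 3)) * (4 * (sqrt R * U) + 1024 / c * U)"
  proof -
    obtain l where lA: "l \<in> A" using False by blast
    obtain \<alpha> \<beta> \<gamma> where l: "l = (\<alpha>, \<beta>, \<gamma>)" by (cases l)
    note Al = A[OF lA[unfolded l]]
    define k' where "k' = real (card (E l))"
    have k: "\<kappa> \<le> k'" unfolding k'_def \<kappa>_def using E(3)[OF lA] by (metis of_nat_le_iff of_nat_numeral of_nat_power)
    have kQ: "Q powr t \<le> k'" using E(3)[OF lA] by (simp add: k'_def)
    have aJ: "J \<le> \<alpha>" "1 \<le> real_of_int \<alpha>" using Al Jk by (auto simp: J_def)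
    have main: "(k' * \<alpha>)^2 \<le> R * (Q^3 * \<delta>)" using sh[OF lA l] by (simp add: k'_def)
    \<comment> \<open>Q^3 \<delta> is the product of the two parts of U, so its square root is at
      most U.\<close>
    have "Q^3 * \<delta> = Q * (\<delta> * Q^2)" by (simp add: power3_eq_cube power2_eq_square)
    also have "\<dots> \<le> U * U" using U Q d by (intro mult_mono) auto
    finally have "R * (Q^3 * \<delta>) \<le> R * U^2" using R by (simp add: power2_eq_square)
    moreover have "(sqrt R * U)^2 = R * U^2" using R by (simp add: power_mult_distrib)
    ultimately have "(k' * \<alpha>)^2 \<le> (sqrt R * U)^2" using main by linarith
    then have "k' * \<alpha> \<le> sqrt R * U" by (rule power2_le_imp_le) (use R U in \<open>auto intro!: mult_nonneg_nonneg\<close>)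
    moreover have "\<kappa> * J \<le> k' * \<alpha>" using k aJ Jk by (intro mult_mono) auto
    ultimately have 1: "\<kappa> * J \<le> sqrt R * U" by linarith
    have "J * \<delta> \<le> \<alpha> * \<delta>" using aJ d by (intro mult_right_mono) auto
    also have ad: "\<alpha> * \<delta> \<le> 1" using Al by simp
    finally have Jd: "J * \<delta> \<le> 1" .
    have "\<delta>^2 * Q^2 * J / \<kappa> \<le> \<delta>^2 * Q^2 * J / 1" using Jk by (intro divide_left_mono) auto
    also have "\<dots> = (\<delta> * Q^2) * (J * \<delta>)" by (simp add: power2_eq_square)
    also have "\<dots> \<le> (\<delta> * Q^2) * 1" using Jd d by (intro mult_left_mono) auto
    finally have 2: "\<delta>^2 * Q^2 * J / \<kappa> \<le> U" using U by linarith
    \<comment> \<open>Multiplying the bound on (k' \<alpha>)^2 by \<alpha> and using \<alpha>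
      \<delta> \<le> 1 removes \<delta>; what is left is a bound on \<alpha>^3 in terms of Q
      alone.\<close>
    have "(Q powr t)^2 * real_of_int \<alpha>^3 \<le> k'^2 * real_of_int \<alpha>^3" using kQ aJ by (intro mult_right_mono power_mono) auto
    also have "\<dots> = (k' * \<alpha>)^2 * \<alpha>" by (simp add: power2_eq_square power3_eq_cube)
    also have "\<dots> \<le> R * (Q^3 * \<delta>) * \<alpha>" using main aJ by (intro mult_right_mono) auto
    also have "\<dots> = R * Q^3 * (\<alpha> * \<delta>)" by simp
    also have "\<dots> \<le> R * Q^3 * 1" using ad R Q by (intro mult_left_mono) auto
    finally have "(Q powr t)^2 * real_of_int \<alpha>^3 \<le> R * Q^3" by simp
    moreover have "(Q powr t)^2 = Q powr (2 * t)" using Q by (simp add: powr_power mult.commute)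
    moreover have "Q^3 = Q powr 3" using Q by (simp add: powr_numeral)
    ultimately have *: "Q powr (2 * t) * real_of_int \<alpha>^3 \<le> R * Q powr 3" by (simp only:)
    have "real_of_int \<alpha>^3 \<le> R * Q powr 3 / Q powr (2 * t)"
      using Q by (subst pos_le_divide_eq) (use * in \<open>auto simp: mult.commute\<close>)
    also have "\<dots> = R * Q powr (3 - 2 * t)" by (simp add: powr_diff)
    finally have a3: "real_of_int \<alpha>^3 \<le> R * Q powr (3 - 2 * t)" .
    have "real_of_int \<alpha>^3 = real_of_int \<alpha> powr 3" using aJ by (simp add: powr_numeral)
    then have "real_of_int \<alpha> = (real_of_int \<alpha>^3) powr (1/3)"
      using aJ by (simp only: powr_powr) simp
    also have "\<dots> \<le> (R * Q powr (3 - 2 * t)) powr (1/3)" using a3 aJ by (intro powr_mono2) auto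
    also have "\<dots> = R powr (1/3) * Q powr (1 - 2 * t / 3)"
      using R by (simp add: powr_mult powr_powr diff_divide_distrib)
    finally have a1: "real_of_int \<alpha> \<le> R powr (1/3) * Q powr (1 - 2 * t / 3)" .
    have "(2 * J) powr \<epsilon> \<le> ((2 * R powr (1/3)) * Q powr (1 - 2 * t / 3)) powr \<epsilon>"
      using a1 aJ Jk \<epsilon> by (intro powr_mono2) auto
    also have "\<dots> = (2 * R powr (1/3)) powr \<epsilon> * Q powr ((1 - 2 * t / 3) * \<epsilon>)"
      by (subst powr_mult) (auto simp: powr_powr)
    also have "(1 - 2 * t / 3) * \<epsilon> = \<epsilon> - 2 * t * \<epsilon> / 3" by (simp add: algebra_simps)
    finally have 3: "(2 * J) powr \<epsilon> \<le> (2 * R powr (1/3)) powr \<epsilon> * Q powr (\<epsilon> - 2 * t * \<epsilon> / 3)" .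
    show ?thesis
    proof (rule mult_mono)
      show "K' * (2 * J) powr \<epsilon> \<le> K' * ((2 * R powr (1/3)) powr \<epsilon> * Q powr (\<epsilon> - 2 * t * \<epsilon> / 3))"
        using 3 K'(1) by (intro mult_left_mono)
      show "4 * (\<kappa> * J) + 1024 / c * (\<delta>^2 * Q^2 * J / \<kappa>) \<le> 4 * (sqrt R * U) + 1024 / c * U"
        by (rule add_mono; rule mult_left_mono) (use 1 2 c in auto)
    qed (use K'(1) c Jk in auto)
  qed
  also have "\<dots> = K' * (2 * (32 / c) powr (1/3)) powr \<epsilon> * (4 * sqrt (32 / c) + 1024 / c) * Q powr (\<epsilon> - 2 * t * \<epsilon> / 3) * (Q + \<delta> * Q^2)"
    unfolding R_def[symmetric] U_def[symmetric] by (simp only: algebra_simps)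
  finally show ?thesis .
qed

text \<open>The square counts pairs of dyadic exponents, one for \<alpha> and one for the
  cardinality, both of which stay below M Q^2.\<close>

lemma log_count_bound:
  fixes M \<eta> :: real
  assumes "M \<ge> 1" "\<eta> > 0"
  obtains C where "C \<ge> 0" "\<And>Q::real. Q \<ge> 1 \<Longrightarrow> (real (nat \<lfloor>log 2 (M * Q^2)\<rfloor>) + 1)^2 \<le> C * Q powr \<eta>"
proof -
  define e where "e = \<eta> / 4"
  have e: "e > 0" using assms by (simp add: e_def)
  define C where "C = 1 + M powr e / (e * ln 2)"
  have l2: "0 < e * ln 2" using e by simp
  have C: "C \<ge> 1" using l2 by (simp add: C_def)
  have "(real (nat \<lfloor>log 2 (M * Q^2)\<rfloor>) + 1)^2 \<le> C^2 * Q powr \<eta>" if Q: "Q \<ge> 1" for Q :: real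
  proof -
    have x1: "1 \<le> M * Q^2" using mult_mono[of 1 M 1 "Q^2"] assms Q by simp
    have "real (nat \<lfloor>log 2 (M * Q^2)\<rfloor>) \<le> log 2 (M * Q^2)"
      using x1 by (intro of_nat_floor) (simp add: zero_le_log_cancel_iff)
    also have "\<dots> = ln (M * Q^2) / ln 2" by (simp add: log_def)
    also have "\<dots> \<le> ((M * Q^2) powr e / e) / ln 2"
      using ln_powr_bound[OF x1 e] by (intro divide_right_mono) auto
    also have "(M * Q^2) powr e = M powr e * Q powr (2 * e)"
      using assms Q by (simp add: powr_mult powr_powr flip: powr_numeral)
    finally have "real (nat \<lfloor>log 2 (M * Q^2)\<rfloor>) \<le> M powr e / (e * ln 2) * Q powr (2 * e)" by simp
    moreover have "1 \<le> Q powr (2 * e)" using Q e by (simp add: ge_one_powr_ge_zero)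
    ultimately have "real (nat \<lfloor>log 2 (M * Q^2)\<rfloor>) + 1 \<le> C * Q powr (2 * e)" by (simp add: C_def algebra_simps)
    then have "(real (nat \<lfloor>log 2 (M * Q^2)\<rfloor>) + 1)^2 \<le> (C * Q powr (2 * e))^2" by (intro power_mono) auto
    also have "\<dots> = C^2 * Q powr \<eta>" using Q by (simp add: power_mult_distrib powr_power e_def)
    finally show ?thesis .
  qed
  then show thesis using that[of "C^2"] by simp
qed

text \<open>Lines that are steep compared with the slope of the curve are counted directly. The others give
  points near the dual curve whose height is smaller than \<open>Q\<close> by a power of \<open>Q\<close>, because each of them
  carries more than \<open>Q powr (\<epsilon> / 2)\<close> points; this is the gain in the exponent.\<close>

lemma count_bound_step:
  assumes cb: "count_bound \<epsilon>" and \<epsilon>: "0 < \<epsilon>" "\<epsilon> \<le> 1"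
  shows "count_bound (\<epsilon> - \<epsilon>^2 / 6)"
  unfolding count_bound_def
proof (intro allI impI)
  fix c C :: real and f g :: "real \<Rightarrow> real" and a b :: real
  assume bt: "bent c C f g" and ab: "a \<le> b"
  have c: "0 < c" "c \<le> C" "0 < C" using bentD[OF bt] by auto
  define \<epsilon>' where "\<epsilon>' = \<epsilon> - \<epsilon>^2 / 6"
  have e2: "\<epsilon>^2 \<le> \<epsilon>" using \<epsilon> by (simp add: power2_eq_square mult_left_le)
  \<comment> \<open>Arcs with about Q^t points must fit under Q^\<epsilon>', while richer lines save
    the exponent 2 t \<epsilon> / 3. The choice \<epsilon> / 2 satisfies the first demand and makes
    the saving \<epsilon>^2 / 3.\<close>
  define t where "t = \<epsilon> / 2"
  have t: "0 \<le> t" "t \<le> \<epsilon>'" "0 \<le> \<epsilon>'" using \<epsilon> e2 by (auto simp: t_def \<epsilon>'_def)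
  obtain G where G: "G > 0" "\<And>x y. x \<in> {a..b} \<Longrightarrow> y \<in> {a..b} \<Longrightarrow> \<bar>f x - f y\<bar> \<le> G * \<bar>x - y\<bar>"
    by (rule bent_lipschitz[OF bt ab]) (rule that; blast)
  obtain h where h: "\<And>t. g (h t) = t" "bent (c / (4 * C^2)) (C / (4 * c^2)) (\<lambda>t. t * h t - f (h t)) h"
    by (rule bent_legendre[OF bt]) (rule that; (assumption | blast))
  define B where "B = 2 * G + 2"
  have B: "- B \<le> B" using G by (simp add: B_def)
  obtain K' where K': "K' \<ge> 0" "\<And>Q \<delta>. Q \<ge> 1 \<Longrightarrow> \<delta> > 0 \<Longrightarrow>
      real (card (near_pts (\<lambda>t. t * h t - f (h t)) (- B) B Q \<delta>)) \<le> K' * Q powr \<epsilon> * (Q + \<delta> * Q^2)"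
    by (rule count_boundE[OF cb h(2) B]) (rule that; blast)
  define M where "M = b - a + 1"
  have M: "M \<ge> 1" using ab by (simp add: M_def)
  define \<eta> where "\<eta> = \<epsilon>^2 / 6"
  have "\<eta> > 0" using \<epsilon> by (simp add: \<eta>_def)
  obtain Cl where Cl: "Cl \<ge> 0" "\<And>Q::real. Q \<ge> 1 \<Longrightarrow> (real (nat \<lfloor>log 2 (M * Q^2)\<rfloor>) + 1)^2 \<le> Cl * Q powr \<eta>"
    by (rule log_count_bound[OF M \<open>\<eta> > 0\<close>]) (rule that; blast)
  define c0 where "c0 = 1 / (8 * (1 + C))"
  have c0: "0 < c0" "c0 \<le> 1" using c by (auto simp: c0_def)
  define Z where "Z = \<bar>a\<bar> + \<bar>b\<bar> + \<bar>f a\<bar> + G * (b - a) + 1"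
  have Z: "Z \<ge> 0" using G ab by (auto simp: Z_def intro!: add_nonneg_nonneg mult_nonneg_nonneg)
  define C1 where "C1 = K' * (2 * (32 / c) powr (1/3)) powr \<epsilon> * (4 * sqrt (32 / c) + 1024 / c)"
  have C1: "C1 \<ge> 0" unfolding C1_def using K'(1) c by (auto intro!: mult_nonneg_nonneg add_nonneg_nonneg)
  define W where "W = 4 * M + ((b - a) / c0 + 1) * 4 + 288 * (2 * Z + 1) + Cl * C1"
  have parts: "0 \<le> 4 * M" "0 \<le> ((b - a) / c0 + 1) * 4" "0 \<le> 288 * (2 * Z + 1)" "0 \<le> Cl * C1"
    using M c0 ab Z Cl C1 by auto
  have "real (card (near_pts f a b Q \<delta>)) \<le> W * Q powr \<epsilon>' * (Q + \<delta> * Q^2)" if Q: "Q \<ge> 1" and d: "\<delta> > 0" for Q \<delta>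
  proof -
    define U where "U = Q + \<delta> * Q^2"
    have U: "0 < U" "Q \<le> U" "\<delta> * Q^2 \<le> U" using Q d by (auto simp: U_def intro!: add_pos_pos)
    have Qe: "1 \<le> Q powr \<epsilon>'" using Q t by (simp add: ge_one_powr_ge_zero)
    let ?S = "near_pts f a b Q \<delta>"
    show ?thesis
    proof (cases "\<delta> \<ge> 1")
      case True
      have "2 * M * (1 + \<delta>) * Q^2 \<le> 2 * M * (2 * \<delta>) * Q^2"
        using True M by (intro mult_right_mono mult_left_mono) auto
      also have "\<dots> = 4 * M * (\<delta> * Q^2)" by simp
      also have "\<dots> \<le> W * (Q powr \<epsilon>' * U)"
      proof (rule mult_mono)
        show "\<delta> * Q^2 \<le> Q powr \<epsilon>' * U" using U Qe mult_mono[of 1 "Q powr \<epsilon>'" "\<delta> * Q^2" U] d by simp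
      qed (use parts d in \<open>auto simp: W_def\<close>)
      finally show ?thesis
        using near_pts_trivial_bound(2)[OF ab Q d, of f] by (simp add: M_def U_def mult.assoc)
    next
      case False
      then have d1: "\<delta> \<le> 1" by simp
      have finS: "finite ?S" by (rule near_pts_trivial_bound(1)[OF ab Q d])
      define \<Delta> where "\<Delta> = 1 / (8 * (1 + C)) / (Q + \<delta> * Q^2)"
      have \<Delta>c: "\<Delta> = c0 / U" by (simp add: \<Delta>_def c0_def U_def)
      have \<Delta>0: "0 < \<Delta>" using c0 U by (simp add: \<Delta>c)
      \<comment> \<open>The 3 guarantees three points on each line that is kept, even if Q^t is
        close to 1.\<close>
      define T where "T = 3 + Q powr t"
      have Qt: "1 \<le> Q powr t" "Q powr t \<le> Q powr \<epsilon>'" using Q t by (auto simp: ge_one_powr_ge_zero intro!: powr_mono)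
      define ix where "ix P = nat \<lfloor>(ptx P - a) / \<Delta>\<rfloor>" for P
      define n where "n = nat \<lfloor>(b - a) / \<Delta>\<rfloor>"
      define Si where "Si i = {P \<in> ?S. ix P = i}" for i
      have Si_fin: "finite (Si i)" for i using finS by (simp add: Si_def)
      have Scov: "?S = (\<Union>i\<in>{..n}. Si i)"
      proof -
        have "ix P \<le> n" if "P \<in> ?S" for P
          unfolding ix_def n_def using near_ptsD(5)[OF that] \<Delta>0
          by (intro nat_mono floor_mono divide_right_mono) auto
        then show ?thesis by (auto simp: Si_def)
      qed
      have close: "\<bar>ptx P' - ptx P\<bar> \<le> \<Delta>" if PP: "P \<in> Si i" "P' \<in> Si i" for i P P'
      proof -
        have "P \<in> ?S" "P' \<in> ?S" and ii: "ix P = ix P'" using PP by (auto simp: Si_def)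
        then have "0 \<le> (ptx P - a) / \<Delta>" "0 \<le> (ptx P' - a) / \<Delta>" using near_ptsD(4) \<Delta>0 by auto
        then have "\<bar>(ptx P' - a) / \<Delta> - (ptx P - a) / \<Delta>\<bar> \<le> 1" using ii unfolding ix_def by linarith
        then have "\<bar>(ptx P' - ptx P) / \<Delta>\<bar> \<le> 1" by (simp add: diff_divide_distrib)
        then show ?thesis using \<Delta>0 by (simp add: abs_divide)
      qed
      define Bad where "Bad = {i \<in> {..n}. T < real (card (Si i))}"
      have line: "\<exists>l. 0 \<le> fst l \<and> prim3 l \<and> (\<forall>P\<in>Si i. on_line l P) \<and> real_of_int (fst l) \<le> \<Delta> * Q^2" if i: "i \<in> Bad" for i
      proof -
        have "1 < real (card (Si i))" using i Qt by (simp add: Bad_def T_def)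
        then have "\<not> card (Si i) \<le> Suc 0" by simp
        then obtain P1 P2 where P: "P1 \<in> Si i" "P2 \<in> Si i" "P1 \<noteq> P2"
          using card_le_Suc0_iff_eq[OF Si_fin] by blast
        have PS: "P1 \<in> ?S" "P2 \<in> ?S" using P by (auto simp: Si_def)
        obtain l where l: "fst l \<ge> 0" "prim3 l" "\<And>P. det3 P1 P2 P = 0 \<Longrightarrow> on_line l P"
          using line_through[OF near_ptsD(3)[OF PS(1)] near_ptsD(3)[OF PS(2)] near_ptsD(1)[OF PS(1)] near_ptsD(1)[OF PS(2)] P(3)]
          by blast
        have on: "on_line l P" if "P \<in> Si i" for P
        proof (rule l(3))
          have "P \<in> ?S" using that by (simp add: Si_def)
          show "det3 P1 P2 P = 0"
            by (rule near_pts_collinear[OF bt Q d PS \<open>P \<in> ?S\<close> close[OF P(1,2)] close[OF P(1) that] \<Delta>_def])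
        qed
        have "real_of_int (fst l) \<le> \<Delta> * Q^2"
        proof (cases "fst l = 0")
          case False
          obtain \<alpha> \<beta> \<gamma> where le: "l = (\<alpha>, \<beta>, \<gamma>)" by (cases l)
          have "\<bar>real_of_int \<alpha>\<bar> / Q^2 \<le> \<bar>ptx P1 - ptx P2\<bar>"
            using line_spacing(2)[OF PS P(3), of \<alpha> \<beta> \<gamma>] l(2) on[OF P(1)] on[OF P(2)] False by (simp add: le)
          also have "\<dots> \<le> \<Delta>" by (rule close[OF P(2,1)])
          finally have "\<bar>real_of_int \<alpha>\<bar> \<le> \<Delta> * Q^2" using Q by (simp add: divide_le_eq)
          then show ?thesis by (simp add: le)
        qed (use \<Delta>0 in simp)
        then show ?thesis using l on by blast
      qed
      then obtain L where L: "\<And>i. i \<in> Bad \<Longrightarrow> 0 \<le> fst (L i) \<and> prim3 (L i) \<and> (\<forall>P\<in>Si i. on_line (L i) P) \<and> real_of_int (fst (L i)) \<le> \<Delta> * Q^2"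
        by metis
      \<comment> \<open>As a set of lines, \<open>A\<close> counts a line once however many arcs it
        serves. Accordingly \<open>E\<close> collects all its points near the curve, since the
        spacing estimates see the whole line.\<close>
      define A where "A = L ` Bad"
      have finBad: "finite Bad" by (simp add: Bad_def)
      have finA: "finite A" using finBad by (simp add: A_def)
      define E where "E l = {P \<in> ?S. on_line l P}" for l
      have E_fin: "finite (E l)" for l using finS by (simp add: E_def)
      have Aprop: "0 \<le> fst l \<and> prim3 l \<and> real_of_int (fst l) \<le> \<Delta> * Q^2 \<and> T < real (card (E l))" if "l \<in> A" for l
      proof -
        obtain i where i: "i \<in> Bad" "l = L i" using \<open>l \<in> A\<close> by (auto simp: A_def)
        have "Si i \<subseteq> E l" using L[OF i(1)] i(2) by (auto simp: E_def Si_def)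
        then have "card (Si i) \<le> card (E l)" using E_fin by (intro card_mono)
        then show ?thesis using L[OF i(1)] i by (auto simp: Bad_def)
      qed
      \<comment> \<open>Two points of one arc are at most \<Delta> apart, so \<alpha> \<le> \<Delta>
        Q^2. With \<Delta> about 1 / (Q + \<delta> Q^2) this yields \<alpha> \<delta> \<le>
        1.\<close>
      have \<Delta>Q: "\<Delta> * Q^2 \<le> 1 / \<delta>" "\<Delta> * Q^2 \<le> M * Q^2"
      proof -
        have "\<Delta> * (\<delta> * Q^2) \<le> \<Delta> * U" using U \<Delta>0 by (intro mult_left_mono) auto
        also have "\<dots> \<le> 1" using c0 U by (simp add: \<Delta>c)
        finally show "\<Delta> * Q^2 \<le> 1 / \<delta>" using d by (simp add: field_simps)
        have "\<Delta> \<le> 1" using c0 U Q unfolding \<Delta>c by (simp add: divide_le_eq)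
        then show "\<Delta> * Q^2 \<le> M * Q^2" using M by (intro mult_right_mono) auto
      qed
      have split: "real (card ?S) \<le> (\<Sum>i\<in>{..n} - Bad. real (card (Si i))) + (\<Sum>l\<in>A. real (card (E l)))"
      proof -
        have "?S \<subseteq> (\<Union>i\<in>{..n} - Bad. Si i) \<union> (\<Union>l\<in>A. E l)"
        proof
          fix P assume P: "P \<in> ?S"
          then obtain i where i: "i \<in> {..n}" "P \<in> Si i" using Scov by blast
          show "P \<in> (\<Union>i\<in>{..n} - Bad. Si i) \<union> (\<Union>l\<in>A. E l)"
          proof (cases "i \<in> Bad")
            case True
            then have "P \<in> E (L i)" using L i P by (auto simp: E_def)
            then show ?thesis using True by (auto simp: A_def)
          qed (use i in auto)
        qed
        then have "card ?S \<le> card ((\<Union>i\<in>{..n} - Bad. Si i) \<union> (\<Union>l\<in>A. E l))"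
          using Si_fin E_fin finA by (intro card_mono) auto
        also have "\<dots> \<le> card (\<Union>i\<in>{..n} - Bad. Si i) + card (\<Union>l\<in>A. E l)" by (rule card_Un_le)
        also have "\<dots> \<le> (\<Sum>i\<in>{..n} - Bad. card (Si i)) + (\<Sum>l\<in>A. card (E l))"
          using finA by (intro add_mono card_UN_le) auto
        finally show ?thesis by (simp flip: of_nat_sum of_nat_add)
      qed
      have good: "(\<Sum>i\<in>{..n} - Bad. real (card (Si i))) \<le> ((b - a) / c0 + 1) * 4 * (Q powr \<epsilon>' * U)"
      proof -
        have "(\<Sum>i\<in>{..n} - Bad. real (card (Si i))) \<le> (\<Sum>i\<in>{..n} - Bad. T)"
          by (intro sum_mono) (auto simp: Bad_def)
        also have "\<dots> = real (card ({..n} - Bad)) * T" by simp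
        also have "\<dots> \<le> (((b - a) / c0 + 1) * U) * (4 * Q powr \<epsilon>')"
        proof (rule mult_mono)
          have "card ({..n} - Bad) \<le> card {..n}" by (intro card_mono) auto
          then have "real (card ({..n} - Bad)) \<le> real n + 1" by simp
          also have "real n \<le> (b - a) / \<Delta>" unfolding n_def using ab \<Delta>0 by (intro of_nat_floor) auto
          also have "(b - a) / \<Delta> = (b - a) / c0 * U" by (simp add: \<Delta>c)
          also have "1 \<le> U" using U Q by linarith
          finally show "real (card ({..n} - Bad)) \<le> ((b - a) / c0 + 1) * U" by (simp add: algebra_simps)
          show "T \<le> 4 * Q powr \<epsilon>'" using Qt Qe by (simp add: T_def)
          show "0 \<le> ((b - a) / c0 + 1) * U" using ab c0 U by auto
          show "0 \<le> T" by (simp add: T_def)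
        qed
        finally show ?thesis by (simp add: mult_ac)
      qed
      \<comment> \<open>Vertical lines fall on the steep side. On the other side \<alpha> > 0, so
        the dual point is defined, and its first coordinate -\<beta> / \<alpha> stays within
        [-B, B].\<close>
      define A1 where "A1 = {l \<in> A. B * real_of_int (fst l) \<le> \<bar>real_of_int (fst (snd l))\<bar>}"
      have finA1: "finite A1" using finA by (simp add: A1_def)
      have steep: "(\<Sum>l\<in>A1. real (card (E l))) \<le> 288 * (2 * Z + 1) * (Q powr \<epsilon>' * U)"
      proof -
        have "(\<Sum>l\<in>A1. real (card (E l))) \<le> 288 * (2 * Z + 1) * \<delta> * Q^2"
        proof (rule steep_sum[OF Q d d1 Z finA1])
          fix \<alpha> \<beta> \<gamma> assume l: "(\<alpha>, \<beta>, \<gamma>) \<in> A1"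
          then have Al: "(\<alpha>, \<beta>, \<gamma>) \<in> A" "B * real_of_int \<alpha> \<le> \<bar>real_of_int \<beta>\<bar>" by (auto simp: A1_def)
          note Ap = Aprop[OF Al(1)]
          have pr: "prim3 (\<alpha>, \<beta>, \<gamma>)" "0 \<le> \<alpha>" using Ap by auto
          have c2: "2 \<le> card (E (\<alpha>, \<beta>, \<gamma>))" using Ap Qt by (simp add: T_def)
          have Es: "E (\<alpha>, \<beta>, \<gamma>) \<subseteq> ?S" "\<And>P. P \<in> E (\<alpha>, \<beta>, \<gamma>) \<Longrightarrow> on_line (\<alpha>, \<beta>, \<gamma>) P" by (auto simp: E_def)
          note st = steep_line_card[OF G Q d d1 ab pr Al(2)[unfolded B_def] Es c2]
          show "0 \<le> \<alpha> \<and> real_of_int \<alpha> \<le> 1 / \<delta> \<and> 1 \<le> \<bar>\<beta>\<bar> \<and> \<bar>real_of_int \<beta>\<bar> \<le> 4 * \<delta> * Q \<and>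
             \<bar>real_of_int \<gamma>\<bar> \<le> Z * \<bar>real_of_int \<beta>\<bar> \<and> real (card (E (\<alpha>, \<beta>, \<gamma>))) \<le> 12 * \<delta> * Q / \<bar>real_of_int \<beta>\<bar>"
            using st Ap \<Delta>Q(1) unfolding Z_def by auto
        qed
        also have "\<dots> = 288 * (2 * Z + 1) * (\<delta> * Q^2)" by simp
        also have "\<dots> \<le> 288 * (2 * Z + 1) * (Q powr \<epsilon>' * U)"
        proof (rule mult_left_mono)
          show "\<delta> * Q^2 \<le> Q powr \<epsilon>' * U" using U Qe mult_mono[of 1 "Q powr \<epsilon>'" "\<delta> * Q^2" U] d by simp
        qed (use parts in simp)
        finally show ?thesis .
      qed
      define A2 where "A2 = A - A1"
      have finA2: "finite A2" using finA by (simp add: A2_def)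
      have shallow: "(\<Sum>l\<in>A2. real (card (E l))) \<le> Cl * C1 * (Q powr \<epsilon>' * U)"
      proof -
        have A2p: "0 < \<alpha> \<and> \<bar>real_of_int \<beta>\<bar> \<le> B * \<alpha> \<and> prim3 (\<alpha>, \<beta>, \<gamma>) \<and> real_of_int \<alpha> \<le> \<Delta> * Q^2 \<and> T < real (card (E (\<alpha>, \<beta>, \<gamma>)))"
          if "(\<alpha>, \<beta>, \<gamma>) \<in> A2" for \<alpha> \<beta> \<gamma> :: int
        proof -
          have lA: "(\<alpha>, \<beta>, \<gamma>) \<in> A" and s: "\<bar>real_of_int \<beta>\<bar> < B * real_of_int \<alpha>" using that by (auto simp: A2_def A1_def)
          have "\<alpha> \<noteq> 0" using s by auto
          then show ?thesis using Aprop[OF lA] s by auto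
        qed
        have c1: "1 \<le> nat (fst l)" "1 \<le> card (E l)" if "l \<in> A2" for l
          using A2p[of "fst l" "fst (snd l)" "snd (snd l)"] that Qt by (auto simp: T_def)
        have "\<exists>j. 2^j \<le> nat (fst l) \<and> nat (fst l) < 2^(j+1)" "\<exists>k. 2^k \<le> card (E l) \<and> card (E l) < 2^(k+1)"
          if "l \<in> A2" for l using ex_power_ivl1[OF order_refl c1(1)[OF that]] ex_power_ivl1[OF order_refl c1(2)[OF that]] by blast+
        then obtain jj kk where jk: "\<And>l. l \<in> A2 \<Longrightarrow> 2^jj l \<le> nat (fst l) \<and> nat (fst l) < 2^(jj l+1)"
            "\<And>l. l \<in> A2 \<Longrightarrow> 2^kk l \<le> card (E l) \<and> card (E l) < 2^(kk l+1)" by metis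
        define N where "N = nat \<lfloor>log 2 (M * Q^2)\<rfloor>"
        have MQ: "1 \<le> M * Q^2" using mult_mono[of 1 M 1 "Q^2"] M Q by simp
        have le_N: "j \<le> N" if "2^j \<le> M * Q^2" for j
        proof -
          have "real j = log 2 (2^j)" by simp
          also have "\<dots> \<le> log 2 (M * Q^2)" using that MQ by (intro log_mono) auto
          finally show ?thesis by (simp add: N_def le_nat_floor)
        qed
        \<comment> \<open>This limits the range of the dyadic exponents of the
          cardinalities.\<close>
        have cE: "real (card (E l)) \<le> M * Q^2" if "l \<in> A2" for l
        proof -
          obtain \<alpha> \<beta> \<gamma> where l: "l = (\<alpha>, \<beta>, \<gamma>)" by (cases l)
          note p = A2p[of \<alpha> \<beta> \<gamma>, folded l, OF that]
          have al: "1 \<le> real_of_int \<alpha>" using p by simp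
          have Q2: "0 < Q^2" using Q by simp
          have sep: "1 / Q^2 \<le> \<bar>ptx P1 - ptx P2\<bar>" if P: "P1 \<in> E l" "P2 \<in> E l" "P1 \<noteq> P2" for P1 P2
          proof -
            have "1 / Q^2 \<le> \<bar>real_of_int \<alpha>\<bar> / Q^2" using al Q2 by (intro divide_right_mono) auto
            also have "\<dots> \<le> \<bar>ptx P1 - ptx P2\<bar>"
              by (rule line_spacing(2)[where \<beta> = \<beta> and \<gamma> = \<gamma>]) (use P p in \<open>auto simp: E_def l\<close>)
            finally show ?thesis .
          qed
          have inj: "inj_on ptx (E l)"
          proof (rule inj_onI, rule ccontr)
            fix P1 P2 assume *: "P1 \<in> E l" "P2 \<in> E l" "ptx P1 = ptx P2" "P1 \<noteq> P2"
            have "0 < 1 / Q^2" using Q2 by simp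
            then show False using sep[OF *(1,2,4)] *(3) by simp
          qed
          have "real (card (ptx ` E l)) \<le> (b - a) / (1 / Q^2) + 1"
          proof (rule separated_set_card(2))
            show "1 / Q^2 \<le> \<bar>x - y\<bar>" if xy: "x \<in> ptx ` E l" "y \<in> ptx ` E l" "x \<noteq> y" for x y
            proof -
              obtain P1 P2 where "P1 \<in> E l" "x = ptx P1" "P2 \<in> E l" "y = ptx P2" using xy by blast
              then show ?thesis using sep[of P1 P2] xy(3) by blast
            qed
            show "ptx ` E l \<subseteq> {a..b}"
            proof
              fix x assume "x \<in> ptx ` E l"
              then obtain P where "P \<in> ?S" "x = ptx P" by (auto simp: E_def)
              then show "x \<in> {a..b}" using near_ptsD(4,5) by simp
            qed
          qed (use ab Q2 in auto)
          also have "\<dots> \<le> M * Q^2" using Q by (simp add: M_def algebra_simps)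
          finally show ?thesis using inj by (simp add: card_image)
        qed
        define T2 where "T2 = {..N} \<times> {..N}"
        have img: "(\<lambda>l. (jj l, kk l)) ` A2 \<subseteq> T2"
        proof
          fix z assume "z \<in> (\<lambda>l. (jj l, kk l)) ` A2"
          then obtain l where l: "l \<in> A2" "z = (jj l, kk l)" by blast
          have "(2::real)^jj l \<le> M * Q^2"
          proof -
            have "real (2^jj l) \<le> real (nat (fst l))" using jk(1)[OF l(1)] by (simp only: of_nat_le_iff)
            also have "\<dots> \<le> \<Delta> * Q^2" using A2p[of "fst l" "fst (snd l)" "snd (snd l)"] l(1) by simp
            finally show ?thesis using \<Delta>Q(2) by simp
          qed
          moreover have "(2::real)^kk l \<le> M * Q^2"
          proof -
            have "real (2^kk l) \<le> real (card (E l))" using jk(2)[OF l(1)] by (simp only: of_nat_le_iff)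
            moreover have "real (2^kk l) = (2::real)^kk l" by simp
            ultimately show ?thesis using cE[OF l(1)] by linarith
          qed
          ultimately show "z \<in> T2" using le_N l(2) by (simp add: T2_def)
        qed
        have "(\<Sum>l\<in>A2. real (card (E l))) = (\<Sum>z\<in>T2. \<Sum>l\<in>{l \<in> A2. (jj l, kk l) = z}. real (card (E l)))"
          using sum.group[OF finA2 _ img, of "\<lambda>l. real (card (E l))"] by (simp add: T2_def)
        also have "\<dots> \<le> (\<Sum>z\<in>T2. C1 * Q powr (\<epsilon> - 2 * t * \<epsilon> / 3) * U)"
        proof (rule sum_mono)
          fix z assume "z \<in> T2"
          obtain j k where z: "z = (j, k)" by (cases z)
          show "(\<Sum>l\<in>{l \<in> A2. (jj l, kk l) = z}. real (card (E l))) \<le> C1 * Q powr (\<epsilon> - 2 * t * \<epsilon> / 3) * U"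
            unfolding C1_def U_def
          proof (rule dyadic_block[OF bt h(1) Q d t(1) \<epsilon>(1) K' B, where j = j and k = k and a = a and b = b])
            show "finite {l \<in> A2. (jj l, kk l) = z}" using finA2 by simp
            show "E l \<subseteq> ?S" for l by (auto simp: E_def)
            show "on_line l P" if "P \<in> E l" for l P using that by (simp add: E_def)
            fix l assume l: "l \<in> {l \<in> A2. (jj l, kk l) = z}"
            then have lA: "l \<in> A2" "jj l = j" "kk l = k" by (auto simp: z)
            have "T < real (card (E l))" using A2p[of "fst l" "fst (snd l)" "snd (snd l)"] lA(1) by simp
            then show "3 \<le> card (E l) \<and> Q powr t \<le> card (E l) \<and> 2^k \<le> card (E l) \<and> card (E l) < 2^(k+1)"
              using jk(2)[OF lA(1)] lA(3) Qt unfolding T_def by simp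
          next
            fix \<alpha> \<beta> \<gamma> assume l: "(\<alpha>, \<beta>, \<gamma>) \<in> {l \<in> A2. (jj l, kk l) = z}"
            then have lA: "(\<alpha>, \<beta>, \<gamma>) \<in> A2" "jj (\<alpha>, \<beta>, \<gamma>) = j" by (auto simp: z)
            note p = A2p[OF lA(1)]
            have "2^j \<le> nat \<alpha> \<and> nat \<alpha> < 2^(j+1)" using jk(1)[OF lA(1)] lA(2) by simp
            then have "real (2^j) \<le> real (nat \<alpha>) \<and> real (nat \<alpha>) < real (2^(j+1))" by (simp only: of_nat_le_iff of_nat_less_iff)
            moreover have "real (nat \<alpha>) = real_of_int \<alpha>" using p by simp
            moreover have "\<alpha> * \<delta> \<le> 1"
            proof -
              have "real_of_int \<alpha> \<le> 1 / \<delta>" using p \<Delta>Q(1) by linarith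
              then show ?thesis using d by (simp add: field_simps)
            qed
            ultimately show "prim3 (\<alpha>, \<beta>, \<gamma>) \<and> 0 < \<alpha> \<and> \<bar>real_of_int \<beta>\<bar> \<le> B * \<alpha> \<and> \<alpha> * \<delta> \<le> 1 \<and>
               2^j \<le> real_of_int \<alpha> \<and> real_of_int \<alpha> < 2^(j+1)" using p by simp
          qed
        qed
        also have "\<dots> = (real N + 1)^2 * (C1 * Q powr (\<epsilon> - 2 * t * \<epsilon> / 3) * U)"
          by (simp add: T2_def card_cartesian_product power2_eq_square algebra_simps)
        also have "\<dots> \<le> (Cl * Q powr \<eta>) * (C1 * Q powr (\<epsilon> - 2 * t * \<epsilon> / 3) * U)"
          using Cl(2)[OF Q] C1 U unfolding N_def by (intro mult_right_mono) auto
        also have "\<dots> = Cl * C1 * ((Q powr \<eta> * Q powr (\<epsilon> - 2 * t * \<epsilon> / 3)) * U)" by simp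
        also have "Q powr \<eta> * Q powr (\<epsilon> - 2 * t * \<epsilon> / 3) = Q powr \<epsilon>'"
          by (simp add: \<eta>_def t_def \<epsilon>'_def power2_eq_square flip: powr_add)
        finally show ?thesis .
      qed
      have "(\<Sum>l\<in>A. real (card (E l))) = (\<Sum>l\<in>A1. real (card (E l))) + (\<Sum>l\<in>A2. real (card (E l)))"
        unfolding A2_def using finA by (subst sum.subset_diff[of A1 A]) (auto simp: A1_def)
      then have "real (card ?S) \<le> (((b - a) / c0 + 1) * 4 + 288 * (2 * Z + 1) + Cl * C1) * (Q powr \<epsilon>' * U)"
        using split good steep shallow by (simp add: algebra_simps)
      also have "\<dots> \<le> W * (Q powr \<epsilon>' * U)"
        using parts U by (intro mult_right_mono) (auto simp: W_def)
      finally show ?thesis by (simp add: U_def mult.assoc)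
    qed
  qed
  then show "\<exists>K. \<forall>Q\<ge>1. \<forall>\<delta>>0. real (card (near_pts f a b Q \<delta>)) \<le> K * Q powr (\<epsilon> - \<epsilon>^2 / 6) * (Q + \<delta> * Q^2)"
    unfolding \<epsilon>'_def by blast
qed

text \<open>A step lowers e by e^2 / 6, so the exponents decay like 6 / n: from e = 6 / (n + 6) it
  leads to 6 (n + 5) / (n + 6)^2, and (n + 5) (n + 7) < (n + 6)^2. At n = 0 this is the trivial
  exponent 1.\<close>

lemma count_bound_all:
  assumes "0 < \<epsilon>"
  shows "count_bound \<epsilon>"
proof -
  have *: "count_bound (6 / (real n + 6))" for n
  proof (induction n)
    case (Suc n)
    define e where "e = 6 / (real n + 6)"
    have e: "0 < e" "e \<le> 1" by (auto simp: e_def)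
    have "e - e^2 / 6 \<le> 6 / (real (Suc n) + 6)"
    proof -
      have "e - e^2/6 = 6 * (real n + 5) / (real n + 6)^2"
        by (simp add: e_def power2_eq_square divide_simps)
      also have "\<dots> \<le> 6 / (real n + 7)"
        by (simp add: divide_simps power2_eq_square algebra_simps not_less add_nonneg_nonneg)
      finally show ?thesis by (simp add: add.commute)
    qed
    then show ?case using count_bound_mono[OF count_bound_step[OF _ e]] Suc by (simp add: e_def)
  qed (simp add: count_bound_1)
  obtain n :: nat where "real n > 6 / \<epsilon>" using reals_Archimedean2 by blast
  then have "6 / (real n + 6) \<le> \<epsilon>" using assms by (simp add: field_simps) 
  then show ?thesis using count_bound_mono[OF *] by blast
qed

section \<open>The upper bound\<close>

text \<open>The convergence half of the Borel-Cantelli argument: every tail of the families covers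
  \<open>E\<close>, and the tails of a convergent series are small.\<close>

lemma hnull_limsup:
  fixes S :: "nat \<Rightarrow> 'i \<Rightarrow> 'a::metric_space set"
  assumes s: "0 < s" and I: "\<And>t. finite (I t)" and bS: "\<And>t i. i \<in> I t \<Longrightarrow> bounded (S t i)"
    and w: "\<And>t. (\<Sum>i\<in>I t. diameter (S t i) powr s) \<le> w t" "summable w"
    and E: "\<And>x T. x \<in> E \<Longrightarrow> \<exists>t\<ge>T. \<exists>i\<in>I t. x \<in> S t i"
  shows "hnull s E"
  unfolding hnull_def
proof (intro allI impI)
  fix e :: real assume "e > 0"
  have w0: "0 \<le> w t" for t using w(1)[of t] by (rule order_trans[rotated]) (auto intro: sum_nonneg)
  obtain T where T: "norm (\<Sum>i. w (i + T)) < e" using suminf_exist_split[OF \<open>e > 0\<close> w(2)] by blast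
  have smT: "summable (\<lambda>i. w (i + T))" using w(2) by (simp add: summable_iff_shift)
  have "\<exists>b. bij_betw b {0..<card (I t)} (I t)" for t using ex_bij_betw_nat_finite[OF I] by blast
  then obtain b where b: "\<And>t. bij_betw (b t) {0..<card (I t)} (I t)" by metis
  define U where "U n k = (if k < card (I (n + T)) then S (n + T) (b (n + T) k) else {})" for n k
  have "bounded (U n k)" for n k
    using bij_betwE[OF b[of "n + T"]] bS by (auto simp: U_def)
  moreover have "(\<Sum>n. \<Sum>k. ennreal (diameter (U n k) powr s)) \<le> ennreal e"
  proof -
    have inner: "(\<Sum>k. ennreal (diameter (U n k) powr s)) \<le> ennreal (w (n + T))" for n
    proof -
      have "(\<Sum>k. ennreal (diameter (U n k) powr s)) = (\<Sum>k\<in>{0..<card (I (n + T))}. ennreal (diameter (U n k) powr s))"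
        using s by (intro suminf_finite) (auto simp: U_def)
      also have "\<dots> = (\<Sum>k\<in>{0..<card (I (n + T))}. ennreal (diameter (S (n + T) (b (n + T) k)) powr s))"
        by (intro sum.cong refl) (simp add: U_def)
      also have "\<dots> = (\<Sum>i\<in>I (n + T). ennreal (diameter (S (n + T) i) powr s))"
        by (rule sum.reindex_bij_betw[OF b])
      also have "\<dots> = ennreal (\<Sum>i\<in>I (n + T). diameter (S (n + T) i) powr s)"
        by (intro sum_ennreal) auto
      also have "\<dots> \<le> ennreal (w (n + T))" by (intro ennreal_leI w)
      finally show ?thesis .
    qed
    have "(\<Sum>n. \<Sum>k. ennreal (diameter (U n k) powr s)) \<le> (\<Sum>n. ennreal (w (n + T)))"
      by (intro suminf_le summableI inner)
    also have "\<dots> = ennreal (\<Sum>n. w (n + T))" by (intro suminf_ennreal2 w0 smT)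
    also have "\<dots> \<le> ennreal e" using T by (intro ennreal_leI) simp
    finally show ?thesis .
  qed
  ultimately obtain V :: "nat \<Rightarrow> 'a set" where V: "(\<Union>n. \<Union>i. U n i) \<subseteq> (\<Union>k. V k)" "\<forall>k. bounded (V k)"
     "(\<Sum>k. ennreal (diameter (V k) powr s)) \<le> ennreal e"
    using cover_from_double[of U s "ennreal e"] by blast
  have "E \<subseteq> (\<Union>n. \<Union>i. U n i)"
  proof
    fix x assume "x \<in> E"
    then obtain t i where ti: "t \<ge> T" "i \<in> I t" "x \<in> S t i" using E by blast
    obtain k where k: "k < card (I t)" "b t k = i"
      using ti(2) bij_betw_imp_surj_on[OF b[of t]] by (metis atLeastLessThan_iff imageE)
    then have "x \<in> U (t - T) k" using ti by (simp add: U_def)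
    then show "x \<in> (\<Union>n. \<Union>i. U n i)" by blast
  qed
  then show "\<exists>U. E \<subseteq> (\<Union>i. U i) \<and> (\<forall>i. bounded (U i)) \<and>
        (\<Sum>i. ennreal (diameter (U i) powr s)) \<le> ennreal e"
    using V by (intro exI[of _ V]) blast
qed

lemma dist_int_half: "dist_int x \<le> 1 / 2"
proof -
  have "\<bar>x - real_of_int (round x)\<bar> \<le> 1 / 2" using of_int_round_abs_le[of x] by (simp add: abs_minus_commute)
  then show ?thesis using dist_int_le[of x "round x"] by linarith
qed

lemma dist_int_nonneg: "0 \<le> dist_int x"
  by (simp add: dist_int_def infdist_nonneg)

lemma dist_int_pos_irrational:
  assumes "x \<notin> \<rat>" "0 < (k::nat)"
  shows "0 < dist_int (real k * x)"
proof -
  obtain m :: int where m: "dist_int (real k * x) = \<bar>real k * x - of_int m\<bar>" using dist_int_attained by blast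
  have "real k * x \<noteq> of_int m"
  proof
    assume "real k * x = of_int m"
    then have "x = of_int m / of_nat k" using assms(2) by (simp add: field_simps)
    then show False using assms(1) by simp
  qed
  then show ?thesis using m by simp
qed

text \<open>Dividing out common factors only improves an approximation, and since \<open>x\<close> and \<open>y\<close> are irrational
  a bounded set of denominators cannot account for infinitely many of them.\<close>

lemma primitive_approximations:
  fixes x y :: real
  assumes v: "v > 0" and inf: "(x, y) \<in> mult_approx v" and irr: "x \<notin> \<rat>" "y \<notin> \<rat>"
  shows "\<exists>q p r. int N \<le> q \<and> 0 < q \<and> gcd q (gcd p r) = 1 \<and>
     \<bar>x - real_of_int p / q\<bar> \<le> 1 / (2 * q) \<and> \<bar>y - real_of_int r / q\<bar> \<le> 1 / (2 * q) \<and>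
     \<bar>x - real_of_int p / q\<bar> * \<bar>y - real_of_int r / q\<bar> < real_of_int q powr (- v - 2)"
proof -
  \<comment> \<open>Positive by irrationality. The range up to \<open>Suc N\<close> keeps the set
    nonempty for N = 0.\<close>
  define \<mu> where "\<mu> = Min ((\<lambda>k. dist_int (real k * x) * dist_int (real k * y)) ` {1..Suc N})"
  have \<mu>: "0 < \<mu>" unfolding \<mu>_def using irr by (subst Min_gr_iff) (auto intro!: mult_pos_pos dist_int_pos_irrational)
  have \<mu>le: "\<mu> \<le> dist_int (real k * x) * dist_int (real k * y)" if "1 \<le> k" "k \<le> Suc N" for k
    unfolding \<mu>_def using that by (intro Min_le) auto
  \<comment> \<open>For n beyond \<open>M\<close> the bound n^(-v) is below \<mu>. A reduced
    denominator below \<open>N\<close> would approximate at least as well as n does, against the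
    definition of \<mu>.\<close>
  obtain M :: nat where M: "real M > (1 / \<mu>) powr (1 / v)" using reals_Archimedean2 by blast
  have "infinite {q::nat. q > 0 \<and> dist_int (real q * x) * dist_int (real q * y) < real q powr (- v)}"
    using inf by (simp add: mult_approx_def)
  then obtain n where n: "n \<ge> M" "n > 0" "dist_int (real n * x) * dist_int (real n * y) < real n powr (- v)"
    unfolding infinite_nat_iff_unbounded_le by blast
  have "1 / \<mu> < real n powr v"
  proof -
    have "(1 / \<mu>) powr (1 / v) < real n" using M n(1) by linarith
    then have "((1 / \<mu>) powr (1 / v)) powr v < real n powr v" using v by (intro powr_less_mono2) auto
    then show ?thesis using v \<mu> by (simp add: powr_powr)
  qed
  then have nv: "real n powr (- v) < \<mu>" using \<mu> n(2) by (simp add: powr_minus field_simps)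
  obtain m1 :: int where m1: "dist_int (real n * x) = \<bar>real n * x - of_int m1\<bar>" using dist_int_attained by blast
  obtain m2 :: int where m2: "dist_int (real n * y) = \<bar>real n * y - of_int m2\<bar>" using dist_int_attained by blast
  define d where "d = gcd (int n) (gcd m1 m2)"
  have d0: "d > 0" using n(2) by (simp add: d_def)
  obtain q p r where qpr: "int n = d * q" "m1 = d * p" "m2 = d * r"
    unfolding d_def by (metis dvdE gcd_dvd1 gcd_dvd2 dvd_trans)
  have "d * gcd q (gcd p r) = d"
    using d0 d_def unfolding qpr by (metis abs_of_pos gcd_mult_distrib_int)
  then have g: "gcd q (gcd p r) = 1" using d0 by simp
  have "0 < d * q" using n(2) qpr(1) by linarith
  then have q0: "q > 0" using d0 by (simp add: zero_less_mult_iff)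
  have nr: "real n = real_of_int d * real_of_int q" using qpr(1) by (metis of_int_mult of_int_of_nat_eq)
  have d1: "1 \<le> real_of_int d" and q1: "1 \<le> real_of_int q" using d0 q0 by auto
  have e1: "\<bar>x - real_of_int p / q\<bar> = dist_int (real n * x) / n"
    unfolding m1 unfolding nr qpr(2) using d0 q0 by (simp add: abs_if field_simps)
  have e2: "\<bar>y - real_of_int r / q\<bar> = dist_int (real n * y) / n"
    unfolding m2 unfolding nr qpr(3) using d0 q0 by (simp add: abs_if field_simps)
  have nq: "real_of_int q \<le> real n" unfolding nr using d1 q1 by simp
  have half: "dist_int z / n \<le> 1 / (2 * q)" for z
  proof -
    have "dist_int z / n \<le> (1/2) / q" using dist_int_half[of z] nq q1 by (intro frac_le) auto
    then show ?thesis by simp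
  qed
  have "\<bar>x - real_of_int p / q\<bar> * \<bar>y - real_of_int r / q\<bar> = dist_int (real n * x) * dist_int (real n * y) / (real n)^2"
    unfolding e1 e2 by (simp add: power2_eq_square)
  also have "\<dots> < real n powr (- v) / (real n)^2" using n by (intro divide_strict_right_mono) auto
  also have "\<dots> = real n powr (- v - 2)" using n by (simp add: powr_diff powr_numeral)
  also have "\<dots> \<le> real_of_int q powr (- v - 2)" using nq q1 v by (intro powr_mono2') auto
  finally have pr: "\<bar>x - real_of_int p / q\<bar> * \<bar>y - real_of_int r / q\<bar> < real_of_int q powr (- v - 2)" .
  have "int N \<le> q"
  proof (rule ccontr)
    assume "\<not> int N \<le> q"
    then have "1 \<le> nat q" "nat q \<le> Suc N" using q0 by auto
    from \<mu>le[OF this] have m: "\<mu> \<le> dist_int (real_of_int q * x) * dist_int (real_of_int q * y)" using q0 by simp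
    have a1: "dist_int (real_of_int q * x) \<le> dist_int (real n * x)"
    proof -
      have "dist_int (real_of_int q * x) \<le> \<bar>real_of_int q * x - real_of_int p\<bar>" by (rule dist_int_le)
      also have "\<dots> \<le> d * \<bar>real_of_int q * x - real_of_int p\<bar>" using d1 by (simp add: mult_le_cancel_right1)
      also have "\<dots> = \<bar>d * (real_of_int q * x - real_of_int p)\<bar>" using d1 by (simp add: abs_mult)
      also have "\<dots> = dist_int (real n * x)" unfolding m1 unfolding nr qpr(2) by (simp add: algebra_simps)
      finally show ?thesis .
    qed
    have a2: "dist_int (real_of_int q * y) \<le> dist_int (real n * y)"
    proof -
      have "dist_int (real_of_int q * y) \<le> \<bar>real_of_int q * y - real_of_int r\<bar>" by (rule dist_int_le)
      also have "\<dots> \<le> d * \<bar>real_of_int q * y - real_of_int r\<bar>" using d1 by (simp add: mult_le_cancel_right1)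
      also have "\<dots> = \<bar>d * (real_of_int q * y - real_of_int r)\<bar>" using d1 by (simp add: abs_mult)
      also have "\<dots> = dist_int (real n * y)" unfolding m2 unfolding nr qpr(3) by (simp add: algebra_simps)
      finally show ?thesis .
    qed
    have "\<mu> \<le> dist_int (real n * x) * dist_int (real n * y)"
      using m mult_mono[OF a1 a2] dist_int_nonneg by (meson order_trans)
    then show False using n(3) nv by linarith
  qed
  then show ?thesis using q0 g half pr e1 e2 by (intro exI[of _ q] exI[of _ p] exI[of _ r]) auto
qed

section \<open>The cost of covering a compact arc\<close>

text \<open>Let d = 2^(-u) be the scale of Q times the larger error. The number Q + d Q^2 of points
  times the cost (Q^(-1-v) / d)^s of each gives two terms. In the second, d occurs as d^(1-s), which
  is harmless for s < 1, and Q^(2 - (1+v) s) decays for s > 2 / (1+v). The first is worst at the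
  smallest scale d = Q^(-v/2), where both errors may be equal; there d^(-s) = Q^(s v / 2) \<le> Q,
  so it is no worse than the second.\<close>

lemma mult_approx_curve_null:
  assumes bt: "bent c C f g" and ab: "a \<le> b"
    and g0: "g0 > 0" "\<And>x y. x \<in> {a..b} \<Longrightarrow> y \<in> {a..b} \<Longrightarrow> g0 * \<bar>x - y\<bar> \<le> \<bar>f x - f y\<bar>"
    and v: "v > 1" and s: "2 / (1 + v) < s" "s < 1" "s * v \<le> 2"
  shows "hnull s {x \<in> {a..b}. (x, f x) \<in> mult_approx v}"
proof -
  have s0: "0 < s" using s(1) v by (meson divide_pos_pos less_trans zero_less_numeral add_pos_pos zero_less_one)
  define W where "W = {x \<in> {a..b}. (x, f x) \<in> mult_approx v}"
  define R where "R = {x \<in> {a..b}. x \<in> \<rat> \<or> f x \<in> \<rat>}"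
  have inj: "inj_on f {a..b}"
  proof (rule inj_onI)
    fix x y assume "x \<in> {a..b}" "y \<in> {a..b}" "f x = f y"
    then have "g0 * \<bar>x - y\<bar> \<le> 0" using g0(2)[of x y] by simp
    then show "x = y" using g0(1) by (simp add: mult_le_0_iff)
  qed
  have "countable R"
  proof -
    have "countable (f ` {x \<in> {a..b}. f x \<in> \<rat>})"
      by (rule countable_subset[OF _ countable_rat]) auto
    then have "countable {x \<in> {a..b}. f x \<in> \<rat>}"
      by (rule countable_image_inj_on) (rule inj_on_subset[OF inj], auto)
    moreover have "countable {x \<in> {a..b}. x \<in> \<rat>}" by (rule countable_subset[OF _ countable_rat]) auto
    moreover have "R = {x \<in> {a..b}. f x \<in> \<rat>} \<union> {x \<in> {a..b}. x \<in> \<rat>}" by (auto simp: R_def)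
    ultimately show ?thesis by simp
  qed
  define \<theta> where "\<theta> = (1 + v) * s - 2"
  have \<theta>: "\<theta> > 0" using s(1) v by (simp add: \<theta>_def field_simps)
  \<comment> \<open>The count may lose any power of Q that is smaller than the gain
    \<theta>.\<close>
  define \<eta> where "\<eta> = \<theta> / 4"
  have \<eta>: "\<eta> > 0" using \<theta> by (simp add: \<eta>_def)
  \<comment> \<open>The rational p/q may lie outside [a, b], but by at most 1.\<close>
  have ab1: "a - 1 \<le> b + 1" using ab by simp
  obtain G where G: "G > 0" "\<And>x y. x \<in> {a-1..b+1} \<Longrightarrow> y \<in> {a-1..b+1} \<Longrightarrow> \<bar>f x - f y\<bar> \<le> G * \<bar>x - y\<bar>"
    by (rule bent_lipschitz[OF bt ab1]) (rule that; blast)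
  obtain K where K: "K \<ge> 0" "\<And>Q \<delta>. Q \<ge> 1 \<Longrightarrow> \<delta> > 0 \<Longrightarrow>
      real (card (near_pts f (a - 1) (b + 1) Q \<delta>)) \<le> K * Q powr \<eta> * (Q + \<delta> * Q^2)"
    by (rule count_boundE[OF count_bound_all[OF \<eta>] bt ab1]) (rule that; blast)
  define Q where "Q t = (2::real)^(t + 1)" for t
  have Q1: "1 \<le> Q t" for t unfolding Q_def by (rule one_le_power) simp
  have Q0: "0 < Q t" for t using Q1[of t] by linarith
  \<comment> \<open>The least u with 2^(-u) \<le> Q^(-v/2). At this scale even the larger error is
    below \<rho>, so finer scales are covered along with it.\<close>
  define um where "um t = nat \<lceil>v * real (t + 1) / 2\<rceil>" for t
  \<comment> \<open>Of the factor 2^(v+3), a part 2^(v+2) comes from q \<ge> Q/2 and one 2 from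
    rounding the larger error to a dyadic scale.\<close>
  define \<rho> where "\<rho> t u = 2 powr (v + 3) * Q t powr (- v - 1) * 2 powr (real u)" for t u :: nat
  have \<rho>0: "0 < \<rho> t u" for t u using Q0[of t] by (simp add: \<rho>_def)
  \<comment> \<open>Moving from x to p/q changes f by at most G times the larger error, and the
    error in y adds one more.\<close>
  define \<delta> where "\<delta> u = (G + 1) * 2 powr (- real u)" for u :: nat
  have \<delta>0: "0 < \<delta> u" for u using G(1) by (simp add: \<delta>_def)
  \<comment> \<open>The boolean tells which of the two coordinates has the smaller error.\<close>
  define I where "I t = (SIGMA u:{..um t}. near_pts f (a - 1) (b + 1) (Q t) (\<delta> u) \<times> (UNIV :: bool set))" for t
  define S where "S t = (\<lambda>(u, P, k). if k then {x \<in> {a..b}. \<bar>x - ptx P\<bar> \<le> \<rho> t u}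
     else {x \<in> {a..b}. \<bar>f x - pty P\<bar> \<le> \<rho> t u})" for t
  have finN: "finite (near_pts f (a - 1) (b + 1) (Q t) (\<delta> u))" for t u
    by (rule near_pts_trivial_bound(1)[OF ab1 Q1 \<delta>0])
  have finI: "finite (I t)" for t unfolding I_def using finN by (intro finite_SigmaI finite_cartesian_product) auto
  have bS: "bounded (S t i)" for t i
    by (rule bounded_subset[of "{a..b}"]) (auto simp: S_def split: prod.split)
  \<comment> \<open>A small error in y confines x only through the lower bound g0 on the growth of
    f; this gives the term 2 / g0.\<close>
  define \<Lambda> where "\<Lambda> = 2 + 2 / g0"
  have \<Lambda>: "\<Lambda> > 0" using g0(1) by (simp add: \<Lambda>_def add_pos_pos)
  have dS: "diameter (S t (u, P, k)) \<le> \<Lambda> * \<rho> t u" for t u P k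
  proof (rule diameter_leI)
    fix x y assume xy: "x \<in> S t (u, P, k)" "y \<in> S t (u, P, k)"
    have r0: "0 \<le> 2 * \<rho> t u" "0 \<le> 2 / g0 * \<rho> t u" using \<rho>0[of t u] g0(1) by auto
    show "dist x y \<le> \<Lambda> * \<rho> t u"
    proof (cases k)
      case True
      then have "\<bar>x - ptx P\<bar> \<le> \<rho> t u" "\<bar>y - ptx P\<bar> \<le> \<rho> t u" using xy by (auto simp: S_def)
      then have "\<bar>x - y\<bar> \<le> 2 * \<rho> t u" by linarith
      then show ?thesis using r0 by (simp add: dist_real_def \<Lambda>_def algebra_simps)
    next
      case False
      then have *: "x \<in> {a..b}" "y \<in> {a..b}" "\<bar>f x - pty P\<bar> \<le> \<rho> t u" "\<bar>f y - pty P\<bar> \<le> \<rho> t u"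
        using xy by (auto simp: S_def)
      then have "g0 * \<bar>x - y\<bar> \<le> 2 * \<rho> t u" using g0(2)[of x y] by linarith
      then have "\<bar>x - y\<bar> \<le> 2 / g0 * \<rho> t u" using g0(1) by (simp add: field_simps)
      then show ?thesis using r0 by (simp add: dist_real_def \<Lambda>_def algebra_simps)
    qed
  qed (use \<Lambda> \<rho>0[of t u] in simp)
  define D where "D = 2 * K * (\<Lambda> * 2 powr (v + 3)) powr s * (2 + (G + 1))"
  have D: "D \<ge> 0" using K(1) G(1) by (simp add: D_def)
  have cost1: "(\<Sum>P\<in>near_pts f (a - 1) (b + 1) (Q t) (\<delta> u). \<Sum>k\<in>UNIV. diameter (S t (u, P, k)) powr s)
      \<le> D * Q t powr (\<eta> - \<theta>)" if u: "u \<le> um t" for t u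
  proof -
    have "(\<Sum>P\<in>near_pts f (a - 1) (b + 1) (Q t) (\<delta> u). \<Sum>k\<in>UNIV. diameter (S t (u, P, k)) powr s)
       \<le> (\<Sum>P\<in>near_pts f (a - 1) (b + 1) (Q t) (\<delta> u). \<Sum>k\<in>(UNIV::bool set). (\<Lambda> * \<rho> t u) powr s)"
      using diameter_ge_0[OF bS] dS s0 by (intro sum_mono powr_mono2) auto
    also have "\<dots> = 2 * real (card (near_pts f (a - 1) (b + 1) (Q t) (\<delta> u))) * (\<Lambda> * \<rho> t u) powr s"
      by (simp add: UNIV_bool)
    also have "\<dots> \<le> 2 * (K * Q t powr \<eta> * (Q t + \<delta> u * (Q t)^2)) * (\<Lambda> * \<rho> t u) powr s"
      using K(2)[OF Q1 \<delta>0] by (intro mult_right_mono mult_left_mono) auto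
    also have "(\<Lambda> * \<rho> t u) powr s = (\<Lambda> * 2 powr (v + 3)) powr s * (Q t powr ((- v - 1) * s) * 2 powr (u * s))"
      unfolding \<rho>_def using \<Lambda> Q0[of t] by (simp add: powr_mult powr_powr mult.assoc)
    also have "2 * (K * Q t powr \<eta> * (Q t + \<delta> u * (Q t)^2)) * ((\<Lambda> * 2 powr (v + 3)) powr s * (Q t powr ((- v - 1) * s) * 2 powr (u * s)))
      = 2 * K * (\<Lambda> * 2 powr (v + 3)) powr s * (Q t powr \<eta> * Q t powr ((- v - 1) * s) * ((Q t + \<delta> u * (Q t)^2) * 2 powr (u * s)))"
      by (simp add: mult_ac)
    also have "\<dots> \<le> 2 * K * (\<Lambda> * 2 powr (v + 3)) powr s * (Q t powr \<eta> * Q t powr ((- v - 1) * s) * ((2 + (G + 1)) * (Q t)^2))"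
    proof (intro mult_left_mono)
      have us: "2 powr (u * s) \<le> 2 * Q t"
      proof -
        have "real u \<le> v * real (t + 1) / 2 + 1"
        proof -
          have "0 \<le> v * real (t + 1) / 2" using v by simp
          then have "real (um t) \<le> v * real (t + 1) / 2 + 1" unfolding um_def by linarith
          then show ?thesis using u by linarith
        qed
        then have "u * s \<le> (v * real (t + 1) / 2 + 1) * s" using s0 by (intro mult_right_mono) auto
        also have "\<dots> = (s * v) * real (t + 1) / 2 + s" by (simp add: algebra_simps)
        also have "\<dots> \<le> 2 * real (t + 1) / 2 + 1"
          using s by (intro add_mono divide_right_mono mult_right_mono) auto
        finally have "u * s \<le> real (t + 2)" by (simp add: field_simps)
        then have "2 powr (u * s) \<le> 2 powr (real (t + 2))" by (intro powr_mono) auto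
        also have "\<dots> = 2 * Q t" by (simp only: powr_realpow zero_less_numeral) (simp add: Q_def)
        finally show ?thesis .
      qed
      have "2 powr (- real u) * 2 powr (u * s) = 2 powr (- (real u * (1 - s)))"
        by (simp add: algebra_simps flip: powr_add)
      also have "\<dots> \<le> 2 powr 0" using s by (intro powr_mono) auto
      finally have d1: "2 powr (- real u) * 2 powr (u * s) \<le> 1" by simp
      have "(Q t + \<delta> u * (Q t)^2) * 2 powr (u * s) =
          Q t * 2 powr (u * s) + (G + 1) * (Q t)^2 * (2 powr (- real u) * 2 powr (u * s))"
        by (simp add: \<delta>_def algebra_simps)
      also have "\<dots> \<le> Q t * (2 * Q t) + (G + 1) * (Q t)^2 * 1"
        using us d1 Q0[of t] G(1) by (intro add_mono mult_left_mono) auto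
      also have "\<dots> = (2 + (G + 1)) * (Q t)^2" by (simp add: power2_eq_square algebra_simps)
      finally show "(Q t + \<delta> u * (Q t)^2) * 2 powr (u * s) \<le> (2 + (G + 1)) * (Q t)^2" .
    qed (use K(1) in auto)
    also have "\<dots> = D * (Q t powr \<eta> * Q t powr ((- v - 1) * s) * (Q t)^2)" by (simp add: D_def mult_ac)
    also have "Q t powr \<eta> * Q t powr ((- v - 1) * s) * (Q t)^2 = Q t powr (\<eta> - \<theta>)"
    proof -
      have "(Q t)^2 = Q t powr 2" using Q0[of t] by (simp add: powr_numeral)
      moreover have "\<eta> + (- v - 1) * s + 2 = \<eta> - \<theta>" by (simp add: \<theta>_def algebra_simps)
      ultimately show ?thesis by (simp only: powr_add[symmetric])
    qed
    finally show ?thesis .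
  qed
  define w where "w t = (v * real (t + 1) / 2 + 2) * (D * Q t powr (\<eta> - \<theta>))" for t
  have cost: "(\<Sum>i\<in>I t. diameter (S t i) powr s) \<le> w t" for t
  proof -
    have "(\<Sum>i\<in>I t. diameter (S t i) powr s) =
       (\<Sum>u\<in>{..um t}. \<Sum>z\<in>near_pts f (a - 1) (b + 1) (Q t) (\<delta> u) \<times> UNIV. diameter (S t (u, z)) powr s)"
      unfolding I_def using finN by (subst sum.Sigma) (auto simp: split_def)
    also have "\<dots> = (\<Sum>u\<in>{..um t}. \<Sum>P\<in>near_pts f (a - 1) (b + 1) (Q t) (\<delta> u). \<Sum>k\<in>UNIV. diameter (S t (u, P, k)) powr s)"
      by (intro sum.cong refl) (simp add: sum.cartesian_product split_def)
    also have "\<dots> \<le> (\<Sum>u\<in>{..um t}. D * Q t powr (\<eta> - \<theta>))" by (intro sum_mono cost1) auto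
    also have "\<dots> = (real (um t) + 1) * (D * Q t powr (\<eta> - \<theta>))" by simp
    also have "\<dots> \<le> w t" unfolding w_def
    proof (intro mult_right_mono)
      have "0 \<le> v * real (t + 1) / 2" using v by simp
      then show "real (um t) + 1 \<le> v * real (t + 1) / 2 + 2" unfolding um_def by linarith
    qed (use D in auto)
    finally show ?thesis .
  qed
  have smw: "summable w"
  proof -
    define z where "z = 2 powr (\<eta> - \<theta>)"
    have z: "0 < z" "z < 1"
    proof -
      have "2 powr (\<eta> - \<theta>) < 2 powr 0" using \<theta> by (intro powr_less_mono) (auto simp: \<eta>_def)
      then show "0 < z" "z < 1" by (auto simp: z_def)
    qed
    have Qz: "Q t powr (\<eta> - \<theta>) = z^(t + 1)" for t
    proof -
      have 1: "Q t = 2 powr real (t + 1)" unfolding Q_def by (rule powr_realpow[symmetric]) simp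
      have "z^(t + 1) = z powr real (t + 1)" using z(1) by (rule powr_realpow[symmetric])
      then show ?thesis unfolding 1 z_def powr_powr by (simp add: mult.commute)
    qed
    \<comment> \<open>The differentiated geometric series: its linear factor matches the number of
      scales u at height Q t.\<close>
    have "summable (\<lambda>n. diffs (\<lambda>n. 1) n * z ^ n)"
      by (rule termdiff_converges[of z 1]) (use z in \<open>auto intro!: summable_geometric\<close>)
    then have s1: "summable (\<lambda>n. real (Suc n) * z ^ n)" by (simp add: diffs_def)
    have s2: "summable (\<lambda>n. z ^ n)" using z by (intro summable_geometric) auto
    have "w = (\<lambda>t. v / 2 * D * z * (real (Suc t) * z ^ t) + 2 * D * z * z ^ t)"
      unfolding w_def Qz by (simp add: fun_eq_iff algebra_simps)
    then show ?thesis using s1 s2 by (simp only:) (intro summable_add summable_mult)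
  qed
  have "hnull s (W - R)"
  proof (rule hnull_limsup[OF s0 finI _ cost smw])
    show "bounded (S t i)" for t i by (rule bS)
    fix x T assume x: "x \<in> W - R"
    then have xab: "x \<in> {a..b}" and xm: "(x, f x) \<in> mult_approx v" and irr: "x \<notin> \<rat>" "f x \<notin> \<rat>"
      by (auto simp: W_def R_def)
    obtain q p r where q: "int (2^T) \<le> q" "0 < q" "gcd q (gcd p r) = 1"
       "\<bar>x - real_of_int p / q\<bar> \<le> 1 / (2 * q)" "\<bar>f x - real_of_int r / q\<bar> \<le> 1 / (2 * q)"
       "\<bar>x - real_of_int p / q\<bar> * \<bar>f x - real_of_int r / q\<bar> < real_of_int q powr (- v - 2)"
    proof -
      have "v > 0" using v by simp
      from primitive_approximations[OF this xm irr, of "2^T"] show thesis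
        by (elim exE conjE) (rule that)
    qed
    obtain t where t: "2^t \<le> nat q" "nat q < 2^(t+1)"
    proof -
      have "1 \<le> nat q" using q(2) by simp
      from ex_power_ivl1[OF order_refl this] show thesis using that by blast
    qed
    have tr: "2^t \<le> real_of_int q" "real_of_int q < 2^(t+1)"
    proof -
      have "real (2^t) \<le> real (nat q)" "real (nat q) < real (2^(t+1))" using t by (simp_all only: of_nat_le_iff of_nat_less_iff)
      then show "2^t \<le> real_of_int q" "real_of_int q < 2^(t+1)" using q(2) by auto
    qed
    have tT: "t \<ge> T"
    proof (rule ccontr)
      assume "\<not> t \<ge> T"
      then have "(2::nat)^(t+1) \<le> 2^T" by (intro power_increasing) auto
      moreover have "2^T \<le> nat q" using q(1) by (simp add: nat_le_iff le_nat_iff)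
      ultimately show False using t(2) by linarith
    qed
    have qQ: "real_of_int q \<le> Q t" "Q t \<le> 2 * real_of_int q" using tr by (auto simp: Q_def)
    define e1 e2 m where "e1 = \<bar>x - real_of_int p / q\<bar>" and "e2 = \<bar>f x - real_of_int r / q\<bar>" and "m = max e1 e2"
    have e0: "0 \<le> e1" "0 \<le> e2" by (auto simp: e1_def e2_def)
    have mQ: "m \<le> 1 / Q t"
    proof -
      have "1 / (2 * real_of_int q) \<le> 1 / Q t" using qQ Q0[of t] q(2) by (intro divide_left_mono) auto
      then show ?thesis using q(4,5) by (simp add: m_def e1_def e2_def)
    qed
    define U where "U = {u. u \<le> um t \<and> m \<le> 2 powr (- real u) / Q t}"
    have Ufin: "finite U" by (rule finite_subset[of _ "{..um t}"]) (auto simp: U_def)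
    have "0 \<in> U" using mQ by (simp add: U_def)
    \<comment> \<open>By maximality either u = um t, or the larger error m exceeds half of 2^(-u) /
      Q, and then dividing the product of the errors by m bounds the smaller one.\<close>
    define u where "u = Max U"
    have uU: "u \<in> U" unfolding u_def using Ufin \<open>0 \<in> U\<close> by (intro Max_in) auto
    then have u: "u \<le> um t" "m \<le> 2 powr (- real u) / Q t" by (auto simp: U_def)
    have mn: "min e1 e2 \<le> \<rho> t u"
    proof (cases "u = um t")
      case True
      have "v * real (t + 1) / 2 \<le> real (um t)" unfolding um_def by linarith
      then have "v * real (t + 1) - real u \<le> real u" using True by simp
      moreover have "0 \<le> v + 3" using v by simp
      ultimately have le: "- real u \<le> (v + 3) - v * real (t + 1) + real u" by linarith
      have Qp: "Q t = 2 powr real (t + 1)" unfolding Q_def by (rule powr_realpow[symmetric]) simp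
      have "min e1 e2 \<le> 2 powr (- real u) / Q t" using u(2) by (simp add: m_def min_le_iff_disj)
      also have "\<dots> \<le> 2 powr ((v + 3) - v * real (t + 1) + real u) / Q t"
        using le Q0[of t] by (intro divide_right_mono powr_mono) auto
      also have "\<dots> = \<rho> t u"
        unfolding \<rho>_def Qp powr_powr by (simp only: powr_add[symmetric] powr_diff[symmetric]) (simp add: algebra_simps)
      finally show ?thesis .
    next
      case False
      have "Suc u \<notin> U" using Max_ge[OF Ufin, of "Suc u"] by (auto simp: u_def)
      then have mg: "2 powr (- real (Suc u)) / Q t < m" using False u(1) by (auto simp: U_def)
      have m0: "0 < m"
      proof -
        have "0 < 2 powr (- real (Suc u)) / Q t" using Q0[of t] by simp
        then show ?thesis using mg by linarith
      qed
      have "min e1 e2 * m = e1 * e2" by (simp add: m_def min_def max_def)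
      also have "\<dots> < real_of_int q powr (- v - 2)" using q(6) by (simp add: e1_def e2_def)
      also have "\<dots> \<le> (Q t / 2) powr (- v - 2)" using qQ Q0[of t] v by (intro powr_mono2') auto
      also have "\<dots> = \<rho> t u * (2 powr (- real (Suc u)) / Q t)"
      proof -
        have Qp: "Q t = 2 powr real (t + 1)" unfolding Q_def by (rule powr_realpow[symmetric]) simp
        have h: "Q t / 2 = 2 powr (real t)" by (simp add: Q_def powr_realpow)
        show ?thesis unfolding \<rho>_def h
          unfolding Qp powr_powr by (simp only: powr_add[symmetric] powr_diff[symmetric]) (simp add: algebra_simps)
      qed
      also have "\<dots> \<le> \<rho> t u * m" using mg \<rho>0[of t u] by (intro mult_left_mono) auto
      finally have "min e1 e2 * m < \<rho> t u * m" .
      then show ?thesis using m0 by simp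
    qed
    have near: "(q, p, r) \<in> near_pts f (a - 1) (b + 1) (Q t) (\<delta> u)"
    proof -
      have "1 / (2 * real_of_int q) \<le> 1" using q(2) by simp
      then have "\<bar>x - real_of_int p / q\<bar> \<le> 1" using q(4) by linarith
      then have px: "a - 1 \<le> real_of_int p / q" "real_of_int p / q \<le> b + 1" using xab by auto
      have "\<bar>f (real_of_int p / q) - f x\<bar> \<le> G * \<bar>real_of_int p / q - x\<bar>" using px xab by (intro G(2)) auto
      also have "\<dots> = G * e1" by (simp add: e1_def abs_minus_commute)
      also have "\<dots> \<le> G * m" using G(1) by (intro mult_left_mono) (auto simp: m_def)
      finally have "\<bar>f (real_of_int p / q) - real_of_int r / q\<bar> \<le> G * m + e2" unfolding e2_def by linarith
      also have "\<dots> \<le> G * m + m" by (simp add: m_def)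
      also have "\<dots> = (G + 1) * m" by (simp add: algebra_simps)
      also have "\<dots> \<le> (G + 1) * (2 powr (- real u) / Q t)" using u(2) G(1) by (intro mult_left_mono) auto
      also have "\<dots> = \<delta> u / Q t" by (simp add: \<delta>_def)
      finally show ?thesis using px q(2,3) qQ by (simp add: near_pts_def)
    qed
    define k where "k \<longleftrightarrow> e1 \<le> e2"
    have "(u, (q, p, r), k) \<in> I t" using u(1) near by (simp add: I_def)
    moreover have "x \<in> S t (u, (q, p, r), k)"
      using mn xab by (auto simp: S_def k_def e1_def e2_def min_def split: if_splits)
    ultimately show "\<exists>t\<ge>T. \<exists>i\<in>I t. x \<in> S t i" using tT by blast
  qed
  moreover have "hnull s R" by (rule hnull_countable) fact
  ultimately have "hnull s ((W - R) \<union> R)" by (rule hnull_Un)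
  then show ?thesis by (rule hnull_subset) (auto simp: W_def)
qed

section \<open>Extending an arc to the whole line\<close>

lemma real_derivative_glue:
  assumes "(F has_real_derivative D) (at x within S)" "(F has_real_derivative D) (at x within T)"
  shows "(F has_real_derivative D) (at x within (S \<union> T))"
  using assms unfolding has_field_derivative_iff by (simp add: at_within_union filterlim_sup)

lemma real_derivative_outside_closed:
  assumes "closed S" "x \<notin> S"
  shows "(F has_real_derivative D) (at x within S)"
proof -
  have "at x within S = bot"
    using assms by (metis closed_limpt trivial_limit_within)
  then show ?thesis by (simp add: has_field_derivative_iff)
qed

text \<open>F minus the parabola with the same tangent at x and second derivative c has a derivative
  with the sign of z - x, hence its minimum at x. The sign \<sigma> treats the upper bound in the
  same way.\<close>

lemma bent_from_slope:
  assumes "0 < c" "c \<le> C" and F: "\<And>x. (F has_real_derivative g x) (at x)"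
    and sl: "\<And>x y. x \<le> y \<Longrightarrow> c * (y - x) \<le> g y - g x \<and> g y - g x \<le> C * (y - x)"
  shows "bent (c / 2) (C / 2) F g"
  unfolding bent_def
proof (intro conjI allI)
  have *: "0 \<le> \<sigma> * (F y - F x - g x * (y - x) - k / 2 * (y - x)^2)"
    if k: "\<And>x y. x \<le> y \<Longrightarrow> 0 \<le> \<sigma> * (g y - g x - k * (y - x))" for \<sigma> k x y
  proof -
    define \<phi> where "\<phi> z = \<sigma> * (F z - F x - g x * (z - x) - k / 2 * (z - x)^2)" for z
    have d: "(\<phi> has_real_derivative \<sigma> * (g z - g x - k * (z - x))) (at z)" for z
      unfolding \<phi>_def by (auto intro!: derivative_eq_intros F)
    have "\<phi> x \<le> \<phi> y"
    proof (cases "x \<le> y")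
      case True
      show ?thesis
        by (rule DERIV_nonneg_imp_nondecreasing[of x y \<phi>, OF True]) (use d k in blast)
    next
      case False
      show ?thesis
      proof (rule DERIV_nonpos_imp_nonincreasing[of y x \<phi>])
        show "y \<le> x" using False by simp
        fix z assume "y \<le> z" "z \<le> x"
        then have "\<sigma> * (g z - g x - k * (z - x)) \<le> 0" using k[of z x] by (simp add: algebra_simps)
        then show "\<exists>w. (\<phi> has_real_derivative w) (at z) \<and> w \<le> 0" using d by blast
      qed
    qed
    then show ?thesis by (simp add: \<phi>_def)
  qed
  fix x y
  show "c / 2 * (y - x)^2 \<le> F y - F x - g x * (y - x)" using *[of 1 c y x] sl by simp
  show "F y - F x - g x * (y - x) \<le> C / 2 * (y - x)^2" using *[of "-1" C y x] sl by simp
qed (use assms in auto)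

text \<open>Beyond its ends the arc is continued by parabolas with second derivative c, the minimum
  of \<open>f2\<close>. Values and slopes match at the joints, which is all that
  \<open>bent_from_slope\<close> asks for, together with bounds on slope increments.\<close>

lemma bent_extension_pos:
  assumes ab: "a < b"
    and f: "\<And>x. x \<in> {a..b} \<Longrightarrow> (f has_real_derivative f1 x) (at x within {a..b})"
    and f1: "\<And>x. x \<in> {a..b} \<Longrightarrow> (f1 has_real_derivative f2 x) (at x within {a..b})"
    and f2: "continuous_on {a..b} f2" "\<And>x. x \<in> {a..b} \<Longrightarrow> 0 < f2 x"
  shows "\<exists>F g c C. bent c C F g \<and> (\<forall>x\<in>{a..b}. F x = f x)"
proof -
  have ne: "{a..b} \<noteq> {}" using ab by simp
  obtain xm where xm: "xm \<in> {a..b}" "\<And>x. x \<in> {a..b} \<Longrightarrow> f2 xm \<le> f2 x"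
    using continuous_attains_inf[OF compact_Icc ne f2(1)] by blast
  obtain xM where xM: "xM \<in> {a..b}" "\<And>x. x \<in> {a..b} \<Longrightarrow> f2 x \<le> f2 xM"
    using continuous_attains_sup[OF compact_Icc ne f2(1)] by blast
  define c C where "c = f2 xm" and "C = f2 xM"
  have cC: "0 < c" "c \<le> C" using f2(2)[OF xm(1)] xM(2)[OF xm(1)] by (auto simp: c_def C_def)
  have sl1: "c * (y - x) \<le> f1 y - f1 x \<and> f1 y - f1 x \<le> C * (y - x)" if xyab: "x \<in> {a..b}" "y \<in> {a..b}" "x \<le> y" for x y
  proof (cases "x = y")
    case False
    then have xy: "x < y" using xyab by simp
    have "\<exists>z\<in>{x<..<y}. f1 y - f1 x = (\<lambda>h. f2 z * h) (y - x)"
    proof (rule mvt_simple[OF xy])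
      fix z assume "x \<le> z" "z \<le> y"
      then have "z \<in> {a..b}" "{x..y} \<subseteq> {a..b}" using xyab by auto
      then have "(f1 has_real_derivative f2 z) (at z within {x..y})" using f1 DERIV_subset by blast
      then show "(f1 has_derivative (\<lambda>h. f2 z * h)) (at z within {x..y})" by (simp add: has_field_derivative_def)
    qed
    then obtain z where z: "z \<in> {x<..<y}" "f1 y - f1 x = f2 z * (y - x)" by blast
    then have zab: "z \<in> {a..b}" using xyab by simp
    then show ?thesis using xm(2)[OF zab] xM(2)[OF zab] xy z(2) unfolding c_def C_def by (auto intro!: mult_right_mono)
  qed simp
  \<comment> \<open>The projection onto [a, b] lets one formula describe the arc and both
    parabolas.\<close>
  define cl where "cl x = max a (min b x)" for x
  have cl: "cl x \<in> {a..b}" for x using ab by (auto simp: cl_def)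
  define g where "g x = f1 (cl x) + c * (x - cl x)" for x
  define F where "F x = f (cl x) + f1 (cl x) * (x - cl x) + c / 2 * (x - cl x)^2" for x
  have clx: "cl x = x" if "x \<in> {a..b}" for x using that by (auto simp: cl_def)
  have cla: "cl x = a" if "x \<le> a" for x using that ab by (auto simp: cl_def)
  have clb: "cl x = b" if "b \<le> x" for x using that ab by (auto simp: cl_def)
  have slg: "c * (y - x) \<le> g y - g x \<and> g y - g x \<le> C * (y - x)" if "x \<le> y" for x y
  proof -
    have "cl x \<le> cl y" using that by (auto simp: cl_def)
    then have 1: "c * (cl y - cl x) \<le> f1 (cl y) - f1 (cl x)" "f1 (cl y) - f1 (cl x) \<le> C * (cl y - cl x)"
      using sl1[OF cl cl] by auto
    have 2: "0 \<le> (y - x) - (cl y - cl x)" using that by (auto simp: cl_def)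
    have e: "g y - g x = (f1 (cl y) - f1 (cl x)) + c * ((y - x) - (cl y - cl x))" by (simp add: g_def algebra_simps)
    have "c * ((y - x) - (cl y - cl x)) \<le> C * ((y - x) - (cl y - cl x))" using 2 cC by (intro mult_right_mono) auto
    then show ?thesis unfolding e using 1 by (simp add: algebra_simps)
  qed
  have "(F has_real_derivative g x) (at x)" for x
  proof -
    have A: "(F has_real_derivative g x) (at x within {..a})"
    proof (cases "x \<in> {..a}")
      case True
      have "((\<lambda>z. f a + f1 a * (z - a) + c / 2 * (z - a)^2) has_real_derivative g x) (at x within {..a})"
        using True by (auto intro!: derivative_eq_intros simp: g_def cla)
      then show ?thesis
        by (rule has_field_derivative_transform_within[OF _ zero_less_one True]) (auto simp: F_def cla)
    qed (simp add: real_derivative_outside_closed)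
    have B: "(F has_real_derivative g x) (at x within {b..})"
    proof (cases "x \<in> {b..}")
      case True
      have "((\<lambda>z. f b + f1 b * (z - b) + c / 2 * (z - b)^2) has_real_derivative g x) (at x within {b..})"
        using True by (auto intro!: derivative_eq_intros simp: g_def clb)
      then show ?thesis
        by (rule has_field_derivative_transform_within[OF _ zero_less_one True]) (auto simp: F_def clb)
    qed (simp add: real_derivative_outside_closed)
    have M: "(F has_real_derivative g x) (at x within {a..b})"
    proof (cases "x \<in> {a..b}")
      case True
      have "(f has_real_derivative g x) (at x within {a..b})" using f[OF True] clx[OF True] by (simp add: g_def)
      then show ?thesis
        by (rule has_field_derivative_transform_within[OF _ zero_less_one True]) (auto simp: F_def clx)
    qed (simp add: real_derivative_outside_closed)
    have "{..a} \<union> {a..b} \<union> {b..} = UNIV" using ab by auto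
    then show ?thesis using real_derivative_glue[OF real_derivative_glue[OF A M] B] by simp
  qed
  from bent_from_slope[OF cC this slg] have "bent (c / 2) (C / 2) F g" .
  moreover have "\<forall>x\<in>{a..b}. F x = f x" by (simp add: F_def clx)
  ultimately show ?thesis by blast
qed

lemma nonzero_constant_sign:
  fixes \<phi> :: "real \<Rightarrow> real"
  assumes "continuous_on {a..b} \<phi>" "\<And>x. x \<in> {a..b} \<Longrightarrow> \<phi> x \<noteq> 0"
  shows "(\<forall>x\<in>{a..b}. 0 < \<phi> x) \<or> (\<forall>x\<in>{a..b}. 0 < - \<phi> x)"
proof (rule ccontr)
  assume "\<not> ?thesis"
  then obtain x y where xy: "x \<in> {a..b}" "y \<in> {a..b}" "\<phi> x < 0" "0 < \<phi> y" using assms(2) by force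
  have "connected (\<phi> ` {a..b})" using assms(1) by (intro connected_continuous_image) auto
  then have "0 \<in> \<phi> ` {a..b}"
    using xy connectedD_interval[of "\<phi> ` {a..b}" "\<phi> x" "\<phi> y" 0] by auto
  then show False using assms(2) by auto
qed

lemma dist_int_uminus: "dist_int (- x) = dist_int x"
proof -
  have le: "dist_int (- x) \<le> dist_int x" for x
  proof -
    obtain m :: int where "dist_int x = \<bar>x - of_int m\<bar>" using dist_int_attained by blast
    then show ?thesis using dist_int_le[of "- x" "- m"] by simp
  qed
  show ?thesis using le[of x] le[of "- x"] by simp
qed

text \<open>A negative \<open>f2\<close> is handled by reflecting the curve in the x-axis, under
  which \<open>mult_approx\<close> is invariant.\<close>

lemma curve_null_compact:
  assumes ab: "a < b"
    and f: "\<And>x. x \<in> {a..b} \<Longrightarrow> (f has_real_derivative f1 x) (at x within {a..b})"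
    and f1: "\<And>x. x \<in> {a..b} \<Longrightarrow> (f1 has_real_derivative f2 x) (at x within {a..b})"
    and f2: "continuous_on {a..b} f2" "\<And>x. x \<in> {a..b} \<Longrightarrow> f2 x \<noteq> 0"
    and f1n: "\<And>x. x \<in> {a..b} \<Longrightarrow> f1 x \<noteq> 0"
    and v: "v > 1" and s: "2 / (1 + v) < s" "s < 1" "s * v \<le> 2"
  shows "hnull s {x \<in> {a..b}. (x, f x) \<in> mult_approx v}"
proof -
  have ne: "{a..b} \<noteq> {}" using ab by simp
  have c1: "continuous_on {a..b} f1" using f1 by (intro DERIV_continuous_on) auto
  obtain xm where xm: "xm \<in> {a..b}" "\<And>x. x \<in> {a..b} \<Longrightarrow> \<bar>f1 xm\<bar> \<le> \<bar>f1 x\<bar>"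
    using continuous_attains_inf[OF compact_Icc ne continuous_on_rabs[OF c1]] by blast
  define g0 where "g0 = \<bar>f1 xm\<bar>"
  have g0: "g0 > 0" using f1n[OF xm(1)] by (simp add: g0_def)
  have lip: "g0 * \<bar>x - y\<bar> \<le> \<bar>f x - f y\<bar>" if "x \<in> {a..b}" "y \<in> {a..b}" for x y
  proof -
    have *: "g0 * (y - x) \<le> \<bar>f y - f x\<bar>" if xyab: "x \<in> {a..b}" "y \<in> {a..b}" "x < y" for x y
    proof -
      have "\<exists>z\<in>{x<..<y}. f y - f x = (\<lambda>h. f1 z * h) (y - x)"
      proof (rule mvt_simple[OF \<open>x < y\<close>])
        fix z assume "x \<le> z" "z \<le> y"
        then have "z \<in> {a..b}" "{x..y} \<subseteq> {a..b}" using xyab by auto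
        then have "(f has_real_derivative f1 z) (at z within {x..y})" using f DERIV_subset by blast
        then show "(f has_derivative (\<lambda>h. f1 z * h)) (at z within {x..y})" by (simp add: has_field_derivative_def)
      qed
      then obtain z where z: "z \<in> {x<..<y}" "f y - f x = f1 z * (y - x)" by blast
      then have zab: "z \<in> {a..b}" using xyab by simp
      have "\<bar>f y - f x\<bar> = \<bar>f1 z\<bar> * (y - x)" unfolding z(2) using \<open>x < y\<close> by (simp add: abs_mult)
      then show ?thesis using xm(2)[OF zab] \<open>x < y\<close> by (simp add: g0_def mult_right_mono)
    qed
    show ?thesis
    proof (cases x y rule: linorder_cases)
      case less
      then have "\<bar>x - y\<bar> = y - x" by simp
      then show ?thesis using *[OF that less] by (simp add: abs_minus_commute)
    next
      case greater
      then have "\<bar>x - y\<bar> = x - y" by simp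
      then show ?thesis using *[OF that(2,1) greater] by simp
    qed simp
  qed
  have "\<exists>\<sigma> F g c C. (\<sigma> = 1 \<or> \<sigma> = - 1) \<and> bent c C F g \<and> (\<forall>x\<in>{a..b}. F x = \<sigma> * f x)"
    using nonzero_constant_sign[OF f2]
  proof
    assume "\<forall>x\<in>{a..b}. 0 < f2 x"
    then have "\<exists>F g c C. bent c C F g \<and> (\<forall>x\<in>{a..b}. F x = f x)"
      using bent_extension_pos[OF ab f f1 f2(1)] by blast
    then show ?thesis by (intro exI[of _ 1]) simp
  next
    assume n: "\<forall>x\<in>{a..b}. 0 < - f2 x"
    have "\<exists>F g c C. bent c C F g \<and> (\<forall>x\<in>{a..b}. F x = - f x)"
    proof (rule bent_extension_pos[OF ab, where ?f1.0 = "\<lambda>x. - f1 x" and ?f2.0 = "\<lambda>x. - f2 x"])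
      show "continuous_on {a..b} (\<lambda>x. - f2 x)" by (intro continuous_intros f2(1))
    qed (use n f f1 in \<open>auto intro!: derivative_intros\<close>)
    then show ?thesis by (intro exI[of _ "- 1"]) simp
  qed
  then obtain \<sigma> F g c C where F: "\<sigma> = 1 \<or> \<sigma> = - 1" "bent c C F g" "\<And>x. x \<in> {a..b} \<Longrightarrow> F x = \<sigma> * f x" by blast
  have lipF: "g0 * \<bar>x - y\<bar> \<le> \<bar>F x - F y\<bar>" if "x \<in> {a..b}" "y \<in> {a..b}" for x y
    using lip[OF that] F(1) F(3)[OF that(1)] F(3)[OF that(2)] by (auto simp: abs_minus_commute)
  have "hnull s {x \<in> {a..b}. (x, F x) \<in> mult_approx v}"
    by (rule mult_approx_curve_null[OF F(2) less_imp_le[OF ab] g0 lipF v s])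
  moreover have "(x, F x) \<in> mult_approx v \<longleftrightarrow> (x, f x) \<in> mult_approx v" if "x \<in> {a..b}" for x
    using F(1) F(3)[OF that] by (auto simp: mult_approx_def dist_int_uminus)
  ultimately show ?thesis by (metis (no_types, lifting) Collect_cong)
qed

section \<open>From compact arcs to the whole interval\<close>

text \<open>A point with members of the interval on both sides is interior, so at most a least and a
  greatest element are left over.\<close>

lemma interval_endpoints_countable:
  fixes I :: "real set"
  assumes "is_interval I"
  shows "countable (I - interior I)"
proof -
  define L where "L = {x \<in> I. \<forall>y\<in>I. x \<le> y}"
  define R where "R = {x \<in> I. \<forall>y\<in>I. y \<le> x}"
  have "I - interior I \<subseteq> L \<union> R"
  proof
    fix x assume x: "x \<in> I - interior I"
    show "x \<in> L \<union> R"
    proof (rule ccontr)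
      assume "x \<notin> L \<union> R"
      then obtain y z where yz: "y \<in> I" "y < x" "z \<in> I" "x < z" using x by (auto simp: L_def R_def not_le)
      have "{y<..<z} \<subseteq> I" using assms yz unfolding is_interval_1 by (meson greaterThanLessThan_iff less_imp_le subsetI)
      then have "x \<in> interior I" using yz by (intro interiorI[of "{y<..<z}"]) auto
      then show False using x by simp
    qed
  qed
  moreover have "L \<subseteq> {x}" if "x \<in> L" for x using that by (auto simp: L_def intro: antisym)
  then have "finite L" by (metis finite.emptyI finite_insert finite_subset equals0I)
  moreover have "R \<subseteq> {x}" if "x \<in> R" for x using that by (auto simp: R_def intro: antisym)
  then have "finite R" by (metis finite.emptyI finite_insert finite_subset equals0I)
  ultimately show ?thesis by (meson countable_finite countable_subset finite_UnI)
qed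

lemma rational_interval_around:
  fixes I :: "real set"
  assumes x: "x \<in> interior I" and e: "eventually P (at x within I)" "P x"
  obtains a b where "a \<in> \<rat>" "b \<in> \<rat>" "a < x" "x < b" "{a..b} \<subseteq> I" "\<And>y. y \<in> {a..b} \<Longrightarrow> P y"
proof -
  obtain d1 where d1: "d1 > 0" "ball x d1 \<subseteq> I" using x by (auto simp: mem_interior)
  obtain d2 where d2: "d2 > 0" "\<And>y. y \<in> I \<Longrightarrow> y \<noteq> x \<Longrightarrow> dist y x < d2 \<Longrightarrow> P y"
    using e(1) unfolding eventually_at by blast
  define d where "d = min d1 d2"
  have d: "d > 0" using d1 d2 by (simp add: d_def)
  obtain a where a: "a \<in> \<rat>" "x - d < a" "a < x" using Rats_dense_in_real[of "x - d" x] d by auto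
  obtain b where b: "b \<in> \<rat>" "x < b" "b < x + d" using Rats_dense_in_real[of x "x + d"] d by auto
  have 1: "dist y x < d" if "y \<in> {a..b}" for y using that a b by (auto simp: dist_real_def abs_if)
  have 2: "y \<in> I" if "y \<in> {a..b}" for y
    using 1[OF that] d1(2) by (auto simp: d_def dist_commute)
  show thesis
  proof (rule that[OF a(1) b(1) a(3) b(2)])
    show "P y" if "y \<in> {a..b}" for y
      using d2(2)[OF 2[OF that]] 1[OF that] e(2) by (cases "y = x") (auto simp: d_def)
  qed (use 2 in blast)
qed

text \<open>By the mean value theorem \<open>f1\<close> vanishes at most once on an interval where
  \<open>f2\<close> has no zero. So the zeros of \<open>f1\<close> away from those of
  \<open>f2\<close> are countable; rational endpoints make the covering families countable.\<close>

lemma mult_approx_curve_null_interval: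
  fixes I :: "real set"
  assumes I: "is_interval I"
    and f: "\<And>x. x \<in> I \<Longrightarrow> (f has_real_derivative f1 x) (at x within I)"
    and f1: "\<And>x. x \<in> I \<Longrightarrow> (f1 has_real_derivative f2 x) (at x within I)"
    and f2: "continuous_on I f2" "hnull s {x \<in> I. f2 x = 0}"
    and v: "v > 1" and s: "2 / (1 + v) < s" "s < 1" "s * v \<le> 2"
  shows "hnull s {x \<in> I. (x, f x) \<in> mult_approx v}"
proof -
  define J where "J = {(a, b). a \<in> \<rat> \<and> b \<in> \<rat> \<and> a < b \<and> {a..b} \<subseteq> I \<and> (\<forall>x\<in>{a..b}. f2 x \<noteq> 0)}"
  define J1 where "J1 = {(a, b) \<in> J. \<forall>x\<in>{a..b}. f1 x \<noteq> 0}"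
  have "countable (\<rat> \<times> \<rat> :: (real \<times> real) set)" by (intro countable_SIGMA countable_rat)
  then have cJ: "countable J" by (rule countable_subset[rotated]) (auto simp: J_def)
  then have cJ1: "countable J1" by (rule countable_subset[rotated]) (auto simp: J1_def)
  have c1: "continuous_on I f1" using f1 by (intro DERIV_continuous_on)
  define N1 where "N1 = (\<Union>(a, b)\<in>J. {x \<in> {a..b}. f1 x = 0})"
  define N2 where "N2 = (\<Union>(a, b)\<in>J1. {x \<in> {a..b}. (x, f x) \<in> mult_approx v})"
  have fab: "(f has_real_derivative f1 x) (at x within {a..b})" "(f1 has_real_derivative f2 x) (at x within {a..b})"
    if ab: "{a..b} \<subseteq> I" "x \<in> {a..b}" for a b x
  proof -
    have "x \<in> I" using ab by blast
    show "(f has_real_derivative f1 x) (at x within {a..b})" by (rule DERIV_subset[OF f[OF \<open>x \<in> I\<close>] ab(1)])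
    show "(f1 has_real_derivative f2 x) (at x within {a..b})" by (rule DERIV_subset[OF f1[OF \<open>x \<in> I\<close>] ab(1)])
  qed
  have "countable {x \<in> {a..b}. f1 x = 0}" if "(a, b) \<in> J" for a b
  proof -
    have ab: "{a..b} \<subseteq> I" "\<And>x. x \<in> {a..b} \<Longrightarrow> f2 x \<noteq> 0" using that by (auto simp: J_def)
    have "x = y" if xy: "x \<in> {a..b}" "y \<in> {a..b}" "f1 x = 0" "f1 y = 0" for x y
    proof (rule ccontr)
      have *: False if "x \<in> {a..b}" "y \<in> {a..b}" "f1 x = 0" "f1 y = 0" "x < y" for x y
      proof -
        have "\<exists>z\<in>{x<..<y}. f1 y - f1 x = (\<lambda>h. f2 z * h) (y - x)"
        proof (rule mvt_simple[OF \<open>x < y\<close>])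
          fix z assume z: "x \<le> z" "z \<le> y"
          have sub: "{x..y} \<subseteq> I" using ab(1) that by auto
          show "(f1 has_derivative (\<lambda>h. f2 z * h)) (at z within {x..y})"
            using fab(2)[OF sub, of z] z by (simp add: has_field_derivative_def)
        qed
        then obtain z where z: "z \<in> {x<..<y}" "f1 y - f1 x = f2 z * (y - x)" by blast
        then have "f2 z = 0" using that by simp
        moreover have "z \<in> {a..b}" using z that by simp
        ultimately show False using ab(2) by blast
      qed
      assume "x \<noteq> y"
      then show False using *[of x y] *[of y x] xy by (cases x y rule: linorder_cases) auto
    qed
    then have "\<And>z. z \<in> {x \<in> {a..b}. f1 x = 0} \<Longrightarrow> {x \<in> {a..b}. f1 x = 0} \<subseteq> {z}" by blast
    then have "finite {x \<in> {a..b}. f1 x = 0}"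
      by (cases "{x \<in> {a..b}. f1 x = 0} = {}") (auto intro: finite_subset)
    then show ?thesis by (rule countable_finite)
  qed
  then have "countable N1" unfolding N1_def using cJ by (intro countable_UN) auto
  then have n1: "hnull s N1" by (rule hnull_countable)
  have n2: "hnull s N2"
    unfolding N2_def
  proof (rule hnull_UN_countable[OF cJ1])
    fix z assume z: "z \<in> J1"
    obtain a b where ab: "z = (a, b)" by (cases z)
    have *: "a < b" "{a..b} \<subseteq> I" "\<And>x. x \<in> {a..b} \<Longrightarrow> f2 x \<noteq> 0" "\<And>x. x \<in> {a..b} \<Longrightarrow> f1 x \<noteq> 0"
      using z by (auto simp: ab J1_def J_def)
    have "hnull s {x \<in> {a..b}. (x, f x) \<in> mult_approx v}"
      by (rule curve_null_compact[OF *(1) fab(1)[OF *(2)] fab(2)[OF *(2)] continuous_on_subset[OF f2(1) *(2)] *(3) *(4) v s])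
    then show "hnull s (case z of (a, b) \<Rightarrow> {x \<in> {a..b}. (x, f x) \<in> mult_approx v})" by (simp add: ab)
  qed
  have sub: "{x \<in> I. (x, f x) \<in> mult_approx v} \<subseteq> (I - interior I) \<union> ({x \<in> I. f2 x = 0} \<union> (N1 \<union> N2))"
  proof
    fix x assume x: "x \<in> {x \<in> I. (x, f x) \<in> mult_approx v}"
    show "x \<in> (I - interior I) \<union> ({x \<in> I. f2 x = 0} \<union> (N1 \<union> N2))"
    proof (cases "x \<in> interior I \<and> f2 x \<noteq> 0")
      case True
      have xI: "x \<in> I" using x by simp
      have ne: "eventually (\<lambda>y. \<phi> y \<noteq> 0) (at x within I)" if "continuous_on I \<phi>" "\<phi> x \<noteq> 0" for \<phi> :: "real \<Rightarrow> real"
        using that xI unfolding continuous_on_def by (intro tendsto_imp_eventually_ne) auto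
      show ?thesis
      proof (cases "f1 x = 0")
        case f10: True
        obtain a b where ab: "a \<in> \<rat>" "b \<in> \<rat>" "a < x" "x < b" "{a..b} \<subseteq> I" "\<And>y. y \<in> {a..b} \<Longrightarrow> f2 y \<noteq> 0"
          by (rule rational_interval_around[of x I "\<lambda>y. f2 y \<noteq> 0"]) (use True ne[OF f2(1)] in auto)
        then have "(a, b) \<in> J" by (auto simp: J_def)
        then have "x \<in> N1" using ab f10 unfolding N1_def by (intro UN_I[of "(a, b)"]) auto
        then show ?thesis by blast
      next
        case f10: False
        have "eventually (\<lambda>y. f2 y \<noteq> 0 \<and> f1 y \<noteq> 0) (at x within I)"
          using ne[OF f2(1)] ne[OF c1] True f10 by (intro eventually_conj) auto
        then obtain a b where ab: "a \<in> \<rat>" "b \<in> \<rat>" "a < x" "x < b" "{a..b} \<subseteq> I" "\<And>y. y \<in> {a..b} \<Longrightarrow> f2 y \<noteq> 0 \<and> f1 y \<noteq> 0"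
          using rational_interval_around[of x I "\<lambda>y. f2 y \<noteq> 0 \<and> f1 y \<noteq> 0"] True f10 by metis
        then have "(a, b) \<in> J1" by (auto simp: J_def J1_def)
        then have "x \<in> N2" using ab x unfolding N2_def by (intro UN_I[of "(a, b)"]) auto
        then show ?thesis by blast
      qed
    qed (use x in auto)
  qed
  show ?thesis
    by (rule hnull_subset[OF hnull_Un[OF hnull_countable[OF interval_endpoints_countable[OF I]] hnull_Un[OF f2(2) hnull_Un[OF n1 n2]]] sub])
qed

text \<open>The graph map is known to be Lipschitz only on compact pieces, as \<open>f1\<close> may
  be unbounded on an interval that is not compact; countably many pieces suffice.\<close>

lemma hnull_graph:
  fixes I :: "real set"
  assumes I: "is_interval I" and s: "0 < s"
    and f: "\<And>x. x \<in> I \<Longrightarrow> (f has_real_derivative f1 x) (at x within I)" and f1: "continuous_on I f1"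
    and N: "hnull s N" "N \<subseteq> I"
  shows "hnull s ((\<lambda>x. (x, f x)) ` N)"
proof -
  let ?h = "\<lambda>x. (x, f x)"
  define J where "J = {(a, b). a \<in> \<rat> \<and> b \<in> \<rat> \<and> a < b \<and> {a..b} \<subseteq> I}"
  have "countable (\<rat> \<times> \<rat> :: (real \<times> real) set)" by (intro countable_SIGMA countable_rat)
  then have cJ: "countable J" by (rule countable_subset[rotated]) (auto simp: J_def)
  have "hnull s (\<Union>z\<in>J. ?h ` (N \<inter> {fst z..snd z}))"
  proof (rule hnull_UN_countable[OF cJ])
    fix z assume z: "z \<in> J"
    obtain a b where ab: "z = (a, b)" by (cases z)
    have abI: "a < b" "{a..b} \<subseteq> I" using z by (auto simp: ab J_def)
    have "bounded (f1 ` {a..b})"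
      by (intro compact_imp_bounded compact_continuous_image continuous_on_subset[OF f1 abI(2)]) auto
    then obtain L where L: "\<forall>x\<in>{a..b}. \<bar>f1 x\<bar> \<le> L" unfolding bounded_iff by auto
    have "\<bar>f x - f y\<bar> \<le> L * \<bar>x - y\<bar>" if "x \<in> {a..b}" "y \<in> {a..b}" for x y
    proof -
      have "norm (f x - f y) \<le> L * norm (x - y)"
      proof (rule field_differentiable_bound[of "{a..b}" f f1 L x y])
        fix u assume "u \<in> {a..b}"
        then show "(f has_field_derivative f1 u) (at u within {a..b})" using f abI(2) DERIV_subset by blast
      qed (use L that in auto)
      then show ?thesis by simp
    qed
    then have lip: "dist (?h x) (?h y) \<le> (1 + L) * dist x y" if "x \<in> N \<inter> {a..b}" "y \<in> N \<inter> {a..b}" for x y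
    proof -
      have "dist (?h x) (?h y) \<le> dist x y + dist (f x) (f y)"
        unfolding dist_Pair_Pair using sqrt_sum_squares_le_sum[of "dist x y" "dist (f x) (f y)"] by simp
      also have "dist (f x) (f y) \<le> L * dist x y"
        using \<open>\<And>x y. x \<in> {a..b} \<Longrightarrow> y \<in> {a..b} \<Longrightarrow> \<bar>f x - f y\<bar> \<le> L * \<bar>x - y\<bar>\<close> that by (simp add: dist_real_def)
      finally show ?thesis by (simp add: algebra_simps)
    qed
    show "hnull s (?h ` (N \<inter> {fst z..snd z}))"
      by (rule hnull_lipschitz_image[OF _ s, of _ _ "1 + L"]) (use lip hnull_subset[OF N(1)] in \<open>auto simp: ab\<close>)
  qed
  moreover have "hnull s (?h ` (I - interior I))"
    by (intro hnull_countable countable_image interval_endpoints_countable I)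
  moreover have "?h ` N \<subseteq> ?h ` (I - interior I) \<union> (\<Union>z\<in>J. ?h ` (N \<inter> {fst z..snd z}))"
  proof
    fix y assume "y \<in> ?h ` N"
    then obtain x where x: "x \<in> N" "y = ?h x" by blast
    show "y \<in> ?h ` (I - interior I) \<union> (\<Union>z\<in>J. ?h ` (N \<inter> {fst z..snd z}))"
    proof (cases "x \<in> interior I")
      case True
      obtain a b where ab: "a \<in> \<rat>" "b \<in> \<rat>" "a < x" "x < b" "{a..b} \<subseteq> I"
        by (rule rational_interval_around[of x I "\<lambda>_. True"]) (use True in auto)
      then have "(a, b) \<in> J" by (auto simp: J_def)
      moreover have "y \<in> ?h ` (N \<inter> {fst (a, b)..snd (a, b)})" using x ab by auto
      ultimately show ?thesis by blast
    qed (use x N(2) in auto)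
  qed
  ultimately show ?thesis using hnull_Un hnull_subset by blast
qed

section \<open>The dimension formula\<close>

theorem theorem6:
  fixes I\<^sub>0 :: "real set" and f :: "real \<Rightarrow> real" and v :: real
  assumes "is_interval I\<^sub>0" and "\<exists>a\<in>I\<^sub>0. \<exists>b\<in>I\<^sub>0. a < b"
    and "Ck_on 3 f I\<^sub>0"
    and "v > 1"
    and "hausdorff_dim {x \<in> I\<^sub>0. (deriv_within I\<^sub>0 ^^ 2) f x = 0} \<le> ennreal (2 / (1 + v))"
  shows "hausdorff_dim ({(x, f x) | x. x \<in> I\<^sub>0} \<inter> mult_approx v) = ennreal (2 / (1 + v))"
proof (rule antisym)
  define d where "d = 2 / (1 + v)"
  have d: "0 < d" "d < 1" "d * v < 2" using assms(4) by (auto simp: d_def field_simps)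
  define f1 where "f1 = deriv_within I\<^sub>0 f"
  define f2 where "f2 = deriv_within I\<^sub>0 f1"
  have f2e: "(deriv_within I\<^sub>0 ^^ 2) f = f2" by (simp add: f2_def f1_def numeral_2_eq_2)
  have diff: "(deriv_within I\<^sub>0 ^^ j) f differentiable_on I\<^sub>0" if "j < 3" for j
    using assms(3) that by (simp add: Ck_on_def)
  have deriv: "(\<phi> has_real_derivative deriv_within I\<^sub>0 \<phi> x) (at x within I\<^sub>0)"
    if "\<phi> differentiable_on I\<^sub>0" "x \<in> I\<^sub>0" for \<phi> :: "real \<Rightarrow> real" and x
    using that vector_derivative_works[of \<phi> "at x within I\<^sub>0"]
    by (simp add: deriv_within_def differentiable_on_def has_real_derivative_iff_has_vector_derivative)
  have D0: "f differentiable_on I\<^sub>0" using diff[of 0] by simp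
  have D1: "f1 differentiable_on I\<^sub>0" using diff[of 1] by (simp add: f1_def)
  have D2: "f2 differentiable_on I\<^sub>0" using diff[of 2] by (simp add: f2e)
  have h1: "(f has_real_derivative f1 x) (at x within I\<^sub>0)" if "x \<in> I\<^sub>0" for x
    unfolding f1_def by (rule deriv[OF D0 that])
  have h2: "(f1 has_real_derivative f2 x) (at x within I\<^sub>0)" if "x \<in> I\<^sub>0" for x
    unfolding f2_def by (rule deriv[OF D1 that])
  have c1: "continuous_on I\<^sub>0 f1" "continuous_on I\<^sub>0 f2"
    using D1 D2 by (auto intro: differentiable_imp_continuous_on)
  let ?h = "\<lambda>x. (x, f x)"
  define N where "N = {x \<in> I\<^sub>0. ?h x \<in> mult_approx v}"
  have curve: "{(x, f x) | x. x \<in> I\<^sub>0} \<inter> mult_approx v = ?h ` N" by (auto simp: N_def)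
  show "hausdorff_dim ({(x, f x) | x. x \<in> I\<^sub>0} \<inter> mult_approx v) \<le> ennreal (2 / (1 + v))"
    unfolding curve d_def[symmetric]
  proof (rule hausdorff_dim_leI)
    fix s assume s: "s > d"
    \<comment> \<open>The covering argument works for exponents between d and the smaller of 1 and 2
      / v. This window is nonempty because d < 1 and d v < 2, and larger exponents follow by
      monotonicity.\<close>
    define s' where "s' = min s (min ((d + 1) / 2) (2 / v))"
    have "d < 2 / v" using d(3) assms(4) by (simp add: field_simps)
    then have ds': "d < s'" using s d by (simp add: s'_def)
    have s'1: "s' < 1" using d by (simp add: s'_def min_less_iff_disj)
    have "s' \<le> 2 / v" by (simp add: s'_def)
    then have s'2: "s' * v \<le> 2" using assms(4) by (simp add: field_simps)
    have nz: "hnull s' {x \<in> I\<^sub>0. f2 x = 0}"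
      using hausdorff_dim_le_imp_hnull[OF assms(5)[folded d_def, unfolded f2e] ds'] d by simp
    have "hnull s' N"
      unfolding N_def
      by (rule mult_approx_curve_null_interval[OF assms(1) h1 h2 c1(2) nz assms(4) ds'[unfolded d_def] s'1 s'2])
    then have "hnull s' (?h ` N)"
      using ds' d by (intro hnull_graph[OF assms(1) _ h1 c1(1)]) (auto simp: N_def)
    then show "hnull s (?h ` N)"
      by (rule hnull_mono_exponent) (use ds' d in linarith, simp add: s'_def)
  qed (use d in simp)
  show "ennreal (2 / (1 + v)) \<le> hausdorff_dim ({(x, f x) | x. x \<in> I\<^sub>0} \<inter> mult_approx v)"
    unfolding curve d_def[symmetric]
  proof (rule hausdorff_dim_geI[OF d(1)])
    fix s assume s: "0 < s" "s < d"
    obtain a b where ab: "a \<in> I\<^sub>0" "b \<in> I\<^sub>0" "a < b" using assms(2) by blast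
    have abI: "{a..b} \<subseteq> I\<^sub>0" using assms(1) ab unfolding is_interval_1 by (meson atLeastAtMost_iff subsetI)
    let ?E = "{x \<in> {a..b}. infinite {q::nat. q > 0 \<and> dist_int (real q * x) < real q powr (- v)}}"
    \<comment> \<open>Projection to the first coordinate does not increase distances, so it is
      enough that the shadow of the set contains the approximable numbers of [a, b].\<close>
    have sub: "?E \<subseteq> fst ` ?h ` N"
    proof
      fix x assume x: "x \<in> ?E"
      have "{q::nat. q > 0 \<and> dist_int (real q * x) < real q powr (- v)} \<subseteq>
          {q::nat. q > 0 \<and> dist_int (real q * x) * dist_int (real q * f x) < real q powr (- v)}"
      proof clarify
        fix q :: nat assume q: "0 < q" "dist_int (real q * x) < real q powr (- v)"
        have "dist_int (real q * x) * dist_int (real q * f x) \<le> dist_int (real q * x) * 1"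
          using dist_int_nonneg[of "real q * x"] dist_int_half[of "real q * f x"] by (intro mult_left_mono) auto
        then show "dist_int (real q * x) * dist_int (real q * f x) < real q powr (- v)" using q by simp
      qed
      then have "?h x \<in> mult_approx v" using x by (auto simp: mult_approx_def dest: finite_subset)
      then show "x \<in> fst ` ?h ` N" using x abI by (force simp: N_def image_image)
    qed
    show "\<not> hnull s (?h ` N)"
    proof
      assume "hnull s (?h ` N)"
      then have "hnull s (fst ` ?h ` N)"
        by (rule hnull_lipschitz_image[OF _ s(1), of _ _ 1]) (use dist_fst_le in auto)
      then have "hnull s ?E" using sub by (rule hnull_subset)
      then show False using jarnik_besicovitch_not_null[OF s(1) s(2)[unfolded d_def] assms(4) ab(3)] by blast
    qed
  qed
qed

end
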